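(* Let $\ell$ be a prime not dividing $48$ (i.e. $\ell\ge 5$), and let $\Phi_\ell(x,y)\in\mathbb{Z}[x,y]$ be the modular polynomial of level $\ell$ with respect to the Weber function $\mathfrak{f}$. Then the coefficient of the monomial $x^iy^j$ in $\Phi_\ell(x,y)$ is nonzero only if $i+\ell j\equiv \ell+1 \pmod{24}$.
   Context: For $\tau$ in the complex upper half plane put $q=e^{2\pi i\tau}$, and let $\eta(\tau)=q^{1/24}\prod_{k\ge1}(1-q^k)$ be the Dedekind eta function, where $q^{1/24}=e^{2\pi i\tau/24}$. With $\zeta_{48}=e^{2\pi i/48}$, the Weber function is $$\mathfrak{f}(\tau)=\zeta_{48}^{-1}\,\frac{\eta\left(\frac{\tau+1}{2}\right)}{\eta(\tau)}.$$ It is a modular function of level $48$ and satisfies $j=(\mathfrak{f}^{24}-16)^3/\mathfrak{f}^{24}$. The modular polynomial $\Phi_\ell(x,y)$ with respect to $\mathfrak{f}$ is the irreducible polynomial in $\mathbb{Z}[x,y]$ (unique up to sign) such that $\Phi_\ell(\mathfrak{f}(\tau),\mathfrak{f}(\ell\tau))=0$ identically in $\tau$. For example $\Phi_5(x,y)=x^6-x^5y^5+4xy+y^6$. *)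

theory Defs
  imports
    "HOL-Complex_Analysis.Complex_Analysis"
    "HOL-Computational_Algebra.Computational_Algebra"
    "HOL-Number_Theory.Cong"
begin

definition dedekind_eta :: "complex \<Rightarrow> complex" where
  "dedekind_eta \<tau> =
     exp (2 * of_real pi * \<i> * \<tau> / 24) * (\<Prod>k. 1 - exp (2 * of_real pi * \<i> * \<tau>) ^ Suc k)"

definition weber_f :: "complex \<Rightarrow> complex" where
  "weber_f \<tau> =
     inverse (exp (2 * of_real pi * \<i> / 48)) * (dedekind_eta ((\<tau> + 1) / 2) / dedekind_eta \<tau>)"

(* The ring Z[x,y] is represented as (Z[x])[y]: the coefficient of x^i y^j
   in P is coeff (coeff P j) i. *)

definition eval_xy :: "int poly poly \<Rightarrow> complex \<Rightarrow> complex \<Rightarrow> complex" where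
  "eval_xy P x y = poly (map_poly (\<lambda>p. poly (map_poly of_int p) x) P) y"

lemma eval_xy_altdef:
  "eval_xy P x y =
     (\<Sum>j\<le>degree P. \<Sum>i\<le>degree (coeff P j). of_int (coeff (coeff P j) i) * x ^ i * y ^ j)"
proof -
  have inner: "poly (map_poly of_int p) x = (\<Sum>i\<le>degree p. of_int (coeff p i) * x ^ i)"
    for p :: "int poly"
    by (subst poly_altdef) (simp add: degree_map_poly coeff_map_poly)
  have "eval_xy P x y =
      (\<Sum>j\<le>degree P. coeff (map_poly (\<lambda>p. poly (map_poly of_int p) x) P) j * y ^ j)"
    unfolding eval_xy_def poly_altdef[of "map_poly (\<lambda>p. poly (map_poly of_int p) x) P"]
  proof (intro sum.mono_neutral_left)
    have "degree (map_poly (\<lambda>p. poly (map_poly of_int p) x) P) \<le> degree P"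
      by (intro degree_le) (simp add: coeff_map_poly coeff_eq_0)
    then show "{..degree (map_poly (\<lambda>p. poly (map_poly of_int p) x) P)} \<subseteq> {..degree P}"
      by simp
  qed (auto simp: coeff_eq_0)
  also have "\<dots> = (\<Sum>j\<le>degree P. poly (map_poly of_int (coeff P j)) x * y ^ j)"
    by (simp add: coeff_map_poly)
  finally show ?thesis
    by (simp add: inner sum_distrib_right)
qed

(* These two conditions determine P up to sign, so a statement about every such P
   is a statement about the modular polynomial. *)

definition is_weber_modular_poly :: "nat \<Rightarrow> int poly poly \<Rightarrow> bool" where
  "is_weber_modular_poly l P \<longleftrightarrow>
     irreducible P \<and> (\<forall>\<tau>. Im \<tau> > 0 \<longrightarrow> eval_xy P (weber_f \<tau>) (weber_f (of_nat l * \<tau>)) = 0)"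

end

theory Submission
  imports Defs "HOL-Real_Asymp.Real_Asymp"
begin

text \<open>
Write \<open>x = weber_f \<tau>\<close> and \<open>y = weber_f (l * \<tau>)\<close>. Translating \<open>\<tau>\<close> by \<open>2\<close> multiplies \<open>x\<close> and \<open>y\<close> by
\<open>\<zeta>\<close> and \<open>\<zeta> ^ l\<close> for a primitive 24th root of unity \<open>\<zeta>\<close>, so every graded piece of \<open>\<Phi>\<close> with
respect to \<open>i + l * j\<close> modulo \<open>24\<close> vanishes on the curve and is a multiple of \<open>\<Phi>\<close>. Hence \<open>\<Phi>\<close> is
homogeneous, and it suffices that the coefficient of \<open>x * y\<close> is not zero.

This coefficient is read off modulo \<open>l\<close>. As \<open>y\<close> is congruent to \<open>x ^ l\<close>, and by inversion the
roles of \<open>x\<close> and \<open>y\<close> can be exchanged, \<open>\<Phi>\<close> is divisible by \<open>y - x ^ l\<close> and by \<open>x - y ^ l\<close> modulo \<open>l\<close>;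
if its degrees in \<open>x\<close> and \<open>y\<close> are at most \<open>l + 1\<close>, the coefficient of \<open>x * y\<close> cannot be divisible by
\<open>l\<close> without all the others being so too.

For the degrees one needs some relation between \<open>x\<close> and \<open>y\<close> of degree at most \<open>l + 1\<close> in \<open>y\<close>. The function
\<open>y / x ^ l\<close> has \<open>l + 1\<close> conjugates under the theta group, generated by \<open>\<tau> + 2\<close> and \<open>- 1 / \<tau>\<close>. Linear
algebra over the integers gives a polynomial in \<open>x ^ 24\<close> and \<open>y / x ^ l\<close> vanishing at infinity to an order
so high that its norm decays at both cusps; by the maximum modulus principle the norm is \<open>0\<close>.
\<close>

section \<open>Product expansion\<close>

text \<open>The multiplier of \<open>weber_f\<close> on integral matrices with even off-diagonal
  entries is a 24th root of unity given by an awkward formula. It becomes linear in the off-diagonal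
  entries when the lower right entry is prime to 3, and with l^2 = 1 modulo 24 this lets the l + 1
  conjugates be rescaled so that no stray roots of unity remain when they are permuted. The theta
  group has two cusps, infinity and 1. The Weber function has a pole at the first and tends to 0 at
  the second, so y / x^l is bounded at infinity but has a pole at 1, which a fixed power of x^24
  compensates. The order at infinity can be forced because about A * (l + 2) coefficients face about
  A * (l + 1) conditions. Once the norm is 0, some conjugate satisfies the relation, and the
  generators of the group carry it to y / x^l itself. Modulo l the result is explicit: \<Phi> is a
  multiple of (y - x^l) * (x - y^l) = x * y - x^(l + 1) - y^(l + 1) + x^l * y^l, where x * y has
  coefficient 1.\<close>

text \<open>For \<open>p = exp (\<i> * pi * \<tau>)\<close> and \<open>x = exp (2 * \<i> * pi * z)\<close>, \<open>odd_prod p x * odd_prod p (1 / x)\<close> is the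
  Jacobi theta product without the factors \<open>1 - p ^ (2 * n)\<close>; up to an exponential factor
  the Weber function is the case \<open>x = 1\<close>.\<close>
definition odd_prod :: "complex \<Rightarrow> complex \<Rightarrow> complex" where
  "odd_prod p x = (\<Prod>n. 1 + p ^ (2 * n + 1) * x)"

lemma summable_odd_powers:
  assumes "norm p < 1"
  shows "summable (\<lambda>n. norm (p ^ (2 * n + 1) * (x::complex)))"
    and "(\<Sum>n. norm (p ^ (2 * n + 1) * x)) = norm p / (1 - norm p ^ 2) * norm x"
proof -
  have eq: "norm (p ^ (2 * n + 1) * x) = (norm p * norm x) * (norm p ^ 2) ^ n" for n
    by (simp add: norm_mult norm_power power_mult)
  have lt: "norm (norm p ^ 2) < 1"
    using assms by (simp add: power_less_one_iff)
  have "(\<lambda>n. (norm p * norm x) * (norm p ^ 2) ^ n) sums ((norm p * norm x) * (1 / (1 - norm p ^ 2)))"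
    by (intro sums_mult geometric_sums lt)
  hence s: "(\<lambda>n. norm (p ^ (2 * n + 1) * x)) sums (norm p / (1 - norm p ^ 2) * norm x)"
    unfolding eq by (simp add: field_simps)
  show "summable (\<lambda>n. norm (p ^ (2 * n + 1) * x))"
    using s by (rule sums_summable)
  show "(\<Sum>n. norm (p ^ (2 * n + 1) * x)) = norm p / (1 - norm p ^ 2) * norm x"
    using s by (rule sums_unique[symmetric])
qed

lemma convergent_odd_prod:
  assumes "norm p < 1"
  shows "convergent_prod (\<lambda>n. 1 + p ^ (2 * n + 1) * (x::complex))"
  by (intro abs_convergent_prod_imp_convergent_prod summable_imp_abs_convergent_prod)
     (use summable_odd_powers(1)[OF assms] in simp)

lemma odd_prod_LIMSEQ:
  assumes "norm p < 1"
  shows "(\<lambda>N. \<Prod>n<N. 1 + p ^ (2 * n + 1) * x) \<longlonglongrightarrow> odd_prod p x"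
  using convergent_prod_LIMSEQ[OF convergent_odd_prod[OF assms]] unfolding odd_prod_def
  by (subst (asm) lessThan_Suc_atMost [symmetric]) (rule LIMSEQ_imp_Suc)

text \<open>Peeling off K factors leaves the same product at the small argument p^(2 * K) * x, so a
  truncation error is an instance of the bound on \<open>odd_prod p x - 1\<close>.\<close>

lemma odd_prod_split:
  assumes "norm p < 1"
  shows "odd_prod p x = (\<Prod>n<K. 1 + p ^ (2 * n + 1) * x) * odd_prod p (p ^ (2 * K) * x)"
proof -
  have "(\<lambda>n. 1 + p ^ (2 * n + 1) * x) has_prod
      ((\<Prod>n<K. 1 + p ^ (2 * n + 1) * x) * (\<Prod>n. 1 + p ^ (2 * (n + K) + 1) * x))"
    by (rule has_prod_ignore_initial_segment'[OF convergent_odd_prod[OF assms]])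
  hence "odd_prod p x = (\<Prod>n<K. 1 + p ^ (2 * n + 1) * x) * (\<Prod>n. 1 + p ^ (2 * (n + K) + 1) * x)"
    unfolding odd_prod_def by (rule has_prod_unique[symmetric])
  thus ?thesis
    by (simp add: odd_prod_def algebra_simps power_add)
qed

lemma odd_prod_shift:
  assumes "norm p < 1"
  shows "odd_prod p x = (1 + p * x) * odd_prod p (p ^ 2 * x)"
  using odd_prod_split[OF assms, of x 1] by simp

lemma odd_prod_eq_0_iff:
  assumes "norm p < 1"
  shows "odd_prod p x = 0 \<longleftrightarrow> (\<exists>n. 1 + p ^ (2 * n + 1) * x = 0)"
  unfolding odd_prod_def
  using has_prod_eq_0_iff[OF convergent_prod_has_prod[OF convergent_odd_prod[OF assms, of x]]] by (auto simp: image_iff eq_commute[of 0])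

lemma norm_odd_prod_minus_1_le:
  assumes "norm p < 1"
  shows "norm (odd_prod p x - 1) \<le> exp (norm p / (1 - norm p ^ 2) * norm x) - 1"
proof (rule LIMSEQ_le_const2)
  show "(\<lambda>N. norm ((\<Prod>n<N. 1 + p ^ (2 * n + 1) * x) - 1)) \<longlonglongrightarrow> norm (odd_prod p x - 1)"
    by (intro tendsto_intros odd_prod_LIMSEQ assms)
  have "norm ((\<Prod>n<N. 1 + p ^ (2 * n + 1) * x) - 1) \<le> exp (norm p / (1 - norm p ^ 2) * norm x) - 1" for N
  proof -
    have "norm ((\<Prod>n<N. 1 + p ^ (2 * n + 1) * x) - 1) \<le> (\<Prod>n<N. 1 + norm (p ^ (2 * n + 1) * x)) - 1"
      by (rule norm_prod_minus1_le_prod_minus1)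
    also have "\<dots> \<le> exp (\<Sum>n<N. norm (p ^ (2 * n + 1) * x)) - 1"
      using prod_le_exp_sum[of "{..<N}" "\<lambda>n. norm (p ^ (2 * n + 1) * x)"] by simp
    also have "\<dots> \<le> exp (norm p / (1 - norm p ^ 2) * norm x) - 1"
      using sum_le_suminf[OF summable_odd_powers(1)[OF assms, of x], of "{..<N}"]
        summable_odd_powers(2)[OF assms, of x] by simp
    finally show ?thesis .
  qed
  thus "\<exists>N. \<forall>n\<ge>N. norm ((\<Prod>n<n. 1 + p ^ (2 * n + 1) * x) - 1)
      \<le> exp (norm p / (1 - norm p ^ 2) * norm x) - 1"
    by blast
qed

lemma norm_odd_prod_le:
  assumes "norm p < 1"
  shows "norm (odd_prod p x) \<le> exp (norm p / (1 - norm p ^ 2) * norm x)"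
  using norm_odd_prod_minus_1_le[OF assms, of x] norm_triangle_ineq[of "odd_prod p x - 1" 1] by simp

text \<open>Base and argument both vary, so that the lemma serves the Weber function (p moves, x =
  1) as well as the theta product (p fixed, x moves).\<close>

lemma holomorphic_odd_prod:
  assumes S: "open S" and holp: "p holomorphic_on S" and holx: "x holomorphic_on S"
    and lt: "\<And>z. z \<in> S \<Longrightarrow> norm (p z) < 1"
  shows "(\<lambda>z. odd_prod (p z) (x z)) holomorphic_on S"
proof (rule holomorphic_uniform_sequence[OF S])
  show "(\<lambda>z. \<Prod>n<N. 1 + p z ^ (2 * n + 1) * x z) holomorphic_on S" for N
    by (intro holomorphic_intros holp holx)
next
  fix z assume "z \<in> S"
  then obtain d where d: "d > 0" "cball z d \<subseteq> S"
    using S open_contains_cball by blast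
  have cont: "continuous_on (cball z d) p" "continuous_on (cball z d) x"
    using holp holx d holomorphic_on_imp_continuous_on continuous_on_subset by blast+
  \<comment> \<open>On the closed disc the base attains its largest modulus r < 1, and r^(2 * n + 1)
    * M is then a summable majorant.\<close>
  obtain w where w: "w \<in> cball z d" "\<And>v. v \<in> cball z d \<Longrightarrow> norm (p v) \<le> norm (p w)"
    using continuous_attains_sup[of "cball z d" "\<lambda>v. norm (p v)"] continuous_on_norm[OF cont(1)] d
    by auto
  define r where "r = norm (p w)"
  have r: "0 \<le> r" "r < 1" using w d lt by (auto simp: r_def)
  obtain M where M: "\<And>v. v \<in> cball z d \<Longrightarrow> norm (x v) \<le> M"
    using compact_imp_bounded[OF compact_continuous_image[OF cont(2) compact_cball]]
    unfolding bounded_iff by blast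
  have "uniformly_convergent_on (cball z d) (\<lambda>N v. \<Sum>n<N. norm (p v ^ (2 * n + 1) * x v))"
  proof (rule Weierstrass_m_test'_ev)
    have "norm (norm (p v ^ (2 * n + 1) * x v)) \<le> r ^ (2 * n + 1) * M" if "v \<in> cball z d" for v n
      using w(2)[OF that] M[OF that] r
      by (auto simp: norm_mult norm_power r_def simp del: power_Suc intro!: mult_mono power_mono)
    thus "\<forall>\<^sub>F n in sequentially. \<forall>v\<in>cball z d. norm (norm (p v ^ (2 * n + 1) * x v)) \<le> r ^ (2 * n + 1) * M"
      by simp
    have "norm (r ^ 2) < 1"
      using r by (simp add: power_less_one_iff)
    hence "summable (\<lambda>n. (r * M) * (r ^ 2) ^ n)"
      by (intro summable_mult summable_geometric)
    also have "(\<lambda>n. (r * M) * (r ^ 2) ^ n) = (\<lambda>n. r ^ (2 * n + 1) * M)"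
      by (rule ext) (simp add: power_mult [symmetric] mult_ac)
    finally show "summable (\<lambda>n. r ^ (2 * n + 1) * M)" .
  qed
  hence "uniformly_convergent_on (cball z d) (\<lambda>N v. \<Prod>n<N. 1 + p v ^ (2 * n + 1) * x v)"
    by (intro uniformly_convergent_on_prod) (auto intro!: continuous_intros cont)
  then obtain g where g: "uniform_limit (cball z d) (\<lambda>N v. \<Prod>n<N. 1 + p v ^ (2 * n + 1) * x v) g sequentially"
    by (auto simp: uniformly_convergent_on_def)
  have "g v = odd_prod (p v) (x v)" if "v \<in> cball z d" for v
    using tendsto_uniform_limitI[OF g that] odd_prod_LIMSEQ[of "p v" "x v"] lt[of v] d that
      LIMSEQ_unique by blast
  hence "uniform_limit (cball z d) (\<lambda>N v. \<Prod>n<N. 1 + p v ^ (2 * n + 1) * x v)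
      (\<lambda>v. odd_prod (p v) (x v)) sequentially"
    by (intro iffD1[OF uniform_limit_cong' g]) auto
  with d show "\<exists>d>0. cball z d \<subseteq> S \<and> uniform_limit (cball z d)
      (\<lambda>N v. \<Prod>n<N. 1 + p v ^ (2 * n + 1) * x v) (\<lambda>v. odd_prod (p v) (x v)) sequentially"
    by blast
qed

lemma odd_prod_minus: "odd_prod (- p) x = odd_prod p (- x)"
  by (simp add: odd_prod_def)

lemma odd_prod_times_odd_prod_minus:
  assumes "norm p < 1"
  shows "odd_prod p x * odd_prod p (- x) = odd_prod (p ^ 2) (- (x ^ 2))"
proof -
  have "odd_prod p x * odd_prod p (- x) =
      (\<Prod>n. (1 + p ^ (2 * n + 1) * x) * (1 + p ^ (2 * n + 1) * (- x)))"
    unfolding odd_prod_def by (intro prodinf_mult convergent_odd_prod assms)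
  also have "(\<lambda>n. (1 + p ^ (2 * n + 1) * x) * (1 + p ^ (2 * n + 1) * (- x))) =
      (\<lambda>n. 1 + (p ^ 2) ^ (2 * n + 1) * (- (x ^ 2)))"
    by (rule ext) (simp add: algebra_simps power2_eq_square power_mult_distrib)
  finally show ?thesis by (simp add: odd_prod_def)
qed

section \<open>Euler's product and its splitting into odd and even exponents\<close>

definition euler_prod :: "complex \<Rightarrow> complex" where
  "euler_prod q = (\<Prod>n. 1 - q ^ Suc n)"

lemma convergent_euler_prod:
  assumes "norm q < 1"
  shows "convergent_prod (\<lambda>n. 1 - (q::complex) ^ Suc n)"
proof (rule abs_convergent_prod_imp_convergent_prod, rule summable_imp_abs_convergent_prod)
  have "summable (\<lambda>n. norm q ^ Suc n)"
    using assms by (intro summable_Suc_iff[THEN iffD2] summable_geometric) simp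
  thus "summable (\<lambda>n. norm (1 - q ^ Suc n - 1))"
    by (simp add: norm_mult norm_power)
qed

lemma euler_prod_LIMSEQ:
  assumes "norm q < 1"
  shows "(\<lambda>N. \<Prod>n<N. 1 - q ^ Suc n) \<longlonglongrightarrow> euler_prod q"
  using convergent_prod_LIMSEQ[OF convergent_euler_prod[OF assms]] unfolding euler_prod_def
  by (subst (asm) lessThan_Suc_atMost [symmetric]) (rule LIMSEQ_imp_Suc)

lemma euler_prod_nonzero:
  assumes "norm q < 1"
  shows "euler_prod q \<noteq> 0"
proof -
  have "1 - q ^ Suc n \<noteq> 0" for n
  proof
    assume "1 - q ^ Suc n = 0"
    hence "norm (q ^ Suc n) = norm (1 :: complex)" by (simp only: right_minus_eq)
    hence "norm q ^ Suc n = 1" by (simp only: norm_power norm_one)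
    moreover have "norm q ^ Suc n < 1"
      using assms by (subst power_less_one_iff) auto
    ultimately show False by simp
  qed
  thus ?thesis
    unfolding euler_prod_def by (intro prodinf_nonzero convergent_euler_prod assms)
qed

lemma euler_prod_eq_odd_prod:
  assumes "norm p < 1"
  shows "euler_prod p = odd_prod p (- 1) * euler_prod (p ^ 2)"
proof (rule LIMSEQ_unique)
  have eq: "(\<Prod>k<2*N. 1 - p ^ Suc k) = (\<Prod>n<N. 1 + p ^ (2 * n + 1) * (- 1)) * (\<Prod>n<N. 1 - (p ^ 2) ^ Suc n)" for N
  proof (induction N)
    case (Suc N)
    have "1 - p ^ Suc (2 * N) = 1 + p ^ (2 * N + 1) * (- 1)"
      and "1 - p ^ Suc (Suc (2 * N)) = 1 - (p ^ 2) ^ Suc N"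
      by (simp_all add: power_mult power2_eq_square)
    with Suc show ?case
      by (simp only: mult_Suc_right prod.lessThan_Suc add_2_eq_Suc) (simp only: mult_ac)
  qed simp
  have "(\<lambda>N. (\<Prod>k<2*N. 1 - p ^ Suc k)) \<longlonglongrightarrow> euler_prod p"
    using LIMSEQ_subseq_LIMSEQ[OF euler_prod_LIMSEQ[OF assms], of "\<lambda>n. 2 * n"]
    by (simp add: strict_mono_def o_def)
  thus "(\<lambda>N. (\<Prod>n<N. 1 + p ^ (2 * n + 1) * (- 1)) * (\<Prod>n<N. 1 - (p ^ 2) ^ Suc n)) \<longlonglongrightarrow> euler_prod p"
    by (simp only: eq)
  show "(\<lambda>N. (\<Prod>n<N. 1 + p ^ (2 * n + 1) * (- 1)) * (\<Prod>n<N. 1 - (p ^ 2) ^ Suc n))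
      \<longlonglongrightarrow> odd_prod p (- 1) * euler_prod (p ^ 2)"
    by (intro tendsto_mult odd_prod_LIMSEQ euler_prod_LIMSEQ assms)
       (use assms in \<open>simp add: norm_power power_less_one_iff\<close>)
qed

text \<open>The factors 1 + p^(2n+1), 1 - p^(2n+1) and 1 + p^(2n+2) belong to the three classical
  Weber functions. The identity is Euler's theorem on partitions into odd and into distinct parts,
  at p^2. It later eliminates unknown constants and turns upper bounds into lower ones.\<close>

lemma odd_prod_triple:
  assumes "norm p < 1"
  shows "odd_prod p 1 * odd_prod p (- 1) * odd_prod p p = 1"
proof -
  have q: "norm (p ^ 2) < 1"
    using assms by (simp add: norm_power power_less_one_iff)
  have conv: "convergent_prod (\<lambda>n. 1 + p ^ (2 * n + 1) * p)"
    by (rule convergent_odd_prod[OF assms])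
  have "odd_prod p p * euler_prod (p ^ 2) =
      (\<Prod>n. (1 + p ^ (2 * n + 1) * p) * (1 - (p ^ 2) ^ Suc n))"
    unfolding odd_prod_def euler_prod_def
    by (intro prodinf_mult conv convergent_euler_prod q)
  also have "(\<lambda>n. (1 + p ^ (2 * n + 1) * p) * (1 - (p ^ 2) ^ Suc n)) = (\<lambda>n. 1 - ((p ^ 2) ^ 2) ^ Suc n)"
  proof
    fix n
    have "p ^ (2 * n + 1) * p = (p ^ 2) ^ Suc n"
      by (simp add: power_mult power2_eq_square)
    moreover have "((p ^ 2) ^ 2) ^ Suc n = (p ^ 2) ^ Suc n * (p ^ 2) ^ Suc n"
      by (simp only: power2_eq_square power_mult_distrib)
    ultimately show "(1 + p ^ (2 * n + 1) * p) * (1 - (p ^ 2) ^ Suc n) = 1 - ((p ^ 2) ^ 2) ^ Suc n"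
      by (simp only:) (simp only: algebra_simps diff_minus_eq_add add_diff_cancel_right' mult_1)
  qed
  finally have "odd_prod p p * euler_prod (p ^ 2) = euler_prod ((p ^ 2) ^ 2)"
    by (simp add: euler_prod_def)
  hence "odd_prod (p ^ 2) (- 1) * odd_prod p p * euler_prod (p ^ 2) = euler_prod (p ^ 2)"
    using euler_prod_eq_odd_prod[OF q] by (simp only: mult_ac)
  hence "odd_prod (p ^ 2) (- 1) * odd_prod p p = 1"
    using euler_prod_nonzero[OF q] by simp
  thus ?thesis
    using odd_prod_times_odd_prod_minus[OF assms, of 1] by simp
qed

section \<open>The Weber function as a product in the nome\<close>

definition nome :: "complex \<Rightarrow> complex" where
  "nome \<tau> = exp (\<i> * of_real pi * \<tau>)"

lemma norm_nome: "norm (nome \<tau>) = exp (- pi * Im \<tau>)"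
  by (simp add: nome_def)

lemma norm_nome_less_1: "Im \<tau> > 0 \<Longrightarrow> norm (nome \<tau>) < 1"
  by (simp add: norm_nome)

lemma nome_nonzero [simp]: "nome \<tau> \<noteq> 0"
  by (simp add: nome_def)

lemma nome_plus_1: "nome (\<tau> + 1) = - nome \<tau>"
  by (simp add: nome_def algebra_simps exp_add)

lemma nome_plus_2: "nome (\<tau> + 2) = nome \<tau>"
  using nome_plus_1[of "\<tau> + 1"] by (simp add: nome_plus_1 add.assoc)

lemma nome_of_nat_mult: "nome (of_nat n * \<tau>) = nome \<tau> ^ n"
  by (simp add: nome_def exp_of_nat_mult [symmetric] mult_ac)

text \<open>Passing from \<tau> to (\<tau> + 1) / 2 replaces q = nome^2 by - nome. In Euler's
  product at - nome the even exponents reproduce the product in \<eta>(\<tau>) and cancel; the odd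
  ones remain.\<close>

lemma weber_f_eq:
  assumes "Im \<tau> > 0"
  shows "weber_f \<tau> = exp (- (\<i> * of_real pi * \<tau> / 24)) * odd_prod (nome \<tau>) 1"
proof -
  have p: "norm (nome \<tau>) < 1" "norm (- nome \<tau>) < 1"
    using norm_nome_less_1[OF assms] by simp_all
  have e1: "exp (2 * of_real pi * \<i> * ((\<tau> + 1) / 2)) = - nome \<tau>"
  proof -
    have "exp (2 * of_real pi * \<i> * ((\<tau> + 1) / 2)) = nome (\<tau> + 1)"
      unfolding nome_def by (rule arg_cong[of _ _ exp]) (simp add: field_simps)
    thus ?thesis by (simp add: nome_plus_1)
  qed
  have e2: "exp (2 * of_real pi * \<i> * \<tau>) = nome \<tau> ^ 2"
    using nome_of_nat_mult[of 2 \<tau>] by (simp add: nome_def mult_ac)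
  have "dedekind_eta ((\<tau> + 1) / 2) =
      exp (2 * of_real pi * \<i> * ((\<tau> + 1) / 2) / 24) * euler_prod (- nome \<tau>)"
    by (simp only: dedekind_eta_def e1 euler_prod_def)
  also have "euler_prod (- nome \<tau>) = odd_prod (nome \<tau>) 1 * euler_prod (nome \<tau> ^ 2)"
    using euler_prod_eq_odd_prod[OF p(2)] by (simp add: odd_prod_minus)
  finally have 1: "dedekind_eta ((\<tau> + 1) / 2) =
      exp (2 * of_real pi * \<i> * ((\<tau> + 1) / 2) / 24) * (odd_prod (nome \<tau>) 1 * euler_prod (nome \<tau> ^ 2))" .
  have 2: "dedekind_eta \<tau> = exp (2 * of_real pi * \<i> * \<tau> / 24) * euler_prod (nome \<tau> ^ 2)"
    by (simp only: dedekind_eta_def e2 euler_prod_def)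
  have nz: "euler_prod (nome \<tau> ^ 2) \<noteq> 0"
    using p by (intro euler_prod_nonzero) (simp add: norm_power power_less_one_iff)
  \<comment> \<open>The constant \<zeta>_48 is exactly what the summand 1 / 2 in (\<tau> + 1) / 2
    contributes, so it cancels.\<close>
  have e3: "inverse (exp (2 * a / 48)) * (exp (2 * a * ((\<tau> + 1) / 2) / 24) / exp (2 * a * \<tau> / 24)) =
      exp (- (a * \<tau> / 24))" for a :: complex
    unfolding exp_minus [symmetric] exp_diff [symmetric] exp_add [symmetric]
    by (rule arg_cong[of _ _ exp]) (simp add: add_divide_distrib distrib_left)
  have "weber_f \<tau> = inverse (exp (2 * (of_real pi * \<i>) / 48)) *
      (exp (2 * (of_real pi * \<i>) * ((\<tau> + 1) / 2) / 24) / exp (2 * (of_real pi * \<i>) * \<tau> / 24)) *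
      odd_prod (nome \<tau>) 1"
    unfolding weber_f_def 1 2 using nz by (simp add: mult.assoc)
  also have "\<dots> = exp (- (\<i> * of_real pi * \<tau> / 24)) * odd_prod (nome \<tau>) 1"
    by (simp only: e3) (simp only: mult_ac)
  finally show ?thesis .
qed

lemma weber_f_nonzero:
  assumes "Im \<tau> > 0"
  shows "weber_f \<tau> \<noteq> 0"
proof -
  have "nome \<tau> ^ (2 * n + 1) \<noteq> - 1" for n
  proof
    assume "nome \<tau> ^ (2 * n + 1) = - 1"
    hence "norm (nome \<tau> ^ (2 * n + 1)) = norm (- 1 :: complex)" by (rule arg_cong)
    hence "norm (nome \<tau>) ^ (2 * n + 1) = 1" by (simp only: norm_power norm_minus_cancel norm_one)
    moreover have "norm (nome \<tau>) ^ (2 * n + 1) < 1"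
      using norm_nome_less_1[OF assms] by (subst power_less_one_iff) auto
    ultimately show False by simp
  qed
  hence "odd_prod (nome \<tau>) 1 \<noteq> 0"
    unfolding odd_prod_eq_0_iff[OF norm_nome_less_1[OF assms]]
    by (auto simp: add_eq_0_iff simp del: power_Suc)
  thus ?thesis by (simp add: weber_f_eq[OF assms])
qed

definition upper_half :: "complex set" where
  "upper_half = {\<tau>. Im \<tau> > 0}"

lemma open_upper_half: "open upper_half"
  by (simp add: upper_half_def open_halfspace_Im_gt)

lemma connected_upper_half: "connected upper_half"
  by (simp add: upper_half_def convex_halfspace_Im_gt convex_connected)

lemma holomorphic_weber_f: "weber_f holomorphic_on upper_half"
proof (rule holomorphic_transform)
  show "(\<lambda>\<tau>. exp (- (\<i> * of_real pi * \<tau> / 24)) * odd_prod (nome \<tau>) 1) holomorphic_on upper_half"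
    by (intro holomorphic_intros holomorphic_odd_prod open_upper_half)
       (auto simp: nome_def upper_half_def intro!: holomorphic_intros)
qed (simp add: upper_half_def weber_f_eq)

lemma weber_f_plus_2:
  assumes "Im \<tau> > 0"
  shows "weber_f (\<tau> + 2) = cis (- (2 * pi / 24)) * weber_f \<tau>"
proof -
  have "exp (- (\<i> * of_real pi * (\<tau> + 2) / 24)) =
      exp (\<i> * of_real (- (2 * pi / 24))) * exp (- (\<i> * of_real pi * \<tau> / 24))"
    unfolding exp_add [symmetric] by (rule arg_cong[of _ _ exp]) (simp add: field_simps)
  thus ?thesis
    using assms by (simp add: weber_f_eq nome_plus_2 cis_conv_exp)
qed

section \<open>Inversion\<close>

lemma nome_add: "nome (a + b) = nome a * nome b"
  by (simp add: nome_def exp_add distrib_left)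

lemma nome_0 [simp]: "nome 0 = 1"
  by (simp add: nome_def)

lemma nome_1 [simp]: "nome 1 = - 1"
  using nome_plus_1[of 0] by simp

lemma nome_minus_1 [simp]: "nome (- 1) = - 1"
  using nome_plus_1[of "- 1"] by (simp add: equation_minus_iff)

lemma nome_eq_1_iff: "nome z = 1 \<longleftrightarrow> (\<exists>m::int. z = of_int (2 * m))"
proof -
  have "nome z = 1 \<longleftrightarrow> (\<exists>n::int. \<i> * of_real pi * z = of_real (of_int (2 * n) * pi) * \<i>)"
    unfolding nome_def exp_eq_1 by (simp add: complex_eq_iff algebra_simps)
  also have "\<dots> \<longleftrightarrow> (\<exists>n::int. z = of_int (2 * n))"
    by (intro iff_exI) (auto simp: mult_ac)
  finally show ?thesis .
qed

lemma nome_eq_minus_1_iff: "nome z = - 1 \<longleftrightarrow> (\<exists>m::int. z = 1 + of_int (2 * m))"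
proof -
  have "nome z = - 1 \<longleftrightarrow> nome (z + (- 1)) = 1"
    unfolding nome_add nome_minus_1 by (simp add: minus_equation_iff[of "nome z"] eq_commute[of "- 1"])
  also have "\<dots> \<longleftrightarrow> (\<exists>m::int. z = 1 + of_int (2 * m))"
  proof -
    have "z + (- 1) = w \<longleftrightarrow> z = 1 + w" for w :: complex by (metis add.commute add_minus_cancel)
    thus ?thesis unfolding nome_eq_1_iff by blast
  qed
  finally show ?thesis .
qed

lemma holomorphic_nome [holomorphic_intros]:
  "f holomorphic_on S \<Longrightarrow> (\<lambda>z. nome (f z)) holomorphic_on S"
  unfolding nome_def by (intro holomorphic_intros)

text \<open>The Jacobi function \<theta>_3 in z for the lattice generated by 1 and \<tau>, divided
  by a factor independent of z; that factor affects neither the zeros nor the quasi-periods in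
  z.\<close>

definition theta_prod :: "complex \<Rightarrow> complex \<Rightarrow> complex" where
  "theta_prod \<tau> z = odd_prod (nome \<tau>) (nome (2 * z)) * odd_prod (nome \<tau>) (nome (- (2 * z)))"

lemma theta_prod_minus: "theta_prod \<tau> (- z) = theta_prod \<tau> z"
  by (simp add: theta_prod_def)

lemma theta_prod_plus_1: "theta_prod \<tau> (z + 1) = theta_prod \<tau> z"
proof -
  have "nome 2 = 1" "nome (- 2) = 1"
    using nome_add[of 1 1] nome_add[of "- 1" "- 1"] by simp_all
  thus ?thesis
    using nome_add[of "2 * z" 2] nome_add[of "- (2 * z)" "- 2"]
    by (simp add: theta_prod_def distrib_left)
qed

text \<open>The shift multiplies a = nome (2z) by p^2: one product loses its first factor 1 + p * a,
  the other gains 1 + 1 / (p * a), and the quotient of these two is the factor of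
  automorphy.\<close>

lemma theta_prod_plus_tau:
  assumes "Im \<tau> > 0"
  shows "theta_prod \<tau> (z + \<tau>) = nome (- (2 * z + \<tau>)) * theta_prod \<tau> z"
proof -
  define p a b where "p = nome \<tau>" and "a = nome (2 * z)" and "b = nome (- (2 * z))"
  have p: "norm p < 1" unfolding p_def by (rule norm_nome_less_1[OF assms])
  have ab: "a * b = 1" unfolding a_def b_def nome_add [symmetric] by simp
  have pm: "p * nome (- \<tau>) = 1" unfolding p_def nome_add [symmetric] by simp
  have 1: "nome (2 * (z + \<tau>)) = p ^ 2 * a"
    unfolding p_def a_def power2_eq_square nome_add [symmetric] by (rule arg_cong[of _ _ nome]) simp
  have b: "b = p ^ 2 * nome (- (2 * (z + \<tau>)))"
    unfolding p_def b_def power2_eq_square nome_add [symmetric] by (rule arg_cong[of _ _ nome]) simp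
  have c: "nome (- (2 * z + \<tau>)) = p * nome (- (2 * (z + \<tau>)))"
    unfolding p_def nome_add [symmetric] by (rule arg_cong[of _ _ nome]) simp
  have "theta_prod \<tau> (z + \<tau>) = odd_prod p (p ^ 2 * a) * ((1 + nome (- (2 * z + \<tau>))) * odd_prod p b)"
    unfolding theta_prod_def p_def [symmetric] 1 b c
    by (subst odd_prod_shift[OF p, of "nome (- (2 * (z + \<tau>)))"]) simp
  also have "1 + nome (- (2 * z + \<tau>)) = nome (- (2 * z + \<tau>)) * (1 + p * a)"
  proof -
    have "nome (- (2 * z + \<tau>)) * (p * a) = 1"
      unfolding p_def a_def nome_add [symmetric] by simp
    thus ?thesis by (simp add: distrib_left)
  qed
  finally show ?thesis
    unfolding theta_prod_def p_def [symmetric] a_def [symmetric] b_def [symmetric]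
    by (subst odd_prod_shift[OF p, of a]) (simp add: mult_ac)
qed

lemma odd_prod_nome_eq_0_iff:
  assumes "Im \<tau> > 0"
  shows "odd_prod (nome \<tau>) (nome w) = 0 \<longleftrightarrow> (\<exists>(n::nat) (m::int). of_nat (2 * n + 1) * \<tau> + w = 1 + of_int (2 * m))"
proof -
  have "1 + nome \<tau> ^ (2 * n + 1) * nome w = 0 \<longleftrightarrow> nome (of_nat (2 * n + 1) * \<tau> + w) = - 1" for n
    unfolding nome_add nome_of_nat_mult by (simp add: add_eq_0_iff eq_commute[of "- 1"] minus_equation_iff)
  thus ?thesis
    unfolding odd_prod_eq_0_iff[OF norm_nome_less_1[OF assms]] nome_eq_minus_1_iff by simp
qed

lemma theta_prod_eq_0_iff:
  assumes "Im \<tau> > 0"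
  shows "theta_prod \<tau> z = 0 \<longleftrightarrow> (\<exists>m n::int. z = (1 + \<tau>) / 2 + of_int m + of_int n * \<tau>)"
proof
  assume "theta_prod \<tau> z = 0"
  then consider n m where "of_nat (2 * n + 1) * \<tau> + 2 * z = 1 + of_int (2 * m)"
    | n m where "of_nat (2 * n + 1) * \<tau> + - (2 * z) = 1 + of_int (2 * m)"
    by (auto simp: theta_prod_def odd_prod_nome_eq_0_iff[OF assms])
  thus "\<exists>m n::int. z = (1 + \<tau>) / 2 + of_int m + of_int n * \<tau>"
  proof cases
    case 1
    hence "2 * z = 2 * ((1 + \<tau>) / 2 + of_int m + of_int (- int n - 1) * \<tau>)"
      by (simp add: algebra_simps eq_diff_eq add_divide_distrib)
    thus ?thesis by (metis mult_cancel_left zero_neq_numeral)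
  next
    case 2
    hence "2 * z = of_nat (2 * n + 1) * \<tau> - (1 + of_int (2 * m))"
      by (simp add: algebra_simps)
    hence "2 * z = 2 * ((1 + \<tau>) / 2 + of_int (- m - 1) + of_int (int n) * \<tau>)"
      by (simp add: algebra_simps add_divide_distrib)
    thus ?thesis by (metis mult_cancel_left zero_neq_numeral)
  qed
next
  assume "\<exists>m n::int. z = (1 + \<tau>) / 2 + of_int m + of_int n * \<tau>"
  then obtain m n :: int where z: "z = (1 + \<tau>) / 2 + of_int m + of_int n * \<tau>" by blast
  show "theta_prod \<tau> z = 0"
  \<comment> \<open>The sign of n decides which of the two products supplies the zero.\<close>
  proof (cases "n \<ge> 0")
    case True
    have "of_nat (2 * nat n + 1) * \<tau> + - (2 * z) = 1 + of_int (2 * (- m - 1))"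
      using True by (simp add: z algebra_simps)
    thus ?thesis
      unfolding theta_prod_def mult_eq_0_iff odd_prod_nome_eq_0_iff[OF assms] by blast
  next
    case False
    have "of_nat (2 * nat (- n - 1) + 1) * \<tau> + 2 * z = 1 + of_int (2 * m)"
      using False by (simp add: z algebra_simps)
    thus ?thesis
      unfolding theta_prod_def mult_eq_0_iff odd_prod_nome_eq_0_iff[OF assms] by blast
  qed
qed

lemma theta_prod_0_nonzero:
  assumes "Im \<tau> > 0"
  shows "theta_prod \<tau> 0 \<noteq> 0"
proof
  assume "theta_prod \<tau> 0 = 0"
  then obtain m n :: int where "0 = (1 + \<tau>) / 2 + of_int m + of_int n * \<tau>"
    unfolding theta_prod_eq_0_iff[OF assms] by blast
  hence "Im ((1 + \<tau>) / 2 + of_int m + of_int n * \<tau>) = 0"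
    by (metis zero_complex.simps(2))
  hence "(2 * real_of_int n + 1) * Im \<tau> = 0"
    by (simp add: algebra_simps)
  hence "2 * real_of_int n + 1 = 0"
    using assms by simp
  hence "real_of_int (2 * n + 1) = 0" by simp
  hence "2 * n + 1 = 0" by (simp only: of_int_eq_0_iff)
  thus False by presburger
qed

lemma holomorphic_theta_prod:
  assumes "Im \<tau> > 0" "f holomorphic_on S" "open S"
  shows "(\<lambda>z. theta_prod \<tau> (f z)) holomorphic_on S"
  unfolding theta_prod_def using assms
  by (intro holomorphic_intros holomorphic_odd_prod norm_nome_less_1)

text \<open>Exactly one factor, 1 + nome (\<tau> - 2z), vanishes at the half period, and to first
  order; \<open>B\<close> collects the others.\<close>

lemma theta_prod_simple_zero:
  assumes "Im \<tau> > 0"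
  obtains d where "(theta_prod \<tau> has_field_derivative d) (at ((1 + \<tau>) / 2))" "d \<noteq> 0"
proof -
  define p where "p = nome \<tau>"
  define z0 where "z0 = (1 + \<tau>) / 2"
  have p: "norm p < 1" unfolding p_def by (rule norm_nome_less_1[OF assms])
  define B where "B = (\<lambda>z. odd_prod p (nome (2 * z)) * odd_prod p (p ^ 2 * nome (- (2 * z))))"
  have B: "B holomorphic_on UNIV"
    unfolding B_def by (intro holomorphic_intros holomorphic_odd_prod) (use p in auto)
  have "theta_prod \<tau> z = (1 + nome (\<tau> - 2 * z)) * B z" for z
  proof -
    have "p * nome (- (2 * z)) = nome (\<tau> - 2 * z)"
      unfolding p_def nome_add [symmetric] by simp
    thus ?thesis
      unfolding theta_prod_def B_def p_def [symmetric]
      by (subst odd_prod_shift[OF p, of "nome (- (2 * z))"]) (simp add: mult_ac)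
  qed
  hence eq: "theta_prod \<tau> = (\<lambda>z. (1 + nome (\<tau> - 2 * z)) * B z)" by blast
  have n0: "\<tau> - 2 * z0 = - 1" by (simp add: z0_def add_divide_distrib)
  have "(B has_field_derivative deriv B z0) (at z0)"
    using B by (meson UNIV_I holomorphic_derivI open_UNIV)
  hence "(theta_prod \<tau> has_field_derivative
      (1 + nome (\<tau> - 2 * z0)) * deriv B z0 + (nome (\<tau> - 2 * z0) * (\<i> * of_real pi * (- 2))) * B z0) (at z0)"
    unfolding eq nome_def
    by (auto intro!: derivative_eq_intros simp: algebra_simps)
  hence D: "(theta_prod \<tau> has_field_derivative 2 * \<i> * of_real pi * B z0) (at z0)"
    unfolding n0 by (simp add: mult_ac)
  \<comment> \<open>At the half period both products in \<open>B\<close> have the argument -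
    p.\<close>
  have "odd_prod p (- p) \<noteq> 0"
  proof
    assume "odd_prod p (- p) = 0"
    then obtain n where "p ^ (2 * n + 1) * p = 1"
      unfolding odd_prod_eq_0_iff[OF p] by auto
    hence "norm (p ^ (2 * n + 1) * p) = 1" by simp
    hence "norm p ^ (2 * n + 2) = 1" by (simp add: norm_mult norm_power mult_ac)
    moreover have "norm p ^ (2 * n + 2) < 1"
      using p by (subst power_less_one_iff) auto
    ultimately show False by simp
  qed
  moreover have "nome (2 * z0) = - p"
    using nome_plus_1[of \<tau>] by (simp add: z0_def p_def add.commute add_divide_distrib)
  moreover have "p ^ 2 * nome (- (2 * z0)) = - p"
  proof -
    have "p * nome (- (2 * z0)) = nome (- 1)"
      unfolding p_def nome_add [symmetric] by (simp add: z0_def add_divide_distrib)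
    thus ?thesis by (simp add: power2_eq_square mult.assoc)
  qed
  ultimately have "B z0 \<noteq> 0" by (simp add: B_def)
  thus ?thesis using D that unfolding z0_def by force
qed

lemma periodic_int_multiple:
  fixes a :: complex
  assumes "\<And>z. r (z + a) = r z"
  shows "r (z + of_int m * a) = r z"
proof -
  have nat: "r (z + of_nat n * a) = r z" for n z
    by (induction n) (use assms[of "z + of_nat _ * a"] in \<open>simp_all add: algebra_simps\<close>)
  show ?thesis
  proof (cases "m \<ge> 0")
    case True
    thus ?thesis using nat[of z "nat m"] by simp
  next
    case False
    thus ?thesis using nat[of "z + of_int m * a" "nat (- m)"] by simp
  qed
qed

text \<open>The quotient of h by the theta product is doubly periodic. The zeros of the theta
  product are simple and shared by h, so the singularities are removable; being bounded on a period
  cell, the quotient is constant by Liouville.\<close>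

lemma quasi_periodic_eq_theta_prod:
  assumes \<tau>: "Im \<tau> > 0" and h: "h holomorphic_on UNIV"
    and h1: "\<And>z. h (z + 1) = h z"
    and h\<tau>: "\<And>z. h (z + \<tau>) = nome (- (2 * z + \<tau>)) * h z"
    and h0: "\<And>z. theta_prod \<tau> z = 0 \<Longrightarrow> h z = 0"
  obtains C where "\<And>z. h z = C * theta_prod \<tau> z"
proof -
  define g where "g = theta_prod \<tau>"
  define z0 where "z0 = (1 + \<tau>) / 2"
  have g: "g holomorphic_on UNIV"
    using holomorphic_theta_prod[OF \<tau>, of "\<lambda>z. z" UNIV] by (simp add: g_def)
  obtain d where d: "(g has_field_derivative d) (at z0)" "d \<noteq> 0"
    using theta_prod_simple_zero[OF \<tau>] unfolding g_def z0_def by blast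
  have h': "(h has_field_derivative deriv h z0) (at z0)"
    using h by (meson UNIV_I holomorphic_derivI open_UNIV)
  have gz: "g z = 0 \<longleftrightarrow> (\<exists>m n::int. z = z0 + of_int m + of_int n * \<tau>)" for z
    unfolding g_def z0_def by (rule theta_prod_eq_0_iff[OF \<tau>])
  have gz0: "g z0 = 0"
    unfolding gz by (rule exI[of _ 0], rule exI[of _ 0]) simp
  \<comment> \<open>The value that removes the singularities: by l'Hopital it is the limit of h / g
    at \<open>z0\<close>.\<close>
  define c where "c = deriv h z0 / d"
  define r where "r = (\<lambda>z. if g z = 0 then c else h z / g z)"
  have r1: "r (z + 1) = r z" for z
    by (simp add: r_def g_def theta_prod_plus_1 h1)
  have r\<tau>: "r (z + \<tau>) = r z" for z
    by (simp add: r_def g_def theta_prod_plus_tau[OF \<tau>] h\<tau>)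
  have r_per: "r (z + of_int m + of_int n * \<tau>) = r z" for z m n
    using periodic_int_multiple[of r \<tau> "z + of_int m" n, OF r\<tau>] periodic_int_multiple[of r 1 z m, OF r1]
    by simp
  have lim: "((\<lambda>w. h w / g w) \<longlongrightarrow> c) (at z0)"
    using lhopital_complex_simple[OF h' d(1) _ gz0 d(2)] h0 gz0 by (simp add: c_def g_def)
  obtain e where e: "e > 0" "\<And>z. z \<in> ball z0 e - {z0} \<Longrightarrow> g z \<noteq> 0"
    using isolated_zeros[OF g, of z0 0] gz0 theta_prod_0_nonzero[OF \<tau>] unfolding g_def by auto
  have "r holomorphic_on ball z0 e"
  proof (rule no_isolated_singularity')
    show "(r \<longlongrightarrow> r z) (at z within ball z0 e)" if "z \<in> {z0}" for z
    proof -
      have "eventually (\<lambda>w. w \<in> ball z0 e - {z0}) (at z0)"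
        using e(1) by (intro eventually_at_in_open) auto
      hence "eventually (\<lambda>w. h w / g w = r w) (at z0)"
        by eventually_elim (use e(2) in \<open>auto simp: r_def\<close>)
      hence "(r \<longlongrightarrow> c) (at z0)"
        using lim by (rule Lim_transform_eventually[rotated])
      moreover have "r z = c" "z = z0" using that gz0 by (simp_all add: r_def)
      moreover have "at z0 within ball z0 e = at z0" using e(1) by (intro at_within_open) auto
      ultimately show ?thesis by simp
    qed
    have "(\<lambda>w. h w / g w) holomorphic_on ball z0 e - {z0}"
      by (intro holomorphic_intros holomorphic_on_subset[OF h] holomorphic_on_subset[OF g]) (use e in auto)
    thus "r holomorphic_on ball z0 e - {z0}"
      by (rule holomorphic_transform) (use e in \<open>auto simp: r_def\<close>)
  qed auto
  hence diff_z0: "r field_differentiable at z0"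
    using e(1) by (auto simp: holomorphic_on_open field_differentiable_def)
  have "r field_differentiable at z" for z
  proof (cases "g z = 0")
    case True
    then obtain m n :: int where z: "z = z0 + of_int m + of_int n * \<tau>" unfolding gz by blast
    \<comment> \<open>Periodicity transports differentiability from \<open>z0\<close> to every other
      zero.\<close>
    have eq: "r = (\<lambda>w. r (w - (of_int m + of_int n * \<tau>)))"
    proof
      fix w show "r w = r (w - (of_int m + of_int n * \<tau>))"
        using r_per[of "w - (of_int m + of_int n * \<tau>)" m n] by (simp add: algebra_simps)
    qed
    from diff_z0 obtain D where "(r has_field_derivative D) (at z0)"
      by (auto simp: field_differentiable_def)
    hence "((\<lambda>w. r (w - (of_int m + of_int n * \<tau>))) has_field_derivative D * 1) (at z)"
      by (intro DERIV_chain2[of r]) (auto simp: z intro!: derivative_eq_intros)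
    thus ?thesis using eq by (auto simp: field_differentiable_def)
  next
    case False
    have op: "open {w. g w \<noteq> 0}"
      by (intro open_Collect_neq holomorphic_on_imp_continuous_on[OF g] continuous_on_const)
    have "(\<lambda>w. h w / g w) holomorphic_on {w. g w \<noteq> 0}"
      using holomorphic_on_subset[OF h subset_UNIV] holomorphic_on_subset[OF g subset_UNIV]
      by (intro holomorphic_on_divide) simp_all
    hence "r holomorphic_on {w. g w \<noteq> 0}"
      by (rule holomorphic_transform) (simp add: r_def)
    thus ?thesis using False op by (simp add: holomorphic_on_open field_differentiable_def)
  qed
  hence r_hol: "r holomorphic_on UNIV"
    by (simp add: holomorphic_on_def field_differentiable_at_within)
  define cell where "cell = (\<lambda>(s, t). of_real s + of_real t * \<tau>) ` ({0..1::real} \<times> {0..1::real})"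
  have "compact cell"
    unfolding cell_def by (intro compact_continuous_image compact_Times compact_Icc)
      (auto simp: case_prod_unfold intro!: continuous_intros)
  hence bdd: "bounded (r ` cell)"
    by (intro compact_imp_bounded compact_continuous_image)
       (use holomorphic_on_imp_continuous_on[OF r_hol] continuous_on_subset in auto)
  have "r z \<in> r ` cell" for z
  proof -
    define t where "t = Im z / Im \<tau>"
    define s where "s = Re z - t * Re \<tau>"
    have z: "z = of_real s + of_real t * \<tau>"
      using \<tau> by (simp add: complex_eq_iff s_def t_def)
    have "of_real (frac s) + of_real (frac t) * \<tau> \<in> cell"
      unfolding cell_def
      by (rule image_eqI[of _ _ "(frac s, frac t)"]) (auto simp: frac_lt_1 less_imp_le)
    moreover have "of_real (frac s) + of_real (frac t) * \<tau> + of_int \<lfloor>s\<rfloor> + of_int \<lfloor>t\<rfloor> * \<tau> = z"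
      unfolding z frac_def by (simp add: algebra_simps)
    hence "r z = r (of_real (frac s) + of_real (frac t) * \<tau>)"
      using r_per[of "of_real (frac s) + of_real (frac t) * \<tau>" "\<lfloor>s\<rfloor>" "\<lfloor>t\<rfloor>"] by simp
    ultimately show ?thesis by blast
  qed
  hence "range r \<subseteq> r ` cell" by blast
  hence "bounded (range r)"
    by (rule bounded_subset[OF bdd])
  then obtain C where C: "\<And>z. r z = C"
    using Liouville_theorem[OF r_hol] by (auto simp: constant_on_def)
  have "h z = C * theta_prod \<tau> z" for z
    using C[of z] h0[of z] by (cases "g z = 0") (auto simp: r_def g_def field_simps)
  thus ?thesis using that by blast
qed


section \<open>The Weber function at - 1 / \<tau> and near the cusp 1\<close>

lemma Im_minus_inverse: "Im (- 1 / \<tau>) = Im \<tau> / norm \<tau> ^ 2"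
  by (simp add: Im_divide cmod_power2)

lemma Im_minus_inverse_pos: "Im \<tau> > 0 \<Longrightarrow> Im (- 1 / \<tau>) > 0"
  unfolding Im_minus_inverse by (intro divide_pos_pos) auto

lemma theta_prod_0: "theta_prod \<tau> 0 = odd_prod (nome \<tau>) 1 ^ 2"
  by (simp add: theta_prod_def power2_eq_square)

lemma theta_prod_half: "theta_prod \<tau> (1 / 2) = odd_prod (nome \<tau>) (- 1) ^ 2"
  by (simp add: theta_prod_def power2_eq_square)

lemma theta_prod_half_tau:
  assumes "Im \<tau> > 0"
  shows "theta_prod \<tau> (\<tau> / 2) = 2 * odd_prod (nome \<tau>) (nome \<tau>) ^ 2"
proof -
  have 1: "nome \<tau> * nome (- \<tau>) = 1"
    unfolding nome_add [symmetric] by simp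
  hence "nome \<tau> ^ 2 * nome (- \<tau>) = nome \<tau>"
    by (simp add: power2_eq_square mult.assoc)
  thus ?thesis
    using odd_prod_shift[OF norm_nome_less_1[OF assms], of "nome (- \<tau>)"] 1
    by (simp add: theta_prod_def) (simp add: power2_eq_square)
qed

text \<open>The Gaussian factor converts the quasi-periods for - 1 / \<tau> into those for \<tau>,
  so that uniqueness up to a constant applies. The constant depends on \<tau> and stays undetermined
  here.\<close>

lemma theta_prod_inversion:
  assumes \<tau>: "Im \<tau> > 0"
  obtains C where "\<And>z. nome (- (z ^ 2 / \<tau>)) * theta_prod (- 1 / \<tau>) (z / \<tau>) = C * theta_prod \<tau> z"
proof -
  define \<sigma> where "\<sigma> = - 1 / \<tau>"
  have \<sigma>: "Im \<sigma> > 0" unfolding \<sigma>_def by (rule Im_minus_inverse_pos[OF \<tau>])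
  have [simp]: "\<tau> \<noteq> 0" using \<tau> by auto
  define h where "h = (\<lambda>z. nome (- (z ^ 2 / \<tau>)) * theta_prod \<sigma> (z / \<tau>))"
  have shift: "theta_prod \<sigma> (v - \<sigma>) = nome (2 * v - \<sigma>) * theta_prod \<sigma> v" for v
  proof -
    have "theta_prod \<sigma> v = nome (- (2 * v - \<sigma>)) * theta_prod \<sigma> (v - \<sigma>)"
      using theta_prod_plus_tau[OF \<sigma>, of "v - \<sigma>"] by (simp add: algebra_simps)
    moreover have "nome (2 * v - \<sigma>) * nome (- (2 * v - \<sigma>)) = 1"
      unfolding nome_add [symmetric] by simp
    ultimately show ?thesis by (metis mult.assoc mult_1)
  qed
  show ?thesis
  proof (rule quasi_periodic_eq_theta_prod[OF \<tau>, of h])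
    show "h holomorphic_on UNIV"
      unfolding h_def by (intro holomorphic_intros holomorphic_theta_prod[OF \<sigma>]) auto
    show "h (z + 1) = h z" for z
    proof -
      have "(z + 1) / \<tau> = z / \<tau> - \<sigma>" by (simp add: \<sigma>_def add_divide_distrib)
      hence "h (z + 1) = (nome (- ((z + 1) ^ 2 / \<tau>)) * nome (2 * (z / \<tau>) - \<sigma>)) * theta_prod \<sigma> (z / \<tau>)"
        by (simp add: h_def shift)
      also have "nome (- ((z + 1) ^ 2 / \<tau>)) * nome (2 * (z / \<tau>) - \<sigma>) = nome (- (z ^ 2 / \<tau>))"
        unfolding nome_add [symmetric]
        by (rule arg_cong[of _ _ nome]) (simp add: \<sigma>_def field_simps power2_eq_square)
      finally show ?thesis by (simp add: h_def)
    qed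
    show "h (z + \<tau>) = nome (- (2 * z + \<tau>)) * h z" for z
    proof -
      have "(z + \<tau>) / \<tau> = z / \<tau> + 1" by (simp add: add_divide_distrib)
      hence "h (z + \<tau>) = nome (- ((z + \<tau>) ^ 2 / \<tau>)) * theta_prod \<sigma> (z / \<tau>)"
        by (simp add: h_def theta_prod_plus_1)
      also have "nome (- ((z + \<tau>) ^ 2 / \<tau>)) = nome (- (2 * z + \<tau>)) * nome (- (z ^ 2 / \<tau>))"
        unfolding nome_add [symmetric]
        by (rule arg_cong[of _ _ nome]) (simp add: field_simps power2_eq_square)
      finally show ?thesis by (simp add: h_def)
    qed
    show "h z = 0" if zero: "theta_prod \<tau> z = 0" for z
    proof -
      obtain m n :: int where z: "z = (1 + \<tau>) / 2 + of_int m + of_int n * \<tau>"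
        using zero unfolding theta_prod_eq_0_iff[OF \<tau>] by blast
      \<comment> \<open>Division by \<tau> exchanges the two lattice directions: the pair (m, n)
        becomes (n, - m - 1).\<close>
      have "z / \<tau> = (1 + \<sigma>) / 2 + of_int n + of_int (- m - 1) * \<sigma>"
        by (simp add: z \<sigma>_def field_simps)
      hence "theta_prod \<sigma> (z / \<tau>) = 0" unfolding theta_prod_eq_0_iff[OF \<sigma>] by blast
      thus ?thesis by (simp add: h_def)
    qed
  qed (use that in \<open>auto simp: h_def \<sigma>_def\<close>)
qed

lemma weber_f_nome:
  assumes "Im \<tau> > 0"
  shows "weber_f \<tau> = nome (- (\<tau> / 24)) * odd_prod (nome \<tau>) 1"
  unfolding weber_f_eq[OF assms] by (simp add: nome_def)

lemma nome_power: "nome z ^ n = nome (of_nat n * z)"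
  by (rule nome_of_nat_mult [symmetric])

text \<open>The theta products at 0, 1 / 2 and \<tau> / 2 are, up to exponential and constant
  factors, the squares of the three Weber functions. The inversion fixes the first and exchanges the
  other two, with one unknown C in all three relations.\<close>

lemma odd_prod_inversion:
  assumes \<tau>: "Im \<tau> > 0"
  obtains C where
    "odd_prod (nome (- 1 / \<tau>)) 1 ^ 2 = C * odd_prod (nome \<tau>) 1 ^ 2"
    "nome (- 1 / \<tau> / 4) * (2 * odd_prod (nome (- 1 / \<tau>)) (nome (- 1 / \<tau>)) ^ 2) = C * odd_prod (nome \<tau>) (- 1) ^ 2"
    "odd_prod (nome (- 1 / \<tau>)) (- 1) ^ 2 = C * nome (\<tau> / 4) * (2 * odd_prod (nome \<tau>) (nome \<tau>) ^ 2)"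
proof -
  define \<sigma> where "\<sigma> = - 1 / \<tau>"
  have \<sigma>: "Im \<sigma> > 0" unfolding \<sigma>_def by (rule Im_minus_inverse_pos[OF \<tau>])
  have [simp]: "\<tau> \<noteq> 0" using \<tau> by auto
  obtain C where C: "\<And>z. nome (- (z ^ 2 / \<tau>)) * theta_prod \<sigma> (z / \<tau>) = C * theta_prod \<tau> z"
    using theta_prod_inversion[OF \<tau>] unfolding \<sigma>_def by blast
  have 1: "odd_prod (nome \<sigma>) 1 ^ 2 = C * odd_prod (nome \<tau>) 1 ^ 2"
    using C[of 0] by (simp add: theta_prod_0)
  have half: "1 / 2 / \<tau> = - (\<sigma> / 2)" "- ((1 / 2) ^ 2 / \<tau>) = \<sigma> / 4"
    by (simp_all add: \<sigma>_def power2_eq_square)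
  have 2: "nome (\<sigma> / 4) * (2 * odd_prod (nome \<sigma>) (nome \<sigma>) ^ 2) = C * odd_prod (nome \<tau>) (- 1) ^ 2"
    using C[of "1 / 2"] unfolding half theta_prod_half theta_prod_minus theta_prod_half_tau[OF \<sigma>] .
  have "\<tau> / 2 / \<tau> = 1 / 2" "- ((\<tau> / 2) ^ 2 / \<tau>) = - (\<tau> / 4)"
    by (simp_all add: power2_eq_square)
  hence "nome (- (\<tau> / 4)) * odd_prod (nome \<sigma>) (- 1) ^ 2 = C * (2 * odd_prod (nome \<tau>) (nome \<tau>) ^ 2)"
    using C[of "\<tau> / 2"] by (simp only: theta_prod_half theta_prod_half_tau[OF \<tau>])
  moreover have "nome (\<tau> / 4) * nome (- (\<tau> / 4)) = 1"
    unfolding nome_add [symmetric] by simp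
  ultimately have 3: "odd_prod (nome \<sigma>) (- 1) ^ 2 = C * nome (\<tau> / 4) * (2 * odd_prod (nome \<tau>) (nome \<tau>) ^ 2)"
    by (metis mult.assoc mult.left_commute mult_1)
  show ?thesis using that 1 2 3 unfolding \<sigma>_def by blast
qed

text \<open>Comparing the theta products for \<open>\<tau>\<close> and \<open>- 1 / \<tau>\<close> at the points \<open>0\<close>, \<open>1 / 2\<close> and \<open>\<tau> / 2\<close> shows that
  the quotient of the two sides is a sixth root of unity; it is constant, and \<open>1\<close> at \<open>\<tau> = \<i>\<close>.\<close>
theorem weber_f_inversion:
  assumes \<tau>: "Im \<tau> > 0"
  shows "weber_f (- 1 / \<tau>) = weber_f \<tau>"
proof -
  define \<phi> where "\<phi> = (\<lambda>\<tau>. weber_f (- 1 / \<tau>) / weber_f \<tau>)"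
  have pow: "\<phi> \<tau> ^ 6 = 1" if \<tau>: "Im \<tau> > 0" for \<tau>
  proof -
    define \<sigma> where "\<sigma> = - 1 / \<tau>"
    have \<sigma>: "Im \<sigma> > 0" unfolding \<sigma>_def by (rule Im_minus_inverse_pos[OF \<tau>])
    define a b c a' b' c' where
      "a = odd_prod (nome \<tau>) 1" "b = odd_prod (nome \<tau>) (- 1)" "c = odd_prod (nome \<tau>) (nome \<tau>)"
      "a' = odd_prod (nome \<sigma>) 1" "b' = odd_prod (nome \<sigma>) (- 1)" "c' = odd_prod (nome \<sigma>) (nome \<sigma>)"
    note defs = this
    obtain C where C: "a' ^ 2 = C * a ^ 2" "nome (\<sigma> / 4) * (2 * c' ^ 2) = C * b ^ 2"
        "b' ^ 2 = C * nome (\<tau> / 4) * (2 * c ^ 2)"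
      using odd_prod_inversion[OF \<tau>] unfolding \<sigma>_def [symmetric] defs by blast
    have abc: "a * b * c = 1" "a' * b' * c' = 1"
      unfolding defs by (intro odd_prod_triple norm_nome_less_1 \<tau> \<sigma>)+
    \<comment> \<open>Multiplying the three relations turns both triple products into 1. What
      remains determines C^3, which is why sixth powers are compared.\<close>
    have "2 * nome (\<sigma> / 4) * (a' * b' * c') ^ 2 = a' ^ 2 * (nome (\<sigma> / 4) * (2 * c' ^ 2)) * b' ^ 2"
      by (simp add: power_mult_distrib)
    also have "\<dots> = 2 * (C ^ 3 * nome (\<tau> / 4)) * (a * b * c) ^ 2"
      unfolding C by (simp add: power_mult_distrib power3_eq_cube mult_ac)
    finally have 1: "nome (\<sigma> / 4) = C ^ 3 * nome (\<tau> / 4)"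
      unfolding abc by simp
    have "weber_f \<sigma> ^ 6 = nome (- (\<sigma> / 24)) ^ 6 * (a' ^ 2) ^ 3"
      unfolding weber_f_nome[OF \<sigma>] defs by (simp add: power_mult_distrib flip: power_mult)
    also have "\<dots> = nome (- (\<sigma> / 4)) * (C ^ 3 * a ^ 6)"
      unfolding C(1) nome_power by (simp add: power_mult_distrib flip: power_mult)
    also have "\<dots> = nome (- (\<tau> / 4)) * a ^ 6"
    proof -
      have n1: "nome (\<sigma> / 4) * nome (- (\<sigma> / 4)) = 1" "nome (\<tau> / 4) * nome (- (\<tau> / 4)) = 1"
        unfolding nome_add [symmetric] by simp_all
      have "nome (- (\<sigma> / 4)) * C ^ 3 = nome (- (\<sigma> / 4)) * (C ^ 3 * nome (\<tau> / 4)) * nome (- (\<tau> / 4))"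
        using n1(2) by (simp add: mult.assoc)
      also have "\<dots> = nome (- (\<tau> / 4))"
        unfolding 1 [symmetric] using n1(1) by (simp add: mult_ac)
      finally show ?thesis by (metis mult.assoc)
    qed
    also have "\<dots> = weber_f \<tau> ^ 6"
      unfolding weber_f_nome[OF \<tau>] defs power_mult_distrib nome_power by simp
    finally show ?thesis
      using weber_f_nonzero[OF \<tau>] by (simp add: \<phi>_def \<sigma>_def power_divide)
  qed
  have "\<phi> holomorphic_on upper_half"
    unfolding \<phi>_def
  proof (intro holomorphic_on_divide holomorphic_weber_f)
    show "(\<lambda>z. weber_f (- 1 / z)) holomorphic_on upper_half"
    proof (rule holomorphic_on_compose_gen[of "\<lambda>z. - 1 / z" _ weber_f upper_half, unfolded o_def])
      show "(\<lambda>z. - 1 / z) holomorphic_on upper_half"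
        by (intro holomorphic_intros) (auto simp: upper_half_def)
      show "(\<lambda>z. - 1 / z) ` upper_half \<subseteq> upper_half"
        using Im_minus_inverse_pos by (auto simp: upper_half_def simp del: divide_minus_left)
    qed (rule holomorphic_weber_f)
  qed (simp add: upper_half_def weber_f_nonzero)
  moreover have "finite (\<phi> ` upper_half)"
    by (rule finite_subset[OF _ finite_roots_unity[of 6]]) (use pow in \<open>auto simp: upper_half_def\<close>)
  ultimately have "\<phi> constant_on upper_half"
    by (intro continuous_finite_range_constant connected_upper_half holomorphic_on_imp_continuous_on)
  then obtain c where c: "\<And>z. z \<in> upper_half \<Longrightarrow> \<phi> z = c"
    by (auto simp: constant_on_def)
  have "- 1 / \<i> = \<i>" by (simp add: complex_eq_iff)
  hence "\<phi> \<i> = 1" using weber_f_nonzero[of \<i>] by (simp add: \<phi>_def)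
  hence "\<phi> \<tau> = 1" using c[of \<i>] c[of \<tau>] \<tau> by (simp add: upper_half_def)
  thus ?thesis using weber_f_nonzero[OF \<tau>] by (simp add: \<phi>_def field_simps)
qed

text \<open>As \<open>\<tau>\<close> tends to infinity, \<open>1 - 1 / \<tau>\<close> tends to the cusp \<open>1\<close>, where the Weber function vanishes.\<close>
lemma norm_weber_f_near_1:
  assumes \<tau>: "Im \<tau> > 0"
  shows "norm (weber_f (1 - 1 / \<tau>)) ^ 2 = 2 * exp (- (pi * Im \<tau> / 6)) * norm (odd_prod (nome \<tau>) (nome \<tau>)) ^ 2"
proof -
  define \<sigma> where "\<sigma> = - 1 / \<tau>"
  have \<sigma>: "Im \<sigma> > 0" unfolding \<sigma>_def by (rule Im_minus_inverse_pos[OF \<tau>])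
  define a where "a = odd_prod (nome \<tau>) 1"
  define a' where "a' = odd_prod (nome \<sigma>) 1"
  obtain C where C: "a' ^ 2 = C * a ^ 2"
      "odd_prod (nome \<sigma>) (- 1) ^ 2 = C * nome (\<tau> / 4) * (2 * odd_prod (nome \<tau>) (nome \<tau>) ^ 2)"
    using odd_prod_inversion[OF \<tau>] unfolding \<sigma>_def [symmetric] a_def a'_def by blast
  have a0: "a \<noteq> 0"
    using weber_f_nonzero[OF \<tau>] by (auto simp: weber_f_nome[OF \<tau>] a_def)
  have "weber_f \<sigma> ^ 2 = weber_f \<tau> ^ 2"
    using weber_f_inversion[OF \<tau>] by (simp add: \<sigma>_def)
  hence "nome (- (\<sigma> / 12)) * a' ^ 2 = nome (- (\<tau> / 12)) * a ^ 2"
    unfolding weber_f_nome[OF \<tau>] weber_f_nome[OF \<sigma>] power_mult_distrib nome_power a_def a'_def by simp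
  \<comment> \<open>The exact inversion formula yields C itself and not only its cube.\<close>
  hence CC: "nome (- (\<sigma> / 12)) * C = nome (- (\<tau> / 12))"
    unfolding C using a0 by (simp add: mult.assoc [symmetric])
  have "weber_f (1 + \<sigma>) = nome (- ((\<sigma> + 1) / 24)) * odd_prod (nome \<sigma>) (- 1)"
    using weber_f_nome[of "\<sigma> + 1"] \<sigma> unfolding nome_plus_1 odd_prod_minus by (simp add: add.commute)
  moreover have "nome (- ((\<sigma> + 1) / 24)) ^ 2 = nome (- ((\<sigma> + 1) / 12))"
    unfolding nome_power by (rule arg_cong[of _ _ nome]) (simp add: field_simps)
  ultimately have "weber_f (1 + \<sigma>) ^ 2 = nome (- ((\<sigma> + 1) / 12)) * odd_prod (nome \<sigma>) (- 1) ^ 2"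
    by (simp add: power_mult_distrib)
  also have "nome (- ((\<sigma> + 1) / 12)) = nome (- (1 / 12)) * nome (- (\<sigma> / 12))"
    unfolding nome_add [symmetric] by (rule arg_cong[of _ _ nome]) (simp add: add_divide_distrib)
  also have "nome (- (1 / 12)) * nome (- (\<sigma> / 12)) * odd_prod (nome \<sigma>) (- 1) ^ 2 =
      nome (- (1 / 12)) * (nome (- (\<sigma> / 12)) * C) * nome (\<tau> / 4) * (2 * odd_prod (nome \<tau>) (nome \<tau>) ^ 2)"
    unfolding C by (simp only: mult_ac)
  also have "\<dots> = nome (- (1 / 12)) * (nome (- (\<tau> / 12)) * nome (\<tau> / 4)) * (2 * odd_prod (nome \<tau>) (nome \<tau>) ^ 2)"
    unfolding CC by (simp only: mult_ac)
  also have "nome (- (\<tau> / 12)) * nome (\<tau> / 4) = nome (\<tau> / 6)"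
    unfolding nome_add [symmetric] by (rule arg_cong[of _ _ nome]) simp
  finally have "norm (weber_f (1 + \<sigma>) ^ 2) =
      norm (nome (- (1 / 12)) * nome (\<tau> / 6) * (2 * odd_prod (nome \<tau>) (nome \<tau>) ^ 2))" by simp
  moreover have "1 + \<sigma> = 1 - 1 / \<tau>" by (simp add: \<sigma>_def)
  ultimately show ?thesis
    by (simp add: norm_power norm_mult norm_nome)
qed

section \<open>The multiplier on $\Gamma(2)$\<close>

definition root24 :: "int \<Rightarrow> complex" where
  "root24 n = cis (2 * pi * of_int n / 24)"

lemma root24_add: "root24 (a + b) = root24 a * root24 b"
  by (simp add: root24_def cis_mult add_divide_distrib distrib_left)

lemma root24_0 [simp]: "root24 0 = 1"
  by (simp add: root24_def)

lemma norm_root24 [simp]: "norm (root24 n) = 1"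
  by (simp add: root24_def)

lemma root24_nonzero [simp]: "root24 n \<noteq> 0"
  by (simp add: root24_def)

lemma root24_eq_1_iff: "root24 n = 1 \<longleftrightarrow> 24 dvd n"
proof
  assume "root24 n = 1"
  hence "cos (2 * pi * of_int n / 24) = 1" by (simp add: root24_def complex_eq_iff)
  then obtain m :: int where "2 * pi * of_int n / 24 = of_int m * 2 * pi"
    by (auto simp: cos_one_2pi_int)
  hence "real_of_int n = real_of_int (24 * m)" by simp
  hence "n = 24 * m" by (simp only: of_int_eq_iff)
  thus "24 dvd n" by simp
next
  assume "24 dvd n"
  then obtain m where "n = 24 * m" by blast
  thus "root24 n = 1"
    using cis_multiple_2pi[of "of_int m"] by (simp add: root24_def mult_ac)
qed

lemma root24_cong: "[a = b] (mod 24) \<Longrightarrow> root24 a = root24 b"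
  using root24_add[of "a - b" b] by (simp add: cong_iff_dvd_diff flip: root24_eq_1_iff)

lemma root24_power: "root24 a ^ n = root24 (int n * a)"
  by (induction n) (simp_all add: root24_add distrib_right)

lemma weber_f_plus_even:
  assumes "Im \<tau> > 0"
  shows "weber_f (\<tau> + 2 * of_int k) = root24 (- k) * weber_f \<tau>"
proof -
  have step: "weber_f (z + 2) = root24 (- 1) * weber_f z" if "Im z > 0" for z
    using weber_f_plus_2[OF that] by (simp add: root24_def)
  have nat: "weber_f (z + 2 * of_nat n) = root24 (- int n) * weber_f z" if "Im z > 0" for z n
  proof (induction n)
    case (Suc n)
    have "weber_f (z + 2 * of_nat (Suc n)) = weber_f ((z + 2 * of_nat n) + 2)"
      by (simp add: algebra_simps)
    also have "\<dots> = root24 (- 1) * (root24 (- int n) * weber_f z)"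
      using that Suc by (subst step) auto
    also have "\<dots> = root24 (- int (Suc n)) * weber_f z"
      using root24_add[of "- 1" "- int n"] by simp
    finally show ?case .
  qed simp
  show ?thesis
  proof (cases "k \<ge> 0")
    case True
    thus ?thesis using nat[OF assms, of "nat k"] by simp
  next
    case False
    have "weber_f (\<tau> + 2 * of_int k + 2 * of_nat (nat (- k))) =
        root24 k * weber_f (\<tau> + 2 * of_int k)"
      using nat[of "\<tau> + 2 * of_int k" "nat (- k)"] assms False by simp
    moreover have "\<tau> + 2 * of_int k + 2 * of_nat (nat (- k)) = \<tau>"
      using False by simp
    ultimately have "root24 (- k) * weber_f \<tau> = (root24 (- k) * root24 k) * weber_f (\<tau> + 2 * of_int k)"
      by (simp add: mult.assoc)
    thus ?thesis by (simp flip: root24_add)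
  qed
qed

lemma Im_moebius:
  fixes a b c d :: real
  assumes "a * d - b * c = 1"
  shows "Im ((of_real a * \<tau> + of_real b) / (of_real c * \<tau> + of_real d)) =
      Im \<tau> / norm (of_real c * \<tau> + of_real d) ^ 2"
proof -
  have "a * Im \<tau> * (c * Re \<tau> + d) - (a * Re \<tau> + b) * (c * Im \<tau>) = (a * d - b * c) * Im \<tau>"
    by (simp add: algebra_simps)
  thus ?thesis
    unfolding assms by (simp add: Im_divide cmod_power2)
qed

lemma moebius_denom_nonzero:
  fixes c d :: real
  assumes "Im \<tau> > 0" "c \<noteq> 0 \<or> d \<noteq> 0"
  shows "of_real c * \<tau> + of_real d \<noteq> 0"
proof
  assume "of_real c * \<tau> + of_real d = 0"
  hence "Re (of_real c * \<tau> + of_real d) = 0" "Im (of_real c * \<tau> + of_real d) = 0" by simp_all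
  thus False using assms by auto
qed

lemma Im_moebius_pos:
  fixes a b c d :: int
  assumes "Im \<tau> > 0" "a * d - b * c = 1"
  shows "of_int c * \<tau> + of_int d \<noteq> 0" "Im ((of_int a * \<tau> + of_int b) / (of_int c * \<tau> + of_int d)) > 0"
proof -
  have "c \<noteq> 0 \<or> d \<noteq> 0" using assms(2) by auto
  hence nz: "of_real (real_of_int c) * \<tau> + of_real (real_of_int d) \<noteq> 0"
    using assms(1) by (intro moebius_denom_nonzero) auto
  thus "of_int c * \<tau> + of_int d \<noteq> 0" by simp
  have "real_of_int a * real_of_int d - real_of_int b * real_of_int c = 1"
    using assms(2) by (metis of_int_1 of_int_diff of_int_mult)
  from Im_moebius[OF this, of \<tau>] show "Im ((of_int a * \<tau> + of_int b) / (of_int c * \<tau> + of_int d)) > 0"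
    using nz assms(1) by simp
qed

text \<open>The matrix is the translation by - 2 * j conjugated by the inversion.\<close>

lemma weber_f_lower_unipotent:
  assumes "Im \<tau> > 0"
  shows "weber_f (\<tau> / (2 * of_int j * \<tau> + 1)) = root24 j * weber_f \<tau>"
proof -
  define z where "z = - 1 / \<tau> + 2 * of_int (- j)"
  have z: "Im z > 0" using Im_minus_inverse_pos[OF assms] by (simp add: z_def)
  have nz: "\<tau> \<noteq> 0" "2 * of_int j * \<tau> + 1 \<noteq> 0"
    using assms Im_moebius_pos(1)[OF assms, of 1 1 0 "2 * j"] by auto
  have "weber_f (- 1 / z) = root24 j * weber_f \<tau>"
    unfolding weber_f_inversion[OF z] unfolding z_def
    using Im_minus_inverse_pos[OF assms] weber_f_inversion[OF assms]
    by (subst weber_f_plus_even) simp_all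
  also have "- 1 / z = \<tau> / (2 * of_int j * \<tau> + 1)"
  proof -
    have "z = - ((2 * of_int j * \<tau> + 1) / \<tau>)"
      using nz(1) by (simp add: z_def field_simps)
    thus ?thesis by simp
  qed
  finally show ?thesis .
qed

section \<open>The exponent of the multiplier modulo 8 and modulo 3\<close>

lemma eight_dvd_square_minus_1:
  fixes l :: int
  assumes "odd l"
  shows "8 dvd l ^ 2 - 1"
proof -
  obtain j where l: "l = 2 * j + 1" using assms by (elim oddE)
  have "even (j * (j + 1))" by simp
  then obtain i where i: "j * (j + 1) = 2 * i" by blast
  have "l ^ 2 - 1 = 4 * (j * (j + 1))" by (simp add: l power2_eq_square algebra_simps)
  thus ?thesis by (simp add: i)
qed

lemma mod_3_cases: "(a::int) mod 3 = 0 \<or> a mod 3 = 1 \<or> a mod 3 = 2"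
  by presburger

text \<open>For the matrix with rows (m, 2k) and (2k', l) the exponent modulo 3 is (m + l) * k' - k
  * l * (k'^2 - 1), of the same shape as in the classical multiplier of \<eta>. Splitting off a
  translation by 2s changes it by s, up to a multiple of (l^2 - 1) * (k'^2 - 1); the determinant
  prevents 3 from dividing both l and k', so this product is 0 modulo 3.\<close>

lemma weber_char_mod3_upper:
  fixes m l k k' s :: int
  assumes "m * l - 4 * k * k' = 1"
  shows "3 dvd ((m - 4 * s * k' + l) * k' - (k - s * l) * l * (k' ^ 2 - 1)) + s
      - ((m + l) * k' - k * l * (k' ^ 2 - 1))"
proof -
  have "3 dvd (l ^ 2 - 1) * (k' ^ 2 - 1)"
  proof -
    have "((m mod 3) * (l mod 3) - 4 * (k mod 3) * (k' mod 3)) mod 3 = (m * l - 4 * k * k') mod 3"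
      unfolding cong_def [symmetric] by (intro cong_diff cong_mult cong_refl) (simp_all add: cong_def)
    hence "((m mod 3) * (l mod 3) - 4 * (k mod 3) * (k' mod 3)) mod 3 = 1"
      using assms by simp
    hence "l mod 3 \<noteq> 0 \<or> k' mod 3 \<noteq> 0" by auto
    moreover have "3 dvd x ^ 2 - 1" if "x mod 3 \<noteq> 0" for x :: int
    proof -
      have "(x ^ 2 - 1) mod 3 = ((x mod 3) ^ 2 - 1) mod 3"
        unfolding cong_def [symmetric] by (intro cong_diff cong_pow cong_refl) (simp add: cong_def)
      thus ?thesis using that mod_3_cases[of x] by auto
    qed
    ultimately show ?thesis by (metis dvd_mult dvd_mult2)
  qed
  moreover have "((m - 4 * s * k' + l) * k' - (k - s * l) * l * (k' ^ 2 - 1)) + s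
      - ((m + l) * k' - k * l * (k' ^ 2 - 1)) = s * ((l ^ 2 - 1) * (k' ^ 2 - 1)) - 3 * (s * k' ^ 2)"
    by (simp add: algebra_simps power2_eq_square)
  ultimately show ?thesis by (simp add: dvd_diff)
qed

text \<open>The companion for splitting off a lower unipotent matrix. Only residues modulo 3 matter,
  which leaves a finite check.\<close>

lemma weber_char_mod3_lower:
  fixes m l k k' s :: int
  assumes "m * l - 4 * k * k' = 1" "s = 1 \<or> s = - 1"
  shows "3 dvd ((m + (l - 4 * s * k)) * (k' - s * m) - k * (l - 4 * s * k) * ((k' - s * m) ^ 2 - 1)) - s
      - ((m + l) * k' - k * l * (k' ^ 2 - 1))"
proof -
  define a b c d where "a = m mod 3" and "b = l mod 3" and "c = k mod 3" and "d = k' mod 3"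
  have "(a * b - 4 * c * d) mod 3 = (m * l - 4 * k * k') mod 3"
    unfolding a_def b_def c_def d_def cong_def [symmetric]
    by (intro cong_diff cong_mult cong_refl) (simp_all add: cong_def)
  hence h: "(a * b - 4 * c * d) mod 3 = 1" using assms by simp
  have eq: "(((m + (l - 4 * s * k)) * (k' - s * m) - k * (l - 4 * s * k) * ((k' - s * m) ^ 2 - 1)) - s
      - ((m + l) * k' - k * l * (k' ^ 2 - 1))) mod 3 =
      (((a + (b - 4 * s * c)) * (d - s * a) - c * (b - 4 * s * c) * ((d - s * a) ^ 2 - 1)) - s
      - ((a + b) * d - c * b * (d ^ 2 - 1))) mod 3"
    unfolding a_def b_def c_def d_def cong_def [symmetric]
    by (intro cong_add cong_diff cong_mult cong_pow cong_refl) (simp_all add: cong_def)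
  have "a = 0 \<or> a = 1 \<or> a = 2" "b = 0 \<or> b = 1 \<or> b = 2" "c = 0 \<or> c = 1 \<or> c = 2" "d = 0 \<or> d = 1 \<or> d = 2"
    unfolding a_def b_def c_def d_def by (rule mod_3_cases)+
  thus ?thesis
    unfolding dvd_eq_mod_eq_0 eq using assms(2) h by (elim disjE) simp_all
qed

lemma abs_diff_less_of_sign:
  fixes m x :: int
  assumes "\<bar>x\<bar> < \<bar>m\<bar>" "x \<noteq> 0" "s = sgn m * sgn x"
  shows "\<bar>m - 2 * s * x\<bar> < \<bar>m\<bar>"
  using assms by (cases "m > 0"; cases "x > 0") auto

text \<open>Euclid's algorithm on the first column (m, 2k'): one entry is odd and the other even, so
  their absolute values differ, and the larger one shrinks when twice the other is added or
  subtracted. Each such step splits off a matrix whose multiplier is known. The exponent is recorded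
  modulo 8 and modulo 3, where it has closed forms.\<close>

lemma weber_f_Gamma2:
  fixes m l k k' :: int
  assumes "m * l - 4 * k * k' = 1" and \<tau>: "Im \<tau> > 0"
  shows "\<exists>n. weber_f ((of_int m * \<tau> + 2 * of_int k) / (2 * of_int k' * \<tau> + of_int l)) = root24 (- n) * weber_f \<tau>
    \<and> 8 dvd n - l * (k - k') \<and> 3 dvd n - ((m + l) * k' - k * l * (k' ^ 2 - 1))"
  using assms(1)
proof (induction "nat (\<bar>m\<bar> + \<bar>2 * k'\<bar>)" arbitrary: m l k k' rule: less_induct)
  case less
  note det = less.prems
  have oddl: "odd l" and oddm: "odd m"
  proof -
    have "m * l = 1 + 2 * (2 * k * k')" using det by simp
    hence "odd (m * l)" by (metis dvd_triv_left odd_one even_add)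
    thus "odd l" "odd m" by simp_all
  qed
  define z where "z = (of_int m * \<tau> + 2 * of_int k) / (2 * of_int k' * \<tau> + of_int l)"
  consider "k' = 0" | "k' \<noteq> 0" "\<bar>2 * k'\<bar> < \<bar>m\<bar>" | "k' \<noteq> 0" "\<bar>m\<bar> < \<bar>2 * k'\<bar>"
  proof -
    have "\<bar>m\<bar> \<noteq> \<bar>2 * k'\<bar>" using oddm by (metis dvd_abs_iff dvd_triv_left)
    thus ?thesis using that by (meson linorder_neqE)
  qed
  thus ?case
  proof cases
    case 1
    hence "m * l = 1" using det by simp
    hence ml: "m = 1 \<and> l = 1 \<or> m = - 1 \<and> l = - 1" by (rule zmult_eq_1_iff[THEN iffD1])
    hence "z = \<tau> + 2 * of_int (k * l)" using 1 by (auto simp: z_def field_simps)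
    hence "weber_f z = root24 (- (k * l)) * weber_f \<tau>" using weber_f_plus_even[OF \<tau>, of "k * l"] by simp
    thus ?thesis using 1 ml unfolding z_def by (intro exI[of _ "k * l"]) auto
  next
    case 2
    define s where "s = sgn m * sgn (2 * k')"
    have s: "\<bar>m - 4 * s * k'\<bar> < \<bar>m\<bar>"
      using abs_diff_less_of_sign[of "2 * k'" m s] 2 by (simp add: s_def mult_ac)
    hence lt: "nat (\<bar>m - 4 * s * k'\<bar> + \<bar>2 * k'\<bar>) < nat (\<bar>m\<bar> + \<bar>2 * k'\<bar>)" by linarith
    have det': "(m - 4 * s * k') * l - 4 * (k - s * l) * k' = 1"
      using det by (simp add: algebra_simps)
    define z' where "z' = (of_int (m - 4 * s * k') * \<tau> + 2 * of_int (k - s * l)) / (2 * of_int k' * \<tau> + of_int l)"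
    have z': "2 * of_int k' * \<tau> + of_int l \<noteq> 0" "Im z' > 0"
      using Im_moebius_pos[OF \<tau>, of "m - 4 * s * k'" l "2 * (k - s * l)" "2 * k'"] det'
      by (simp_all add: z'_def algebra_simps)
    have "z = z' + 2 * of_int s"
      using z'(1) unfolding z_def z'_def by (simp add: field_simps)
    hence fz: "weber_f z = root24 (- s) * weber_f z'"
      using weber_f_plus_even[OF z'(2)] by simp
    obtain n where n: "weber_f z' = root24 (- n) * weber_f \<tau>" "8 dvd n - l * (k - s * l - k')"
        "3 dvd n - ((m - 4 * s * k' + l) * k' - (k - s * l) * l * (k' ^ 2 - 1))"
      using less.hyps[OF lt det'] unfolding z'_def by blast
    have "weber_f z = root24 (- (n + s)) * weber_f \<tau>"
      unfolding fz n(1) using root24_add[of "- n" "- s"] by (simp add: mult_ac)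
    \<comment> \<open>The new exponent n + s deviates from the closed form by s * (l^2 - 1), which 8
      divides because l is odd.\<close>
    moreover have "8 dvd (n - l * (k - s * l - k')) - s * (l ^ 2 - 1)"
      by (rule dvd_diff[OF n(2) dvd_mult[OF eight_dvd_square_minus_1[OF oddl]]])
    hence "8 dvd n + s - l * (k - k')"
      by (simp add: algebra_simps power2_eq_square)
    moreover have "3 dvd n + s - ((m + l) * k' - k * l * (k' ^ 2 - 1))"
      using dvd_add[OF n(3) weber_char_mod3_upper[OF det, of s]] by (simp add: algebra_simps)
    ultimately show ?thesis unfolding z_def by blast
  next
    case 3
    define s where "s = sgn (2 * k') * sgn m"
    have m0: "m \<noteq> 0" using oddm by auto
    have s1: "s = 1 \<or> s = - 1" using m0 3 by (auto simp: s_def sgn_if)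
    have s: "\<bar>2 * (k' - s * m)\<bar> < \<bar>2 * k'\<bar>"
      using abs_diff_less_of_sign[of m "2 * k'" s] 3 m0 by (simp add: s_def algebra_simps)
    hence lt: "nat (\<bar>m\<bar> + \<bar>2 * (k' - s * m)\<bar>) < nat (\<bar>m\<bar> + \<bar>2 * k'\<bar>)" by linarith
    have det': "m * (l - 4 * s * k) - 4 * k * (k' - s * m) = 1"
      using det by (simp add: algebra_simps)
    define z' where "z' = (of_int m * \<tau> + 2 * of_int k) / (2 * of_int (k' - s * m) * \<tau> + of_int (l - 4 * s * k))"
    have z': "2 * of_int (k' - s * m) * \<tau> + of_int (l - 4 * s * k) \<noteq> 0" "Im z' > 0"
      using Im_moebius_pos[OF \<tau>, of m "l - 4 * s * k" "2 * k" "2 * (k' - s * m)"] det'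
      by (simp_all add: z'_def algebra_simps)
    have "2 * of_int k' * \<tau> + of_int l \<noteq> 0"
      using Im_moebius_pos(1)[OF \<tau>, of m l "2 * k" "2 * k'"] det by (simp add: algebra_simps)
    moreover have "2 * of_int s * z' + 1 =
        (2 * of_int k' * \<tau> + of_int l) / (2 * of_int (k' - s * m) * \<tau> + of_int (l - 4 * s * k))"
      using z'(1) unfolding z'_def by (simp add: field_simps)
    ultimately have "z = z' / (2 * of_int s * z' + 1)"
      using z'(1) unfolding z_def z'_def by simp
    hence fz: "weber_f z = root24 s * weber_f z'"
      using weber_f_lower_unipotent[OF z'(2)] by simp
    obtain n where n: "weber_f z' = root24 (- n) * weber_f \<tau>" "8 dvd n - (l - 4 * s * k) * (k - (k' - s * m))"
        "3 dvd n - ((m + (l - 4 * s * k)) * (k' - s * m) - k * (l - 4 * s * k) * ((k' - s * m) ^ 2 - 1))"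
      using less.hyps[OF lt det'] unfolding z'_def by blast
    have "weber_f z = root24 (- (n - s)) * weber_f \<tau>"
      unfolding fz n(1) using root24_add[of s "- n"] by (simp add: mult_ac)
    moreover have "8 dvd n - s - l * (k - k')"
    proof -
      \<comment> \<open>As m and s are odd, one of k and s * k + m is even; this raises the visible
        factor 4 to 8.\<close>
      have "even (k * (s * k + m))" using oddm s1 by auto
      hence "4 * 2 dvd 4 * (k * (s * k + m))" by (rule mult_dvd_mono[OF dvd_refl])
      hence "8 dvd (n - (l - 4 * s * k) * (k - (k' - s * m))) + 8 * (s * k * k') - 4 * (k * (s * k + m))"
        using n(2) by (intro dvd_diff[OF dvd_add]) simp_all
      also have "\<dots> = n - s - l * (k - k')"
      proof -
        have lm: "l * m = 1 + 4 * k * k'" using det by (simp add: mult.commute)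
        have ss: "s * s = 1" using s1 by auto
        have "(l - 4 * s * k) * (k - (k' - s * m)) =
            l * (k - k') + s * (l * m) - 4 * s * k * (k - k') - 4 * (s * s) * k * m"
          by (simp add: algebra_simps)
        also have "\<dots> = l * (k - k') + s + 8 * (s * k * k') - 4 * (k * (s * k + m))"
          unfolding lm ss by (simp add: algebra_simps)
        finally show ?thesis by simp
      qed
      finally show ?thesis .
    qed
    moreover have "3 dvd n - s - ((m + l) * k' - k * l * (k' ^ 2 - 1))"
      using dvd_add[OF n(3) weber_char_mod3_lower[OF det s1]] by (simp add: algebra_simps)
    ultimately show ?thesis unfolding z_def by blast
  qed
qed

text \<open>For \<open>l\<close> prime to \<open>3\<close> the two congruences combine to a multiplier that is linear in \<open>k\<close> and \<open>k'\<close>.\<close>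
lemma weber_f_Fricke:
  fixes l m k k' :: int
  assumes det: "l * m = 1 + 4 * k * k'" and l3: "\<not> 3 dvd l" and \<tau>: "Im \<tau> > 0"
  shows "weber_f ((2 * of_int k * \<tau> - of_int m) / (of_int l * \<tau> - 2 * of_int k')) = root24 (l * (k' - k)) * weber_f \<tau>"
proof -
  define \<sigma> where "\<sigma> = - 1 / \<tau>"
  have \<sigma>: "Im \<sigma> > 0" unfolding \<sigma>_def by (rule Im_minus_inverse_pos[OF \<tau>])
  have det': "m * l - 4 * k * k' = 1" using det by (simp add: mult.commute)
  \<comment> \<open>The matrix in the claim is one with even off-diagonal entries times the
    inversion, so its multiplier is read off at \<open>\<sigma>\<close>.\<close>
  obtain n where n: "weber_f ((of_int m * \<sigma> + 2 * of_int k) / (2 * of_int k' * \<sigma> + of_int l)) = root24 (- n) * weber_f \<sigma>"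
      "8 dvd n - l * (k - k')" "3 dvd n - ((m + l) * k' - k * l * (k' ^ 2 - 1))"
    using weber_f_Gamma2[OF det' \<sigma>] by blast
  have "3 dvd ((m + l) * k' - k * l * (k' ^ 2 - 1)) - l * (k - k')"
  proof -
    define a b c d where "a = m mod 3" and "b = l mod 3" and "c = k mod 3" and "d = k' mod 3"
    have "(a * b - 4 * c * d) mod 3 = (m * l - 4 * k * k') mod 3"
      unfolding a_def b_def c_def d_def cong_def [symmetric]
      by (intro cong_diff cong_mult cong_refl) (simp_all add: cong_def)
    hence h: "(a * b - 4 * c * d) mod 3 = 1" using det' by simp
    have eq: "(((m + l) * k' - k * l * (k' ^ 2 - 1)) - l * (k - k')) mod 3 =
        (((a + b) * d - c * b * (d ^ 2 - 1)) - b * (c - d)) mod 3"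
      unfolding a_def b_def c_def d_def cong_def [symmetric]
    by (intro cong_add cong_diff cong_mult cong_pow cong_refl) (simp_all add: cong_def)
    have "a = 0 \<or> a = 1 \<or> a = 2" "c = 0 \<or> c = 1 \<or> c = 2" "d = 0 \<or> d = 1 \<or> d = 2"
      unfolding a_def c_def d_def by (rule mod_3_cases)+
    moreover have "b = 1 \<or> b = 2"
      using l3 mod_3_cases[of l] by (auto simp: b_def dvd_eq_mod_eq_0)
    ultimately show ?thesis
      unfolding dvd_eq_mod_eq_0 eq using h by (elim disjE) simp_all
  qed
  from dvd_add[OF n(3) this] have "3 dvd n - l * (k - k')" by simp
  moreover have "24 dvd x" if "3 dvd x" "8 dvd x" for x :: int
    using that by presburger
  ultimately have "24 dvd n - l * (k - k')"
    using n(2) by blast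
  hence "[- n = l * (k' - k)] (mod 24)"
    by (simp add: cong_iff_dvd_diff algebra_simps dvd_diff_commute)
  hence "root24 (- n) = root24 (l * (k' - k))" by (rule root24_cong)
  moreover have "(of_int m * \<sigma> + 2 * of_int k) / (2 * of_int k' * \<sigma> + of_int l) =
      (2 * of_int k * \<tau> - of_int m) / (of_int l * \<tau> - 2 * of_int k')"
  proof -
    have t0: "\<tau> \<noteq> 0" using \<tau> by auto
    have "(of_int m * \<sigma> + 2 * of_int k) = (2 * of_int k * \<tau> - of_int m) / \<tau>"
      "(2 * of_int k' * \<sigma> + of_int l) = (of_int l * \<tau> - 2 * of_int k') / \<tau>"
      using t0 by (simp_all add: \<sigma>_def field_simps)
    thus ?thesis using t0 by simp
  qed
  ultimately show ?thesis
    using n(1) weber_f_inversion[OF \<tau>] by (simp add: \<sigma>_def)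
qed

section \<open>Functions invariant under the theta group\<close>

text \<open>\<open>Orb\<close> consists of the images of \<tau> under integral matrices of
  determinant 1 at which N has the value N \<tau>; it is closed under both moves, and the theta
  group itself need not be described. A highest point of \<open>Orb\<close>, translated into
  \<bar>Re z\<bar> \<le> 1, lies outside the open unit disc since the inversion would otherwise
  raise it.\<close>

lemma theta_group_reduction:
  fixes N :: "complex \<Rightarrow> 'b"
  assumes per: "\<And>z. Im z > 0 \<Longrightarrow> N (z + 2) = N z" and inv: "\<And>z. Im z > 0 \<Longrightarrow> N (- 1 / z) = N z"
    and \<tau>: "Im \<tau> > 0"
  obtains z where "\<bar>Re z\<bar> \<le> 1" "norm z \<ge> 1" "Im z > 0" "N z = N \<tau>"
proof -
  have per_int: "N (z + 2 * of_int k) = N z" if "Im z > 0" for z k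
  proof -
    have nat: "N (z + 2 * of_nat n) = N z" if "Im z > 0" for z n
      by (induction n) (use per[of "z + 2 * of_nat _"] that in \<open>simp_all add: algebra_simps\<close>)
    show ?thesis
    proof (cases "k \<ge> 0")
      case True
      thus ?thesis using nat[OF that, of "nat k"] by simp
    next
      case False
      thus ?thesis using nat[of "z + 2 * of_int k" "nat (- k)"] that by simp
    qed
  qed
  define Orb where "Orb = {z. N z = N \<tau> \<and> (\<exists>a b c d :: int. a * d - b * c = 1 \<and>
      z = (of_int a * \<tau> + of_int b) / (of_int c * \<tau> + of_int d))}"
  have Im_pos: "Im z > 0" if "z \<in> Orb" for z
    using that Im_moebius_pos(2)[OF \<tau>] unfolding Orb_def by blast
  have base: "\<tau> \<in> Orb"
    unfolding Orb_def by (simp, rule exI[of _ 1], rule exI[of _ 0], rule exI[of _ 0], rule exI[of _ 1]) simp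
  have shift: "z + 2 * of_int k \<in> Orb" if zO: "z \<in> Orb" for z k
  proof -
    obtain a b c d :: int where abcd: "a * d - b * c = 1"
        "z = (of_int a * \<tau> + of_int b) / (of_int c * \<tau> + of_int d)"
      using zO unfolding Orb_def by blast
    have "(a + 2 * k * c) * d - (b + 2 * k * d) * c = 1"
      using abcd(1) by (simp add: algebra_simps)
    moreover have "z + 2 * of_int k =
        (of_int (a + 2 * k * c) * \<tau> + of_int (b + 2 * k * d)) / (of_int c * \<tau> + of_int d)"
      using Im_moebius_pos(1)[OF \<tau> abcd(1)] unfolding abcd(2) by (simp add: field_simps)
    moreover have "N (z + 2 * of_int k) = N \<tau>"
      using per_int[OF Im_pos[OF zO]] zO by (simp add: Orb_def)
    ultimately show ?thesis unfolding Orb_def by blast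
  qed
  have flip: "- 1 / z \<in> Orb" if zO: "z \<in> Orb" for z
  proof -
    obtain a b c d :: int where abcd: "a * d - b * c = 1"
        "z = (of_int a * \<tau> + of_int b) / (of_int c * \<tau> + of_int d)"
      using zO unfolding Orb_def by blast
    have "(- c) * b - (- d) * a = 1"
      using abcd(1) by (simp add: algebra_simps)
    moreover have "- 1 / z = (of_int (- c) * \<tau> + of_int (- d)) / (of_int a * \<tau> + of_int b)"
      unfolding abcd(2) by (simp add: minus_divide_left)
    moreover have "N (- 1 / z) = N \<tau>"
      using inv[OF Im_pos[OF zO]] zO by (simp add: Orb_def)
    ultimately show ?thesis unfolding Orb_def by blast
  qed
  \<comment> \<open>A height of at least Im \<tau> bounds c and then d, so only finitely many such
    heights occur and a maximum exists.\<close>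
  define Ims where "Ims = Im ` {z \<in> Orb. Im z \<ge> Im \<tau>}"
  have "finite Ims"
  proof (rule finite_subset)
    define B where "B = \<lceil>1 / Im \<tau>\<rceil>"
    define E where "E = \<lceil>1 + of_int B * norm \<tau>\<rceil>"
    show "finite ((\<lambda>(c, d). Im \<tau> / norm (of_int c * \<tau> + of_int d) ^ 2) ` ({- B..B} \<times> {- E..E}))"
      by simp
    show "Ims \<subseteq> (\<lambda>(c, d). Im \<tau> / norm (of_int c * \<tau> + of_int d) ^ 2) ` ({- B..B} \<times> {- E..E})"
    proof
      fix y assume "y \<in> Ims"
      then obtain a b c d :: int where abcd: "a * d - b * c = 1"
          "y = Im ((of_int a * \<tau> + of_int b) / (of_int c * \<tau> + of_int d))" "y \<ge> Im \<tau>"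
        unfolding Ims_def Orb_def by blast
      have nz: "of_int c * \<tau> + of_int d \<noteq> 0" by (rule Im_moebius_pos(1)[OF \<tau> abcd(1)])
      have "real_of_int a * real_of_int d - real_of_int b * real_of_int c = 1"
        using abcd(1) by (metis of_int_1 of_int_diff of_int_mult)
      from Im_moebius[OF this, of \<tau>] have y: "y = Im \<tau> / norm (of_int c * \<tau> + of_int d) ^ 2"
        using abcd(2) by simp
      have "Im \<tau> * norm (of_int c * \<tau> + of_int d) ^ 2 \<le> Im \<tau> * 1"
        using abcd(3) nz unfolding y by (simp add: field_simps)
      hence le: "norm (of_int c * \<tau> + of_int d) \<le> 1"
        using \<tau> by (simp add: power_le_one_iff abs_square_le_1)
      have "\<bar>of_int c\<bar> * Im \<tau> \<le> 1"
        using abs_Im_le_cmod[of "of_int c * \<tau> + of_int d"] le \<tau> by (simp add: abs_mult)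
      hence "\<bar>real_of_int c\<bar> \<le> 1 / Im \<tau>" using \<tau> by (simp add: field_simps)
      hence cB: "\<bar>c\<bar> \<le> B" unfolding B_def by linarith
      have "norm (of_int d :: complex) \<le> norm (of_int c * \<tau> + of_int d) + norm (of_int c * \<tau>)"
        using norm_triangle_ineq4[of "of_int c * \<tau> + of_int d" "of_int c * \<tau>"] by simp
      also have "\<dots> \<le> 1 + of_int B * norm \<tau>"
        using le cB by (intro add_mono) (auto simp: norm_mult intro!: mult_right_mono)
      finally have "\<bar>d\<bar> \<le> E" unfolding E_def by simp linarith
      thus "y \<in> (\<lambda>(c, d). Im \<tau> / norm (of_int c * \<tau> + of_int d) ^ 2) ` ({- B..B} \<times> {- E..E})"
        using y cB by (intro image_eqI[of _ _ "(c, d)"]) auto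
    qed
  qed
  moreover have "Im \<tau> \<in> Ims" using base by (auto simp: Ims_def)
  ultimately have "Max Ims \<in> Ims" and Max: "\<And>y. y \<in> Ims \<Longrightarrow> y \<le> Max Ims"
    by (auto intro: Max_in)
  then obtain z where z: "z \<in> Orb" "Im z \<ge> Im \<tau>" "Im z = Max Ims"
    by (auto simp: Ims_def)
  have max: "Im v \<le> Im z" if "v \<in> Orb" for v
    using Max[of "Im v"] that z by (cases "Im v \<ge> Im \<tau>") (auto simp: Ims_def)
  define v where "v = z + 2 * of_int (- round (Re z / 2))"
  have v: "v \<in> Orb" unfolding v_def by (rule shift[OF z(1)])
  have "\<bar>of_int (round (Re z / 2)) - Re z / 2\<bar> \<le> 1 / 2" by (rule of_int_round_abs_le)
  hence "\<bar>Re v\<bar> \<le> 1" by (simp add: v_def abs_if split: if_splits)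
  moreover have "norm v \<ge> 1"
  proof (rule ccontr)
    assume "\<not> norm v \<ge> 1"
    hence "norm v ^ 2 < 1" by (simp add: abs_square_less_1)
    moreover have "norm v > 0" using Im_pos[OF v] by auto
    ultimately have "Im v < Im v / norm v ^ 2" using Im_pos[OF v] by (simp add: field_simps)
    also have "\<dots> = Im (- 1 / v)" by (rule Im_minus_inverse [symmetric])
    also have "\<dots> \<le> Im z" by (rule max[OF flip[OF v]])
    finally show False by (simp add: v_def)
  qed
  moreover have "N v = N \<tau>" using v by (simp add: Orb_def)
  ultimately show ?thesis using that Im_pos[OF v] by blast
qed

text \<open>In the reduction domain the two cusps appear as Im z large and Im z small. Values of
  modulus above e therefore already occur on a compact part, so the modulus of N attains its
  maximum; N is then constant, which contradicts its smallness at infinity.\<close>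

lemma theta_group_invariant_eq_0:
  assumes hol: "N holomorphic_on upper_half"
    and per: "\<And>z. Im z > 0 \<Longrightarrow> N (z + 2) = N z" and inv: "\<And>z. Im z > 0 \<Longrightarrow> N (- 1 / z) = N z"
    and at_inf: "\<And>e. e > 0 \<Longrightarrow> \<exists>Y. \<forall>z. Im z > 0 \<longrightarrow> Im z \<ge> Y \<longrightarrow> norm (N z) \<le> e"
    and at_1: "\<And>e. e > 0 \<Longrightarrow> \<exists>y>0. \<forall>z. \<bar>Re z\<bar> \<le> 1 \<longrightarrow> norm z \<ge> 1 \<longrightarrow> 0 < Im z \<longrightarrow> Im z \<le> y \<longrightarrow> norm (N z) \<le> e"
    and \<tau>: "Im \<tau> > 0"
  shows "N \<tau> = 0"
proof (rule ccontr)
  assume nz: "N \<tau> \<noteq> 0"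
  define e where "e = norm (N \<tau>) / 2"
  have e: "e > 0" "e < norm (N \<tau>)" using nz by (simp_all add: e_def)
  obtain Y where Y: "\<And>z. Im z > 0 \<Longrightarrow> Im z \<ge> Y \<Longrightarrow> norm (N z) \<le> e"
    using at_inf[OF e(1)] by blast
  obtain y where y: "y > 0" "\<And>z. \<lbrakk>\<bar>Re z\<bar> \<le> 1; norm z \<ge> 1; 0 < Im z; Im z \<le> y\<rbrakk> \<Longrightarrow> norm (N z) \<le> e"
    using at_1[OF e(1)] by blast
  define K where "K = cbox (Complex (- 1) y) (Complex 1 Y)"
  have red: "\<exists>v\<in>K. N v = N z" if z: "Im z > 0" "norm (N z) > e" for z
  proof -
    obtain v where v: "\<bar>Re v\<bar> \<le> 1" "norm v \<ge> 1" "Im v > 0" "N v = N z"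
      using theta_group_reduction[of N, OF per inv z(1)] by blast
    have "Im v > y" using y(2)[OF v(1-3)] v(4) z(2) by force
    moreover have "Im v < Y" using Y[OF v(3)] v(4) z(2) by force
    ultimately have "v \<in> K" using v(1) by (auto simp: K_def in_cbox_complex_iff)
    thus ?thesis using v(4) by blast
  qed
  have K_sub: "K \<subseteq> upper_half"
    using y(1) by (auto simp: K_def in_cbox_complex_iff upper_half_def)
  obtain v0 where v0: "v0 \<in> K" "N v0 = N \<tau>" using red[OF \<tau>] e by blast
  have "continuous_on K (\<lambda>z. norm (N z))"
    using holomorphic_on_imp_continuous_on[OF hol] K_sub continuous_on_subset by (intro continuous_on_norm) blast
  moreover have "compact K" "K \<noteq> {}" using v0 by (auto simp: K_def)
  ultimately obtain x where x: "x \<in> K" "\<And>z. z \<in> K \<Longrightarrow> norm (N z) \<le> norm (N x)"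
    using continuous_attains_sup[of K "\<lambda>z. norm (N z)"] by blast
  have xe: "norm (N x) > e" using x(2)[OF v0(1)] v0(2) e by simp
  have "norm (N z) \<le> norm (N x)" if zH: "z \<in> upper_half" for z
  proof (cases "norm (N z) > e")
    case True
    then obtain v where "v \<in> K" "N v = N z" using red[of z] zH by (auto simp: upper_half_def)
    thus ?thesis using x(2)[of v] by simp
  next
    case False
    thus ?thesis using xe by simp
  qed
  hence "N constant_on upper_half"
    using maximum_modulus_principle[OF hol open_upper_half connected_upper_half open_upper_half subset_refl, of x]
      x(1) K_sub by blast
  then obtain c where c: "\<And>z. z \<in> upper_half \<Longrightarrow> N z = c" by (auto simp: constant_on_def)
  have "norm (N (\<i> * of_real (max 1 Y))) \<le> e" by (intro Y) auto
  moreover have "N (\<i> * of_real (max 1 Y)) = N \<tau>"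
    using c \<tau> by (simp add: upper_half_def)
  ultimately show False using e(2) by simp
qed

section \<open>Conjugates at prime level\<close>

locale weber_level =
  fixes l :: nat
  assumes prime_level: "prime l" and level_not_dvd: "\<not> l dvd 48"
begin

lemma not_2_dvd_level: "\<not> 2 dvd int l"
proof
  assume "2 dvd int l"
  hence "2 dvd l" by presburger
  hence "l = 2" using prime_level by (metis primes_dvd_imp_eq two_is_prime_nat)
  thus False using level_not_dvd by simp
qed

lemma not_3_dvd_level: "\<not> 3 dvd int l"
proof
  assume "3 dvd int l"
  hence "3 dvd l" by presburger
  moreover have "prime (3 :: nat)" by simp
  ultimately have "l = 3" using prime_level by (metis primes_dvd_imp_eq)
  thus False using level_not_dvd by simp
qed

lemma level_ge_5: "l \<ge> 5"
proof -
  have "l \<ge> 2" by (rule prime_ge_2_nat[OF prime_level])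
  moreover have "l \<noteq> 2" "l \<noteq> 4" "l \<noteq> 3"
    using not_2_dvd_level not_3_dvd_level by auto
  ultimately show ?thesis by simp
qed

lemma level_pos: "l > 0"
  using level_ge_5 by simp

lemma level_square: "24 dvd int l * int l - 1"
proof -
  have "3 dvd int l ^ 2 - 1"
  proof -
    have "(int l ^ 2 - 1) mod 3 = ((int l mod 3) ^ 2 - 1) mod 3"
      unfolding cong_def [symmetric] by (intro cong_diff cong_pow cong_refl) (simp add: cong_def)
    moreover have "int l mod 3 = 1 \<or> int l mod 3 = 2"
      using not_3_dvd_level mod_3_cases[of "int l"] unfolding dvd_eq_mod_eq_0 by blast
    ultimately show ?thesis unfolding dvd_eq_mod_eq_0 by (elim disjE) simp_all
  qed
  moreover have "8 dvd int l ^ 2 - 1"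
    using not_2_dvd_level by (intro eight_dvd_square_minus_1)
  moreover have "24 dvd x" if "3 dvd x" "8 dvd x" for x :: int
    using that by presburger
  ultimately show ?thesis by (simp add: power2_eq_square)
qed

text \<open>Multiplication by l is an involution modulo 24. This is what makes the rescaled
  conjugates periodic in k.\<close>

lemma root24_level_square: "root24 (int l * (int l * a)) = root24 a"
proof (rule root24_cong)
  have "int l * (int l * a) - a = (int l * int l - 1) * a" by (simp add: algebra_simps)
  thus "[int l * (int l * a) = a] (mod 24)"
    using level_square by (simp add: cong_iff_dvd_diff)
qed

text \<open>The \<open>l + 1\<close> conjugates of \<open>weber_f (l * \<tau>) / weber_f \<tau> ^ l\<close> under the theta group, the root of
  unity being chosen so that they are permuted exactly.\<close>
definition weber_conj_inf :: "complex \<Rightarrow> complex" where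
  "weber_conj_inf \<tau> = weber_f (of_nat l * \<tau>) / weber_f \<tau> ^ l"

definition weber_conj :: "int \<Rightarrow> complex \<Rightarrow> complex" where
  "weber_conj k \<tau> = root24 (int l * k) * weber_f ((\<tau> + 2 * of_int k) / of_nat l) / weber_f \<tau> ^ l"

lemma weber_f_24_plus_2:
  assumes "Im \<tau> > 0"
  shows "weber_f (\<tau> + 2) ^ 24 = weber_f \<tau> ^ 24"
  using weber_f_plus_even[OF assms, of 1] root24_power[of "- 1" 24]
  by (simp add: power_mult_distrib root24_eq_1_iff)

lemma weber_f_power_level_plus_2:
  assumes "Im \<tau> > 0"
  shows "weber_f (\<tau> + 2) ^ l = root24 (- int l) * weber_f \<tau> ^ l"
  using weber_f_plus_even[OF assms, of 1] by (simp add: power_mult_distrib root24_power)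

lemma weber_conj_inf_plus_2:
  assumes \<tau>: "Im \<tau> > 0"
  shows "weber_conj_inf (\<tau> + 2) = weber_conj_inf \<tau>"
proof -
  have "weber_f (of_nat l * (\<tau> + 2)) = root24 (- int l) * weber_f (of_nat l * \<tau>)"
    using weber_f_plus_even[of "of_nat l * \<tau>" "int l"] \<tau> level_pos by (simp add: algebra_simps)
  thus ?thesis
    unfolding weber_conj_inf_def weber_f_power_level_plus_2[OF \<tau>] by simp
qed

lemma weber_conj_plus_2:
  assumes \<tau>: "Im \<tau> > 0"
  shows "weber_conj k (\<tau> + 2) = weber_conj (k + 1) \<tau>"
proof -
  have "root24 (int l * (k + 1)) * root24 (- int l) = root24 (int l * k)"
    unfolding root24_add [symmetric] by (simp add: algebra_simps)
  hence "root24 (int l * k) / root24 (- int l) = root24 (int l * (k + 1))"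
    by (simp add: field_simps)
  moreover have "\<tau> + 2 + 2 * of_int k = \<tau> + 2 * of_int (k + 1)" by simp
  ultimately show ?thesis
    unfolding weber_conj_def weber_f_power_level_plus_2[OF \<tau>]
    by (metis (no_types, lifting) divide_divide_eq_left times_divide_eq_left)
qed

text \<open>Raising k by l translates the argument by 2, at the cost of \<open>root24 (- 1)\<close>;
  the normalising root gains \<open>root24 (int l * int l)\<close>, which is
  \<open>root24 1\<close>.\<close>

lemma weber_conj_plus_level:
  assumes \<tau>: "Im \<tau> > 0"
  shows "weber_conj (k + int l) \<tau> = weber_conj k \<tau>"
proof -
  have "(\<tau> + 2 * of_int (k + int l)) / of_nat l = (\<tau> + 2 * of_int k) / of_nat l + 2 * of_int 1"
    using level_pos by (simp add: field_simps)
  moreover have "weber_f ((\<tau> + 2 * of_int k) / of_nat l + 2 * of_int 1) =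
      root24 (- 1) * weber_f ((\<tau> + 2 * of_int k) / of_nat l)"
    using \<tau> level_pos by (intro weber_f_plus_even) simp
  moreover have "root24 (int l * (k + int l)) * root24 (- 1) = root24 (int l * k)"
    using root24_level_square[of 1] root24_add[of 1 "- 1"] by (simp add: distrib_left root24_add)
  ultimately show ?thesis
    unfolding weber_conj_def by (simp add: mult.assoc [symmetric])
qed

lemma weber_conj_inf_inversion:
  assumes \<tau>: "Im \<tau> > 0"
  shows "weber_conj_inf (- 1 / \<tau>) = weber_conj 0 \<tau>"
proof -
  have "weber_f (- 1 / (\<tau> / of_nat l)) = weber_f (\<tau> / of_nat l)"
    using \<tau> level_pos by (intro weber_f_inversion) simp
  thus ?thesis
    unfolding weber_conj_inf_def weber_conj_def weber_f_inversion[OF \<tau>] by simp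
qed

lemma weber_conj_0_inversion:
  assumes \<tau>: "Im \<tau> > 0"
  shows "weber_conj 0 (- 1 / \<tau>) = weber_conj_inf \<tau>"
  using weber_conj_inf_inversion[OF Im_minus_inverse_pos[OF \<tau>]] \<tau> by simp

text \<open>In terms of z = (\<tau> + 2k') / l the argument is the image of z under the matrix with
  rows (2k, - m) and (l, - 2k'), to which the linear multiplier applies. The root of unity it
  produces is precisely the change of normalisation from k to k'.\<close>

lemma weber_conj_inversion:
  assumes \<tau>: "Im \<tau> > 0" and k: "int l dvd 1 + 4 * k * k'"
  shows "weber_conj k (- 1 / \<tau>) = weber_conj k' \<tau>"
proof -
  obtain m where m: "int l * m = 1 + 4 * k * k'" using k by (metis dvdE)
  have m': "of_nat l * of_int m = 1 + 4 * of_int k * (of_int k' :: complex)"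
    using arg_cong[OF m, of "of_int :: int \<Rightarrow> complex"] by simp
  define z where "z = (\<tau> + 2 * of_int k') / of_nat l"
  have z: "Im z > 0" using \<tau> level_pos by (simp add: z_def)
  have \<tau>z: "\<tau> = of_nat l * z - 2 * of_int k'" using level_pos by (simp add: z_def)
  have [simp]: "\<tau> \<noteq> 0" "of_nat l \<noteq> (0 :: complex)" using \<tau> level_pos by auto
  have "(- 1 / \<tau> + 2 * of_int k) / of_nat l = (2 * of_int k * \<tau> - 1) / of_nat l / \<tau>"
    by (simp add: field_simps)
  also have "(2 * of_int k * \<tau> - 1) / of_nat l = 2 * of_int k * z - of_int m"
  proof -
    have "2 * of_int k * \<tau> - 1 = of_nat l * (2 * of_int k * z) - (1 + 4 * of_int k * of_int k')"
      unfolding \<tau>z by (simp add: algebra_simps)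
    also have "\<dots> = of_nat l * (2 * of_int k * z - of_int m)"
      unfolding m' [symmetric] by (simp add: algebra_simps)
    finally show ?thesis using level_pos by simp
  qed
  finally have arg: "(- 1 / \<tau> + 2 * of_int k) / of_nat l =
      (2 * of_int k * z - of_int m) / (of_int (int l) * z - 2 * of_int k')"
    using \<tau>z by simp
  have "weber_f ((- 1 / \<tau> + 2 * of_int k) / of_nat l) = root24 (int l * (k' - k)) * weber_f z"
    unfolding arg by (rule weber_f_Fricke[OF m not_3_dvd_level z])
  moreover have "root24 (int l * k) * root24 (int l * (k' - k)) = root24 (int l * k')"
    unfolding root24_add [symmetric] by (simp add: algebra_simps)
  ultimately show ?thesis
    unfolding weber_conj_def weber_f_inversion[OF \<tau>] z_def by (simp add: mult.assoc [symmetric])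
qed

text \<open>F is left arbitrary because only the permutation of the conjugates matters for
  invariance; its first argument is the 24th power because that is fixed by both generators.\<close>

definition conj_norm :: "(complex \<Rightarrow> complex \<Rightarrow> complex) \<Rightarrow> complex \<Rightarrow> complex" where
  "conj_norm F \<tau> = F (weber_f \<tau> ^ 24) (weber_conj_inf \<tau>) *
     (\<Prod>k\<in>{0..<int l}. F (weber_f \<tau> ^ 24) (weber_conj k \<tau>))"

lemma conj_norm_plus_2:
  assumes \<tau>: "Im \<tau> > 0"
  shows "conj_norm F (\<tau> + 2) = conj_norm F \<tau>"
proof -
  define g where "g = (\<lambda>k. F (weber_f \<tau> ^ 24) (weber_conj k \<tau>))"
  have "(\<Prod>k\<in>{0..<int l}. g (k + 1)) = (\<Prod>k\<in>{1..<int l + 1}. g k)"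
    by (rule prod.reindex_bij_witness[of _ "\<lambda>k. k - 1" "\<lambda>k. k + 1"]) auto
  also have "{1..<int l + 1} = insert (int l) {1..<int l}" using level_pos by auto
  also have "prod g \<dots> = g (0 + int l) * prod g {1..<int l}" by simp
  also have "g (0 + int l) = g 0" unfolding g_def by (simp only: weber_conj_plus_level[OF \<tau>])
  also have "g 0 * prod g {1..<int l} = prod g (insert 0 {1..<int l})" by simp
  also have "insert 0 {1..<int l} = {0..<int l}" using level_pos by auto
  finally show ?thesis
    unfolding conj_norm_def weber_f_24_plus_2[OF \<tau>] weber_conj_inf_plus_2[OF \<tau>] weber_conj_plus_2[OF \<tau>] g_def
    by simp
qed

text \<open>The inversion exchanges the conjugates with index infinity and 0, and acts on the
  nonzero residues modulo l by the involution k \<mapsto> - 1 / (4k).\<close>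

lemma conj_norm_inversion:
  assumes \<tau>: "Im \<tau> > 0"
  shows "conj_norm F (- 1 / \<tau>) = conj_norm F \<tau>"
proof -
  define A where "A = {1..<int l}"
  have split: "{0..<int l} = insert 0 A" using level_pos by (auto simp: A_def)
  have prime_int: "prime (int l)" using prime_level by simp
  have not_dvd_A: "\<not> int l dvd k" if "k \<in> A" for k
    using that by (auto simp: A_def dest: zdvd_imp_le)
  have not_dvd_4: "\<not> int l dvd 4"
    using level_ge_5 by (auto dest: zdvd_imp_le)
  have "\<exists>k'\<in>A. int l dvd 1 + 4 * k * k'" if k: "k \<in> A" for k
  proof -
    have "\<not> int l dvd 4 * k"
      using not_dvd_A[OF k] not_dvd_4 prime_dvd_multD[OF prime_int] by blast
    hence "coprime (4 * k) (int l)"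
      by (subst coprime_commute) (rule prime_imp_coprime[OF prime_int])
    then obtain x where x: "[4 * k * x = 1] (mod int l)" by (metis cong_solve_coprime_int)
    define k' where "k' = (- x) mod int l"
    have "[1 + 4 * k * k' = 1 + 4 * k * (- x)] (mod int l)"
      unfolding k'_def by (intro cong_add cong_mult cong_refl) (simp add: cong_def)
    also have "1 + 4 * k * (- x) = 1 - 4 * k * x" by simp
    also have "[1 - 4 * k * x = 1 - 1] (mod int l)" by (intro cong_diff cong_refl x)
    finally have d: "int l dvd 1 + 4 * k * k'" by (simp add: cong_0_iff)
    have "k' \<noteq> 0" using d level_ge_5 by (auto dest: zdvd_imp_le)
    moreover have "0 \<le> k'" "k' < int l" using level_pos by (simp_all add: k'_def)
    ultimately have "k' \<in> A" by (simp add: A_def)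
    thus ?thesis using d by blast
  qed
  then obtain s where s: "\<And>k. k \<in> A \<Longrightarrow> s k \<in> A" "\<And>k. k \<in> A \<Longrightarrow> int l dvd 1 + 4 * k * s k"
    by metis
  have ss: "s (s k) = k" if k: "k \<in> A" for k
  proof -
    have "int l dvd (1 + 4 * s k * s (s k)) - (1 + 4 * k * s k)"
      by (intro dvd_diff s k)
    also have "\<dots> = 4 * s k * (s (s k) - k)" by (simp add: algebra_simps)
    finally have "int l dvd s (s k) - k"
      using not_dvd_4 not_dvd_A[OF s(1)[OF k]] prime_dvd_multD[OF prime_int] by blast
    moreover have "\<bar>s (s k) - k\<bar> < int l"
      using s(1)[OF s(1)[OF k]] k by (auto simp: A_def)
    ultimately show ?thesis by (metis dvd_imp_le_int eq_iff_diff_eq_0 linorder_not_le abs_of_nat)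
  qed
  define U where "U = weber_f \<tau> ^ 24"
  have U: "weber_f (- 1 / \<tau>) ^ 24 = U" using weber_f_inversion[OF \<tau>] by (simp add: U_def)
  have "(\<Prod>k\<in>A. F U (weber_conj k (- 1 / \<tau>))) = (\<Prod>k\<in>A. F U (weber_conj k \<tau>))"
  proof (rule prod.reindex_bij_witness[of _ s s])
    show "F U (weber_conj (s k) \<tau>) = F U (weber_conj k (- 1 / \<tau>))" if "k \<in> A" for k
      unfolding weber_conj_inversion[OF \<tau> s(2)[OF that]] ..
  qed (auto simp: ss s)
  thus ?thesis
    unfolding conj_norm_def split U U_def [symmetric] weber_conj_inf_inversion[OF \<tau>]
    by (simp add: A_def weber_conj_0_inversion[OF \<tau>, simplified])
qed

lemma holomorphic_weber_f_compose:
  assumes "f holomorphic_on upper_half" "\<And>z. Im z > 0 \<Longrightarrow> Im (f z) > 0"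
  shows "(\<lambda>z. weber_f (f z)) holomorphic_on upper_half"
  using holomorphic_on_compose_gen[OF assms(1) holomorphic_weber_f] assms(2)
  by (auto simp: upper_half_def o_def)

lemma holomorphic_weber_conj_inf: "weber_conj_inf holomorphic_on upper_half"
  unfolding weber_conj_inf_def
  by (intro holomorphic_intros holomorphic_weber_f holomorphic_weber_f_compose)
     (auto simp: upper_half_def weber_f_nonzero level_pos)

lemma holomorphic_weber_conj: "weber_conj k holomorphic_on upper_half"
  unfolding weber_conj_def
  by (intro holomorphic_intros holomorphic_weber_f holomorphic_weber_f_compose)
     (auto simp: upper_half_def weber_f_nonzero level_pos)

end

section \<open>Growth at the cusps\<close>

text \<open>For r the modulus of the nome and y = Im \<tau>, 1 / r - r \<ge> exp (pi * y) - 1 \<ge>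
  3 * y. The bound must hold at every height, since near the cusp 1 the imaginary part tends to
  0.\<close>

lemma odd_prod_nome_bound:
  assumes \<tau>: "Im \<tau> > 0"
  shows "norm (odd_prod (nome \<tau>) x) \<le> exp (norm x / (3 * Im \<tau>))"
proof -
  define r where "r = exp (- pi * Im \<tau>)"
  have r: "0 < r" "r < 1" using \<tau> by (simp_all add: r_def)
  have r2: "r ^ 2 < 1" using r by (simp add: power_less_one_iff)
  have "3 * Im \<tau> \<le> pi * Im \<tau>" using pi_gt3 \<tau> by (intro mult_right_mono) auto
  also have "\<dots> \<le> exp (pi * Im \<tau>) - 1" using exp_ge_add_one_self[of "pi * Im \<tau>"] by linarith
  also have "\<dots> \<le> 1 / r - r" using r by (simp add: r_def exp_minus field_simps)
  finally have "3 * Im \<tau> * r \<le> (1 / r - r) * r" using r by (intro mult_right_mono) auto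
  also have "\<dots> = 1 - r ^ 2" using r by (simp add: field_simps power2_eq_square)
  finally have "r / (1 - r ^ 2) \<le> 1 / (3 * Im \<tau>)"
    using \<tau> r2 by (simp add: field_simps)
  hence "r / (1 - r ^ 2) * norm x \<le> 1 / (3 * Im \<tau>) * norm x"
    by (intro mult_right_mono) auto
  hence le: "exp (r / (1 - r ^ 2) * norm x) \<le> exp (norm x / (3 * Im \<tau>))" by simp
  have "norm (odd_prod (nome \<tau>) x) \<le> exp (r / (1 - r ^ 2) * norm x)"
    using norm_odd_prod_le[OF norm_nome_less_1[OF \<tau>], of x] by (simp add: norm_nome r_def)
  thus ?thesis using le by (rule order_trans)
qed

lemma norm_weber_f_le:
  assumes \<tau>: "Im \<tau> > 0"
  shows "norm (weber_f \<tau>) \<le> exp (pi * Im \<tau> / 24 + 1 / Im \<tau>)"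
proof -
  have "norm (weber_f \<tau>) = exp (pi * Im \<tau> / 24) * norm (odd_prod (nome \<tau>) 1)"
    unfolding weber_f_nome[OF \<tau>] by (simp add: norm_mult norm_nome)
  also have "\<dots> \<le> exp (pi * Im \<tau> / 24) * exp (1 / Im \<tau>)"
  proof (intro mult_left_mono)
    have "1 / (3 * Im \<tau>) \<le> 1 / Im \<tau>" using \<tau> by (simp add: field_simps)
    thus "norm (odd_prod (nome \<tau>) 1) \<le> exp (1 / Im \<tau>)"
      using odd_prod_nome_bound[OF \<tau>, of 1] by (simp add: order_trans)
  qed simp
  finally show ?thesis by (simp add: exp_add)
qed

text \<open>The triple product identity writes the reciprocal of the product as two other products,
  so upper bounds for those give a lower bound here.\<close>

lemma norm_weber_f_ge:
  assumes \<tau>: "Im \<tau> > 0"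
  shows "norm (weber_f \<tau>) \<ge> exp (pi * Im \<tau> / 24 - 1 / Im \<tau>)"
proof -
  define a b c where "a = norm (odd_prod (nome \<tau>) 1)" and "b = norm (odd_prod (nome \<tau>) (- 1))"
    and "c = norm (odd_prod (nome \<tau>) (nome \<tau>))"
  have "a * b * c = norm (odd_prod (nome \<tau>) 1 * odd_prod (nome \<tau>) (- 1) * odd_prod (nome \<tau>) (nome \<tau>))"
    by (simp add: a_def b_def c_def norm_mult)
  hence abc: "a * (b * c) = 1"
    unfolding odd_prod_triple[OF norm_nome_less_1[OF \<tau>]] by (simp add: mult.assoc)
  have "c \<le> exp (norm (nome \<tau>) / (3 * Im \<tau>))"
    unfolding c_def by (rule odd_prod_nome_bound[OF \<tau>])
  also have "\<dots> \<le> exp (1 / (3 * Im \<tau>))"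
    using norm_nome_less_1[OF \<tau>] \<tau> by (simp add: divide_right_mono)
  finally have "b * c \<le> exp (1 / (3 * Im \<tau>)) * exp (1 / (3 * Im \<tau>))"
    using odd_prod_nome_bound[OF \<tau>, of "- 1"] by (intro mult_mono) (auto simp: b_def c_def)
  also have "\<dots> \<le> exp (1 / Im \<tau>)"
    unfolding exp_add [symmetric] using \<tau> by (simp add: field_simps)
  finally have "1 \<le> a * exp (1 / Im \<tau>)"
    using mult_left_mono[of "b * c" "exp (1 / Im \<tau>)" a] abc by (simp add: a_def)
  hence "exp (- (1 / Im \<tau>)) \<le> a"
    by (simp add: exp_minus field_simps)
  hence "exp (pi * Im \<tau> / 24) * exp (- (1 / Im \<tau>)) \<le> exp (pi * Im \<tau> / 24) * a"
    by (intro mult_left_mono) auto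
  thus ?thesis
    unfolding weber_f_nome[OF \<tau>] by (simp add: norm_mult norm_nome a_def flip: exp_add)
qed

text \<open>The low part of the reduction domain lies near the cusps 1 and - 1, which a translation
  identifies. Lying outside the unit disc forces \<bar>Re v - 1\<bar> \<le> y^2, hence - 1 / (v - 1)
  has height at least 1 / (2 * y), and the expansion at the cusp 1 gives exponential decay.\<close>

lemma norm_weber_f_power_24_le:
  assumes \<tau>: "\<bar>Re \<tau>\<bar> \<le> 1" "norm \<tau> \<ge> 1" "0 < Im \<tau>" "Im \<tau> \<le> 1"
  shows "norm (weber_f \<tau>) ^ 24 \<le> (2 * exp 4) ^ 12 * exp (- (3 / Im \<tau>))"
proof -
  define y where "y = Im \<tau>"
  have y: "0 < y" "y \<le> 1" using \<tau> by (simp_all add: y_def)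
  define v where "v = (if Re \<tau> \<ge> 0 then \<tau> else \<tau> + 2)"
  have nv: "norm (weber_f v) = norm (weber_f \<tau>)"
    using weber_f_plus_even[OF \<tau>(3), of 1] by (simp add: v_def norm_mult)
  define d where "d = Re v - 1"
  have Im_v: "Im v = y" by (simp add: v_def y_def)
  have d1: "\<bar>d\<bar> \<le> 1" and "\<bar>Re \<tau>\<bar> = 1 - \<bar>d\<bar>"
    using \<tau>(1) by (auto simp: d_def v_def)
  hence "1 \<le> (1 - \<bar>d\<bar>) ^ 2 + y ^ 2"
    using \<tau>(2) by (metis cmod_power2 one_le_power power2_abs y_def)
  hence "2 * \<bar>d\<bar> - \<bar>d\<bar> * \<bar>d\<bar> \<le> y ^ 2"
    by (simp add: power2_eq_square algebra_simps)
  moreover have "\<bar>d\<bar> * \<bar>d\<bar> \<le> \<bar>d\<bar> * 1" using d1 by (intro mult_left_mono) auto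
  ultimately have dy: "\<bar>d\<bar> \<le> y ^ 2" by linarith
  have "d ^ 2 = \<bar>d\<bar> * \<bar>d\<bar>" by (simp add: power2_eq_square)
  also have "\<dots> \<le> y ^ 2 * 1" using dy d1 by (intro mult_mono) auto
  finally have d2: "d ^ 2 \<le> y ^ 2" by simp
  define s where "s = - 1 / (v - 1)"
  have v1: "v - 1 \<noteq> 0" using Im_v y by auto
  have "Im s = y / (d ^ 2 + y ^ 2)"
    unfolding s_def Im_minus_inverse by (simp add: cmod_power2 d_def Im_v)
  moreover have "y / (d ^ 2 + y ^ 2) \<ge> y / (y ^ 2 + y ^ 2)"
    using d2 y by (intro divide_left_mono) (auto intro!: mult_pos_pos add_nonneg_pos)
  moreover have "y / (y ^ 2 + y ^ 2) = 1 / (2 * y)"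
    using y by (simp add: field_simps power2_eq_square)
  ultimately have Ims: "Im s \<ge> 1 / (2 * y)" by simp
  moreover have "1 / (2 * y) \<ge> 1 / 2" using y by (simp add: field_simps)
  ultimately have Ims2: "Im s \<ge> 1 / 2" by linarith
  have v_eq: "v = 1 - 1 / s" using v1 by (simp add: s_def)
  have s0: "Im s > 0" using Ims2 by simp
  have "norm (odd_prod (nome s) (nome s)) \<le> exp (norm (nome s) / (3 * Im s))"
    by (rule odd_prod_nome_bound[OF s0])
  also have "\<dots> \<le> exp 2"
  proof -
    have "norm (nome s) / (3 * Im s) \<le> 1 / (3 * (1 / 2))"
      using norm_nome_less_1[OF s0] Ims2 by (intro frac_le) auto
    thus ?thesis by simp
  qed
  finally have "norm (odd_prod (nome s) (nome s)) ^ 2 \<le> exp 2 ^ 2" by (intro power_mono) auto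
  hence o: "norm (odd_prod (nome s) (nome s)) ^ 2 \<le> exp 4" by (simp flip: exp_of_nat_mult)
  have "norm (weber_f v) ^ 2 = 2 * exp (- (pi * Im s / 6)) * norm (odd_prod (nome s) (nome s)) ^ 2"
    unfolding v_eq by (rule norm_weber_f_near_1[OF s0])
  also have "\<dots> \<le> 2 * exp (- (1 / (4 * y))) * exp 4"
  proof (intro mult_mono o)
    have "1 / (4 * y) = 3 * (1 / (2 * y)) / 6" by simp
    also have "\<dots> \<le> pi * Im s / 6"
      using Ims pi_gt3 y by (intro divide_right_mono mult_mono) auto
    finally show "exp (- (pi * Im s / 6)) \<le> exp (- (1 / (4 * y)))" by simp
  qed auto
  \<comment> \<open>From the square to the 24th power: 12 / (4 * y) = 3 / y.\<close>
  finally have "(norm (weber_f v) ^ 2) ^ 12 \<le> (2 * exp (- (1 / (4 * y))) * exp 4) ^ 12"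
    by (intro power_mono) auto
  also have "\<dots> = (2 * exp 4) ^ 12 * exp (- (1 / (4 * y))) ^ 12"
    by (simp only: power_mult_distrib mult_ac)
  also have "exp (- (1 / (4 * y))) ^ 12 = exp (- (3 / y))"
    by (simp flip: exp_of_nat_mult)
  finally show ?thesis
    by (simp add: nv y_def flip: power_mult)
qed

context weber_level
begin

text \<open>Numerator and denominator both grow like exp (pi * l * y / 24) and cancel; only the
  error terms of the two bounds survive.\<close>

lemma norm_weber_conj_inf_le:
  assumes \<tau>: "Im \<tau> > 0"
  shows "norm (weber_conj_inf \<tau>) \<le> exp (2 * real l / Im \<tau>)"
proof -
  define y where "y = Im \<tau>"
  have y: "y > 0" using \<tau> by (simp add: y_def)
  have l1: "real l \<ge> 1" using level_pos by simp
  have "norm (weber_f (of_nat l * \<tau>)) \<le> exp (pi * (l * y) / 24 + 1 / (l * y))"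
    using norm_weber_f_le[of "of_nat l * \<tau>"] y level_pos by (simp add: y_def)
  moreover have "norm (weber_f \<tau>) ^ l \<ge> exp (pi * y / 24 - 1 / y) ^ l"
    using norm_weber_f_ge[OF \<tau>] by (intro power_mono) (auto simp: y_def)
  ultimately have "norm (weber_conj_inf \<tau>) \<le> exp (pi * (l * y) / 24 + 1 / (l * y)) / exp (pi * y / 24 - 1 / y) ^ l"
    unfolding weber_conj_inf_def norm_divide norm_power by (intro frac_le) auto
  also have "\<dots> = exp (1 / (l * y) + l / y)"
    by (simp add: field_simps flip: exp_of_nat_mult exp_diff)
  also have "\<dots> \<le> exp (2 * real l / y)"
  proof -
    have "1 / (l * y) \<le> l / y"
      using y l1 mult_mono[of 1 "real l" 1 "real l"] by (simp add: field_simps)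
    thus ?thesis by simp
  qed
  finally show ?thesis by (simp add: y_def)
qed

text \<open>Here the numerator grows only like exp (pi * y / (24 * l)), so the leading exponent is
  at most 0 and the bound for the conjugate at infinity holds again.\<close>

lemma norm_weber_conj_le:
  assumes \<tau>: "Im \<tau> > 0"
  shows "norm (weber_conj k \<tau>) \<le> exp (2 * real l / Im \<tau>)"
proof -
  define y where "y = Im \<tau>"
  have y: "y > 0" using \<tau> by (simp add: y_def)
  have l1: "real l \<ge> 1" using level_pos by simp
  define z where "z = (\<tau> + 2 * of_int k) / of_nat l"
  have Imz: "Im z = y / l" by (simp add: z_def y_def)
  have "norm (weber_f z) \<le> exp (pi * (y / l) / 24 + l / y)"
    using norm_weber_f_le[of z] y level_pos by (simp add: Imz)
  moreover have "norm (weber_f \<tau>) ^ l \<ge> exp (pi * y / 24 - 1 / y) ^ l"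
    using norm_weber_f_ge[OF \<tau>] by (intro power_mono) (auto simp: y_def)
  ultimately have "norm (weber_conj k \<tau>) \<le> exp (pi * (y / l) / 24 + l / y) / exp (pi * y / 24 - 1 / y) ^ l"
    unfolding weber_conj_def norm_divide norm_power norm_mult norm_root24 z_def [symmetric]
    by (intro frac_le) auto
  also have "\<dots> = exp (pi / 24 * (y / l - l * y) + 2 * real l / y)"
    by (simp add: field_simps flip: exp_of_nat_mult exp_diff)
  also have "\<dots> \<le> exp (2 * real l / y)"
  proof -
    have "y / l \<le> y / 1" using y l1 by (intro divide_left_mono) auto
    also have "\<dots> \<le> l * y" using y l1 by simp
    finally have "pi / 24 * (y / l - l * y) \<le> 0" by (intro mult_nonneg_nonpos) auto
    thus ?thesis by simp
  qed
  finally show ?thesis by (simp add: y_def)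
qed

text \<open>At the cusp \<open>1\<close> the powers of \<open>w\<close> blow up, and \<open>l * (l + 1)\<close> factors \<open>u\<close> outweigh them; at infinity
  the order of vanishing of one conjugate has to beat the poles of the other \<open>l\<close>.\<close>
lemma conj_norm_eq_0:
  fixes c :: "nat \<times> nat \<Rightarrow> complex" and A :: nat
  defines "F \<equiv> \<lambda>u w. \<Sum>(a, b)\<in>{l * (l + 1)..A} \<times> {..l + 1}. c (a, b) * u ^ a * w ^ b"
  assumes vanish: "\<And>\<tau>. Im \<tau> \<ge> Y \<Longrightarrow> Im \<tau> > 0 \<Longrightarrow>
      norm (F (weber_f \<tau> ^ 24) (weber_conj_inf \<tau>)) \<le> C * exp (- (pi * real (A * l + 1) * Im \<tau>))"
    and \<tau>: "Im \<tau> > 0"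
  shows "conj_norm F \<tau> = 0"
proof (rule theta_group_invariant_eq_0[OF _ conj_norm_plus_2 conj_norm_inversion _ _ \<tau>])
  define I where "I = {l * (l + 1)..A} \<times> {..l + 1}"
  define S where "S = (\<Sum>i\<in>I. norm (c i))"
  have S0: "S \<ge> 0" unfolding S_def by (intro sum_nonneg) auto
  have F_le: "norm (F u w) \<le> S * B"
    if "\<And>a b. (a, b) \<in> I \<Longrightarrow> norm u ^ a * norm w ^ b \<le> B" for u w B
  proof -
    have "norm (F u w) \<le> (\<Sum>i\<in>I. norm (case i of (a, b) \<Rightarrow> c (a, b) * u ^ a * w ^ b))"
      unfolding F_def I_def [symmetric] by (rule norm_sum)
    also have "\<dots> \<le> (\<Sum>i\<in>I. norm (c i) * B)"
      using that by (intro sum_mono)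
        (auto simp: norm_mult norm_power mult.assoc intro!: mult_left_mono)
    finally show ?thesis by (simp add: S_def sum_distrib_right)
  qed
  show "conj_norm F holomorphic_on upper_half"
    unfolding conj_norm_def F_def case_prod_unfold
    by (intro holomorphic_intros holomorphic_weber_f holomorphic_weber_conj_inf holomorphic_weber_conj)
  show "\<exists>Y. \<forall>z. Im z > 0 \<longrightarrow> Im z \<ge> Y \<longrightarrow> norm (conj_norm F z) \<le> e" if e: "e > 0" for e
  proof -
    define K where "K = S * (exp (24 * real A) * exp (2 * real l * real (l + 1)))"
    have F_inf: "norm (F (weber_f z ^ 24) w) \<le> K * exp (pi * real A * Im z)"
      if z: "Im z \<ge> 1" and w: "norm w \<le> exp (2 * real l / Im z)" for z w
    proof -
      have "norm (weber_f z ^ 24) ^ a * norm w ^ b \<le>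
          exp (24 * real A) * exp (2 * real l * real (l + 1)) * exp (pi * real A * Im z)"
        if ab: "(a, b) \<in> I" for a b
      proof -
        have "norm (weber_f z) \<le> exp (pi * Im z / 24 + 1 / Im z)"
          using z by (intro norm_weber_f_le) simp
        also have "\<dots> \<le> exp (pi * Im z / 24 + 1)" using z by simp
        finally have "norm (weber_f z) ^ 24 \<le> exp (pi * Im z / 24 + 1) ^ 24"
          by (intro power_mono) auto
        also have "\<dots> = exp (pi * Im z + 24)" by (simp flip: exp_of_nat_mult)
        finally have "norm (weber_f z ^ 24) ^ a \<le> exp (pi * Im z + 24) ^ a"
          by (intro power_mono) (auto simp: norm_power)
        also have "\<dots> \<le> exp (pi * Im z + 24) ^ A"
          using ab z by (intro power_increasing) (auto simp: I_def)
        finally have 1: "norm (weber_f z ^ 24) ^ a \<le> exp (24 * real A) * exp (pi * real A * Im z)"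
          by (simp add: algebra_simps flip: exp_of_nat_mult exp_add)
        have "2 * real l / Im z \<le> 2 * real l / 1" using z by (intro divide_left_mono) auto
        hence "norm w \<le> exp (2 * real l)" using w by (simp add: order_trans)
        hence "norm w ^ b \<le> exp (2 * real l) ^ b" by (intro power_mono) auto
        also have "\<dots> \<le> exp (2 * real l) ^ (l + 1)"
          using ab by (intro power_increasing) (auto simp: I_def)
        also have "\<dots> = exp (2 * real l * real (l + 1))"
          unfolding exp_of_nat_mult [symmetric] by (rule arg_cong[of _ _ exp]) simp
        finally have "norm w ^ b \<le> exp (2 * real l * real (l + 1))" .
        from mult_mono[OF 1 this] show ?thesis by (simp add: mult_ac)
      qed
      from F_le[OF this] show ?thesis unfolding K_def by (simp only: mult_ac)
    qed
    \<comment> \<open>The l other factors contribute at most K^l * exp (pi * A * l * y); the assumed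
      decay beats this by exp (- pi * y).\<close>
    have "((\<lambda>y. \<bar>C\<bar> * K ^ l * exp (- (pi * y))) \<longlongrightarrow> 0) at_top"
      by real_asymp
    hence "eventually (\<lambda>y. \<bar>C\<bar> * K ^ l * exp (- (pi * y)) < e) at_top"
      using e by (auto intro: order_tendstoD)
    then obtain Y' where Y': "\<And>y. y \<ge> Y' \<Longrightarrow> \<bar>C\<bar> * K ^ l * exp (- (pi * y)) < e"
      by (auto simp: eventually_at_top_linorder)
    have "norm (conj_norm F z) \<le> e" if z: "Im z \<ge> max 1 (max Y Y')" for z
    proof -
      have z0: "Im z > 0" using z by simp
      define y where "y = Im z"
      have a: "norm (F (weber_f z ^ 24) (weber_conj_inf z)) \<le> \<bar>C\<bar> * exp (- (pi * real (A * l + 1) * y))"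
        using vanish[of z] z abs_ge_self[of C] by (auto simp: y_def intro: order_trans[OF _ mult_right_mono])
      have b: "(\<Prod>k\<in>{0..<int l}. norm (F (weber_f z ^ 24) (weber_conj k z))) \<le> (\<Prod>k\<in>{0..<int l}. K * exp (pi * real A * y))"
        using z norm_weber_conj_le[OF z0] by (intro prod_mono) (auto simp: y_def intro!: F_inf)
      have "norm (conj_norm F z) \<le> \<bar>C\<bar> * exp (- (pi * real (A * l + 1) * y)) * (K * exp (pi * real A * y)) ^ l"
        unfolding conj_norm_def norm_mult prod_norm [symmetric]
        using mult_mono[OF a b _ prod_nonneg] by simp
      also have "\<dots> = \<bar>C\<bar> * K ^ l * (exp (- (pi * real (A * l + 1) * y)) * exp (pi * real A * y) ^ l)"
        by (simp add: power_mult_distrib)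
      also have "exp (- (pi * real (A * l + 1) * y)) * exp (pi * real A * y) ^ l = exp (- (pi * y))"
        unfolding exp_of_nat_mult [symmetric] exp_add [symmetric]
        by (rule arg_cong[of _ _ exp]) (simp add: algebra_simps)
      finally show ?thesis using Y'[of y] z by (simp add: y_def)
    qed
    thus ?thesis by (intro exI[of _ "max 1 (max Y Y')"]) auto
  qed
  show "\<exists>y>0. \<forall>z. \<bar>Re z\<bar> \<le> 1 \<longrightarrow> norm z \<ge> 1 \<longrightarrow> 0 < Im z \<longrightarrow> Im z \<le> y \<longrightarrow> norm (conj_norm F z) \<le> e"
    if e: "e > 0" for e
  proof -
    define K where "K = (2 * exp 4 :: real) ^ 12"
    \<comment> \<open>Near the cusp u is of size exp (- 3 / y) and w at most exp (2 * l / y), so A0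
      factors u against at most l + 1 factors w leave exp (- A0 / y).\<close>
    define A0 where "A0 = l * (l + 1)"
    have K0: "K > 0" by (simp add: K_def)
    have "((\<lambda>y::real. K * exp (- (3 / y))) \<longlongrightarrow> 0) (at_right 0)"
      by real_asymp
    hence "eventually (\<lambda>y. K * exp (- (3 / y)) < 1) (at_right 0)"
      by (rule order_tendstoD) simp
    moreover have "((\<lambda>y::real. (S * K ^ A0 * exp (- (1 / y))) ^ (l + 1)) \<longlongrightarrow> 0 ^ (l + 1)) (at_right 0)"
      by (intro tendsto_power) real_asymp
    hence "eventually (\<lambda>y. (S * K ^ A0 * exp (- (1 / y))) ^ (l + 1) < e) (at_right 0)"
      using e by (auto intro: order_tendstoD)
    ultimately have "eventually (\<lambda>y. K * exp (- (3 / y)) < 1 \<and> (S * K ^ A0 * exp (- (1 / y))) ^ (l + 1) < e) (at_right 0)"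
      by (rule eventually_conj)
    then obtain y0 where y0: "y0 > 0"
        "\<And>y. 0 < y \<Longrightarrow> y < y0 \<Longrightarrow> K * exp (- (3 / y)) < 1 \<and> (S * K ^ A0 * exp (- (1 / y))) ^ (l + 1) < e"
      by (auto simp: eventually_at_right_field)
    have "norm (conj_norm F z) \<le> e"
      if z: "\<bar>Re z\<bar> \<le> 1" "norm z \<ge> 1" "0 < Im z" "Im z \<le> min 1 (y0 / 2)" for z
    proof -
      define y where "y = Im z"
      have y: "0 < y" "y \<le> 1" "y < y0" using z y0(1) by (auto simp: y_def)
      have F1: "norm (F (weber_f z ^ 24) w) \<le> S * (K ^ A0 * exp (- (1 / y)))"
        if w: "norm w \<le> exp (2 * real l / y)" for w
      proof (rule F_le)
        fix a b assume ab: "(a, b) \<in> I"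
        have u: "norm (weber_f z ^ 24) \<le> K * exp (- (3 / y))"
          using norm_weber_f_power_24_le[of z] z by (simp add: norm_power K_def y_def)
        also have "\<dots> \<le> 1" using y0(2)[of y] y by simp
        finally have "norm (weber_f z ^ 24) ^ a \<le> norm (weber_f z ^ 24) ^ A0"
          using ab by (intro power_decreasing) (auto simp: I_def A0_def)
        also have "\<dots> \<le> (K * exp (- (3 / y))) ^ A0" using u by (intro power_mono) auto
        finally have 1: "norm (weber_f z ^ 24) ^ a \<le> K ^ A0 * exp (- (3 * real A0 / y))"
          by (simp add: power_mult_distrib mult.commute flip: exp_of_nat_mult)
        have "norm w ^ b \<le> exp (2 * real l / y) ^ b" using w by (intro power_mono) auto
        also have "\<dots> \<le> exp (2 * real l / y) ^ (l + 1)"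
          using ab y by (intro power_increasing) (auto simp: I_def)
        also have "\<dots> = exp (2 * real A0 / y)"
          unfolding exp_of_nat_mult [symmetric] by (rule arg_cong[of _ _ exp]) (simp add: A0_def algebra_simps)
        finally have 2: "norm w ^ b \<le> exp (2 * real A0 / y)" .
        have "norm (weber_f z ^ 24) ^ a * norm w ^ b \<le> K ^ A0 * exp (- (3 * real A0 / y)) * exp (2 * real A0 / y)"
          using K0 by (intro mult_mono 1 2) auto
        also have "\<dots> = K ^ A0 * exp (- (real A0 / y))"
          unfolding mult.assoc exp_add [symmetric] by (simp add: diff_divide_distrib [symmetric])
        also have "\<dots> \<le> K ^ A0 * exp (- (1 / y))"
        proof (intro mult_left_mono)
          have "A0 \<noteq> 0" using level_pos by (simp add: A0_def)
          hence "real A0 \<ge> 1" by simp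
          thus "exp (- (real A0 / y)) \<le> exp (- (1 / y))" using y by (simp add: divide_right_mono)
        qed (use K0 in auto)
        finally show "norm (weber_f z ^ 24) ^ a * norm w ^ b \<le> K ^ A0 * exp (- (1 / y))" .
      qed
      have a: "norm (F (weber_f z ^ 24) (weber_conj_inf z)) \<le> S * (K ^ A0 * exp (- (1 / y)))"
        by (intro F1) (use norm_weber_conj_inf_le[OF z(3)] in \<open>simp add: y_def\<close>)
      have b: "(\<Prod>k\<in>{0..<int l}. norm (F (weber_f z ^ 24) (weber_conj k z))) \<le> (\<Prod>k\<in>{0..<int l}. S * (K ^ A0 * exp (- (1 / y))))"
        using norm_weber_conj_le[OF z(3)] by (intro prod_mono) (auto simp: y_def intro!: F1[unfolded y_def])
      have "norm (conj_norm F z) \<le> (S * (K ^ A0 * exp (- (1 / y)))) * (S * (K ^ A0 * exp (- (1 / y)))) ^ l"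
        unfolding conj_norm_def norm_mult prod_norm [symmetric]
        using mult_mono[OF a b _ prod_nonneg] S0 K0 by simp
      also have "\<dots> = (S * K ^ A0 * exp (- (1 / y))) ^ (l + 1)" by (simp add: mult.assoc)
      also have "\<dots> \<le> e" using y0(2)[of y] y by simp
      finally show ?thesis .
    qed
    thus ?thesis using y0(1) by (intro exI[of _ "min 1 (y0 / 2)"]) auto
  qed
qed

end

section \<open>Integer polynomials\<close>

lemma coeff_hom_mult:
  fixes h :: "'a :: comm_ring_1 \<Rightarrow> 'b :: comm_ring_1"
  assumes "h 0 = 0" "\<And>a b. h (a + b) = h a + h b" "\<And>a b. h (a * b) = h a * h b"
  shows "map_poly h (p * q) = map_poly h p * map_poly h q"
proof -
  have "h (\<Sum>i\<in>A. f i) = (\<Sum>i\<in>A. h (f i))" for f :: "nat \<Rightarrow> 'a" and A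
    by (induction A rule: infinite_finite_induct) (simp_all add: assms)
  thus ?thesis
    by (intro poly_eqI) (simp add: coeff_map_poly assms coeff_mult)
qed

lemma coeff_hom_add:
  assumes "h 0 = 0" "\<And>a b. h (a + b) = h a + h b"
  shows "map_poly h (p + q) = map_poly h p + map_poly h q"
  by (intro poly_eqI) (simp add: coeff_map_poly assms)

section \<open>Evaluation of integer polynomials in one and two variables\<close>

definition ipoly_at :: "complex \<Rightarrow> int poly \<Rightarrow> complex" where
  "ipoly_at x p = poly (map_poly of_int p) x"

lemma ipoly_at_0 [simp]: "ipoly_at x 0 = 0"
  and ipoly_at_1 [simp]: "ipoly_at x 1 = 1"
  by (simp_all add: ipoly_at_def)

lemma ipoly_at_add: "ipoly_at x (p + q) = ipoly_at x p + ipoly_at x q"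
  unfolding ipoly_at_def by (subst coeff_hom_add) simp_all

lemma ipoly_at_mult: "ipoly_at x (p * q) = ipoly_at x p * ipoly_at x q"
  unfolding ipoly_at_def by (subst coeff_hom_mult) simp_all

lemma ipoly_at_monom: "ipoly_at x (monom c n) = of_int c * x ^ n"
  by (simp add: ipoly_at_def map_poly_monom poly_monom)

lemma ipoly_at_sum: "ipoly_at x (\<Sum>i\<in>A. f i) = (\<Sum>i\<in>A. ipoly_at x (f i))"
  by (induction A rule: infinite_finite_induct) (simp_all add: ipoly_at_add)

lemma ipoly_at_prod: "ipoly_at x (\<Prod>i\<in>A. f i) = (\<Prod>i\<in>A. ipoly_at x (f i))"
  by (induction A rule: infinite_finite_induct) (simp_all add: ipoly_at_mult)

lemma ipoly_at_power: "ipoly_at x (p ^ n) = ipoly_at x p ^ n"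
  by (induction n) (simp_all add: ipoly_at_mult)

lemma eval_xy_eq: "eval_xy P x y = poly (map_poly (ipoly_at x) P) y"
  by (simp add: eval_xy_def ipoly_at_def[abs_def])

lemma eval_xy_0 [simp]: "eval_xy 0 x y = 0"
  by (simp add: eval_xy_eq)

lemma eval_xy_const: "eval_xy [:p:] x y = ipoly_at x p"
  by (simp add: eval_xy_eq map_poly_pCons)

lemma eval_xy_add: "eval_xy (P + Q) x y = eval_xy P x y + eval_xy Q x y"
  unfolding eval_xy_eq by (subst coeff_hom_add) (simp_all add: ipoly_at_add)

lemma eval_xy_mult: "eval_xy (P * Q) x y = eval_xy P x y * eval_xy Q x y"
  unfolding eval_xy_eq by (subst coeff_hom_mult) (simp_all add: ipoly_at_add ipoly_at_mult)

lemma eval_xy_sum: "eval_xy (\<Sum>i\<in>A. f i) x y = (\<Sum>i\<in>A. eval_xy (f i) x y)"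
  by (induction A rule: infinite_finite_induct) (simp_all add: eval_xy_add)

lemma eval_xy_monom: "eval_xy (monom (monom c i) j) x y = of_int c * x ^ i * y ^ j"
  by (simp add: eval_xy_eq map_poly_monom poly_monom ipoly_at_monom)

text \<open>Gaussian elimination with cross-multiplication by the pivot in place of division, which
  keeps the solution integral.\<close>

lemma homogeneous_system_nontrivial_solution:
  fixes e :: "'i \<Rightarrow> nat \<Rightarrow> int"
  assumes "finite I" "m < card I"
  shows "\<exists>c. (\<exists>i\<in>I. c i \<noteq> 0) \<and> (\<forall>n<m. (\<Sum>i\<in>I. c i * e i n) = 0)"
  using assms
proof (induction m arbitrary: I e)
  case 0
  then obtain i where "i \<in> I" by (metis card.empty equals0I less_irrefl)
  thus ?case by (intro exI[of _ "\<lambda>_. 1"]) auto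
next
  case (Suc m)
  show ?case
  proof (cases "\<forall>i\<in>I. e i m = 0")
    case True
    obtain c where "\<exists>i\<in>I. c i \<noteq> 0" "\<forall>n<m. (\<Sum>i\<in>I. c i * e i n) = 0"
      using Suc.IH[of I e] Suc.prems by auto
    thus ?thesis using True by (intro exI[of _ c]) (auto simp: less_Suc_eq)
  next
    case False
    then obtain j where j: "j \<in> I" "e j m \<noteq> 0" by blast
    define e' where "e' = (\<lambda>i n. e j m * e i n - e i m * e j n)"
    have "finite (I - {j})" "m < card (I - {j})"
      using Suc.prems j by auto
    from Suc.IH[OF this, of e'] obtain c where
      c: "\<exists>i\<in>I - {j}. c i \<noteq> 0" "\<And>n. n < m \<Longrightarrow> (\<Sum>i\<in>I - {j}. c i * e' i n) = 0" by blast
    \<comment> \<open>The value at the pivot index j is dictated by equation m; the other values are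
      scaled by the pivot \<open>e j m\<close>.\<close>
    define d where "d = (\<lambda>i. if i = j then - (\<Sum>i\<in>I - {j}. c i * e i m) else e j m * c i)"
    have "(\<Sum>i\<in>I. d i * e i n) = (\<Sum>i\<in>I - {j}. c i * e' i n)" for n
    proof -
      have "(\<Sum>i\<in>I. d i * e i n) = d j * e j n + (\<Sum>i\<in>I - {j}. d i * e i n)"
        using Suc.prems(1) j(1) by (rule sum.remove)
      also have "(\<Sum>i\<in>I - {j}. d i * e i n) = (\<Sum>i\<in>I - {j}. c i * (e j m * e i n))"
        by (intro sum.cong) (simp_all add: d_def mult_ac)
      also have "d j * e j n = - (\<Sum>i\<in>I - {j}. c i * (e i m * e j n))"
        by (simp add: d_def sum_distrib_right mult.assoc)
      finally show ?thesis
        by (simp add: e'_def right_diff_distrib sum_subtractf)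
    qed
    moreover have "(\<Sum>i\<in>I - {j}. c i * e' i m) = 0"
      by (simp add: e'_def)
    ultimately have "\<forall>n<Suc m. (\<Sum>i\<in>I. d i * e i n) = 0"
      using c(2) by (simp add: less_Suc_eq)
    moreover have "\<exists>i\<in>I. d i \<noteq> 0"
      using c(1) j(2) by (auto simp: d_def)
    ultimately show ?thesis by blast
  qed
qed

text \<open>Bezout's identity over the rational functions in x, with denominators cleared. By
  pseudo-division an element G of least degree in the ideal divides multiples of P and R by nonzero
  polynomials in x. If G had positive degree, primality of P would give either P dvd G, hence P dvd
  R, or that G divides a polynomial in x alone.\<close>

lemma irreducible_combination:
  fixes P R :: "int poly poly"
  assumes irr: "irreducible P" and deg: "degree P > 0" and ndvd: "\<not> P dvd R"
  obtains A B r where "r \<noteq> 0" "A * P + B * R = [:r:]"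
proof -
  define S where "S = {G. G \<noteq> 0 \<and> (\<exists>A B. G = A * P + B * R)}"
  have prime: "prime_elem P" using irr by (rule irreducible_imp_prime_elem)
  have "P \<noteq> 0" using irr by auto
  moreover have "P = 1 * P + 0 * R" by simp
  ultimately have "P \<in> S" unfolding S_def by blast
  then obtain G where G: "G \<in> S" "\<And>H. H \<in> S \<Longrightarrow> degree G \<le> degree H"
    using ex_has_least_nat[of "\<lambda>G. G \<in> S" P degree] by blast
  have G0: "G \<noteq> 0" using G(1) by (simp add: S_def)
  obtain A0 B0 where G_eq: "G = A0 * P + B0 * R" using G(1) unfolding S_def by blast
  have red: "\<exists>a q. a \<noteq> 0 \<and> [:a:] * X = G * q" if X: "X = A1 * P + B1 * R" for X A1 B1
  proof -
    obtain a q where aq: "a \<noteq> 0" "smult a X = G * q + pseudo_mod X G"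
      using pseudo_mod(1)[OF G0] by blast
    have "pseudo_mod X G = ([:a:] * A1 - q * A0) * P + ([:a:] * B1 - q * B0) * R"
    proof -
      have "pseudo_mod X G = [:a:] * X - G * q" using aq(2) by simp
      thus ?thesis unfolding X G_eq by (simp only: algebra_simps)
    qed
    hence "pseudo_mod X G \<noteq> 0 \<Longrightarrow> pseudo_mod X G \<in> S" unfolding S_def by blast
    hence "pseudo_mod X G = 0"
      using pseudo_mod(2)[OF G0, of X] G(2) by fastforce
    thus ?thesis using aq by auto
  qed
  have "degree G = 0"
  proof (rule ccontr)
    assume dG: "degree G \<noteq> 0"
    obtain a q where a: "a \<noteq> 0" "[:a:] * P = G * q" using red[of P 1 0] by auto
    obtain b q' where b: "b \<noteq> 0" "[:b:] * R = G * q'" using red[of R 0 1] by auto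
    have "P dvd G * q" using a(2) by (metis dvd_triv_right)
    then consider "P dvd G" | "P dvd q" using prime by (auto simp: prime_elem_dvd_mult_iff)
    thus False
    proof cases
      case 1
      hence "P dvd [:b:] * R" unfolding b(2) by (rule dvd_mult2)
      hence "P dvd [:b:]" using prime ndvd by (metis prime_elem_dvd_mult_iff)
      hence "degree P \<le> degree [:b:]" using b(1) by (intro dvd_imp_degree_le) auto
      thus False using deg by simp
    next
      case 2
      then obtain q2 where q2: "q = P * q2" by blast
      have "P * [:a:] = P * (G * q2)" using a(2) unfolding q2 by (simp only: mult_ac)
      hence "[:a:] = G * q2" using irr by (metis mult_left_cancel not_irreducible_zero)
      moreover from this a(1) have "q2 \<noteq> 0" by auto
      ultimately have "degree [:a:] = degree G + degree q2" using G0 by (metis degree_mult_eq)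
      thus False using dG by simp
    qed
  qed
  then obtain r where "G = [:r:]" by (rule degree_eq_zeroE)
  thus ?thesis using that[of r A0 B0] G0 G_eq by simp
qed

section \<open>A relation of low degree\<close>

lemma ipoly_at_pCons: "ipoly_at x (pCons c p) = of_int c + x * ipoly_at x p"
  by (simp add: ipoly_at_def map_poly_pCons)

lemma ipoly_at_pcompose: "ipoly_at x (pcompose p q) = ipoly_at (ipoly_at x q) p"
proof (induction p)
  case (pCons c p)
  thus ?case
    using ipoly_at_pCons[of x c 0]
    by (simp add: pcompose_pCons ipoly_at_add ipoly_at_mult ipoly_at_pCons)
qed simp

lemma continuous_on_ipoly_at: "continuous_on S (\<lambda>x. ipoly_at x p)"
  unfolding ipoly_at_def by (intro continuous_intros)

lemma ipoly_at_bounded: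
  obtains C where "\<And>x. norm x \<le> 1 / 2 \<Longrightarrow> norm (ipoly_at x p) \<le> C"
proof -
  have "bounded ((\<lambda>x. ipoly_at x p) ` cball 0 (1 / 2))"
    by (intro compact_imp_bounded compact_continuous_image continuous_on_ipoly_at compact_cball)
  then obtain C where "\<forall>y\<in>(\<lambda>x. ipoly_at x p) ` cball 0 (1 / 2). norm y \<le> C"
    unfolding bounded_iff by blast
  thus ?thesis by (intro that[of C]) auto
qed

lemma ipoly_at_order_ge:
  assumes "\<And>n. n < m \<Longrightarrow> coeff p n = 0"
  obtains C where "\<And>x. norm x \<le> 1 / 2 \<Longrightarrow> norm (ipoly_at x p) \<le> C * norm x ^ m"
proof -
  have "monom 1 m dvd p" using assms by (simp add: monom_1_dvd_iff')
  then obtain q where q: "p = monom 1 m * q" by blast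
  obtain C where "\<And>x. norm x \<le> 1 / 2 \<Longrightarrow> norm (ipoly_at x q) \<le> C"
    using ipoly_at_bounded by blast
  hence "norm x ^ m * norm (ipoly_at x q) \<le> norm x ^ m * C" if "norm x \<le> 1 / 2" for x
    using that by (intro mult_left_mono) auto
  moreover have "norm (ipoly_at x p) = norm x ^ m * norm (ipoly_at x q)" for x
    by (simp add: q ipoly_at_mult ipoly_at_monom norm_mult norm_power)
  ultimately show ?thesis by (intro that[of C]) (simp add: mult.commute)
qed

text \<open>The bound is asked only away from 0 because a nome is never 0. Dividing by x^n and
  letting x tend to 0 removes the coefficients one after the other.\<close>

lemma coeff_eq_0_of_ipoly_at_order:
  assumes bound: "\<And>x. x \<noteq> 0 \<Longrightarrow> norm x \<le> 1 / 2 \<Longrightarrow> norm (ipoly_at x p) \<le> C * norm x ^ m" and "n < m"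
  shows "coeff p n = 0"
  using \<open>n < m\<close>
proof (induction n rule: less_induct)
  case (less n)
  hence "monom 1 n dvd p" by (simp add: monom_1_dvd_iff')
  then obtain q where q: "p = monom 1 n * q" by blast
  have "((\<lambda>x. ipoly_at x q) \<longlongrightarrow> ipoly_at 0 q) (at 0)"
    using continuous_on_ipoly_at[of UNIV q] by (auto simp: continuous_on_def)
  moreover have "((\<lambda>x. ipoly_at x q) \<longlongrightarrow> 0) (at 0)"
  proof (rule Lim_null_comparison)
    have "eventually (\<lambda>x. x \<in> ball 0 (1 / 2) - {0}) (at (0 :: complex))"
      by (intro eventually_at_in_open) auto
    thus "eventually (\<lambda>x. norm (ipoly_at x q) \<le> C * norm x ^ (m - n)) (at 0)"
    proof eventually_elim
      case (elim x)
      have "norm x ^ n * norm (ipoly_at x q) \<le> C * norm x ^ m"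
        using bound[of x] elim by (simp add: q ipoly_at_mult ipoly_at_monom norm_mult norm_power)
      also have "\<dots> = norm x ^ n * (C * norm x ^ (m - n))"
        using less.prems by (simp flip: power_add)
      finally show ?case using elim by simp
    qed
    have "((\<lambda>x::complex. C * norm x ^ (m - n)) \<longlongrightarrow> C * norm (0 :: complex) ^ (m - n)) (at 0)"
      by (intro tendsto_intros)
    thus "((\<lambda>x::complex. C * norm x ^ (m - n)) \<longlongrightarrow> 0) (at 0)"
      using less.prems by (simp add: power_0_left)
  qed
  ultimately have "ipoly_at 0 q = 0" using tendsto_unique trivial_limit_at by blast
  hence "coeff q 0 = 0" by (cases q) (simp add: ipoly_at_pCons)
  thus ?case by (simp add: q coeff_monom_mult)
qed

text \<open>Congruence modulo p^K in an analytic form, uniform on a disc. Boundedness of both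
  functions is included to make the relation compatible with products.\<close>

definition agree :: "nat \<Rightarrow> (complex \<Rightarrow> complex) \<Rightarrow> (complex \<Rightarrow> complex) \<Rightarrow> bool" where
  "agree K f g \<longleftrightarrow> (\<exists>C. \<forall>p. norm p \<le> 1 / 2 \<longrightarrow>
     norm (f p) \<le> C \<and> norm (g p) \<le> C \<and> norm (f p - g p) \<le> C * norm p ^ K)"

lemma agreeE:
  assumes "agree K f g"
  obtains C where "C \<ge> 0" "\<And>p. norm p \<le> 1 / 2 \<Longrightarrow>
    norm (f p) \<le> C \<and> norm (g p) \<le> C \<and> norm (f p - g p) \<le> C * norm p ^ K"
proof -
  obtain C where C: "\<And>p. norm p \<le> 1 / 2 \<Longrightarrow> norm (f p) \<le> C \<and> norm (g p) \<le> C \<and> norm (f p - g p) \<le> C * norm p ^ K"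
    using assms unfolding agree_def by blast
  have "0 \<le> norm (f 0)" by simp
  also have "\<dots> \<le> C" using C[of 0] by simp
  finally show ?thesis using C that by blast
qed

lemma agree_monom: "agree K (\<lambda>p. c * p ^ n) (\<lambda>p. c * p ^ n)"
  unfolding agree_def
proof (intro exI allI impI)
  fix p :: complex assume p: "norm p \<le> 1 / 2"
  have "norm p ^ n \<le> 1" using p by (intro power_le_one) auto
  thus "norm (c * p ^ n) \<le> norm c \<and> norm (c * p ^ n) \<le> norm c \<and> norm (c * p ^ n - c * p ^ n) \<le> norm c * norm p ^ K"
    by (auto simp: norm_mult norm_power intro: mult_left_le)
qed

lemma agree_add:
  assumes "agree K f g" "agree K f' g'"
  shows "agree K (\<lambda>p. f p + f' p) (\<lambda>p. g p + g' p)"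
proof (rule agreeE[OF assms(1)], rule agreeE[OF assms(2)])
  fix C D assume C: "\<And>p. norm p \<le> 1 / 2 \<Longrightarrow>
      norm (f p) \<le> C \<and> norm (g p) \<le> C \<and> norm (f p - g p) \<le> C * norm p ^ K"
    and D: "\<And>p. norm p \<le> 1 / 2 \<Longrightarrow>
      norm (f' p) \<le> D \<and> norm (g' p) \<le> D \<and> norm (f' p - g' p) \<le> D * norm p ^ K"
  show ?thesis
    unfolding agree_def
  proof (intro exI[of _ "C + D"] allI impI conjI)
    fix p :: complex assume p: "norm p \<le> 1 / 2"
    show "norm (f p + f' p) \<le> C + D" "norm (g p + g' p) \<le> C + D"
      using C[OF p] D[OF p] by (auto intro!: norm_triangle_mono)
    have "norm ((f p - g p) + (f' p - g' p)) \<le> C * norm p ^ K + D * norm p ^ K"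
      using C[OF p] D[OF p] by (intro norm_triangle_mono) auto
    thus "norm (f p + f' p - (g p + g' p)) \<le> (C + D) * norm p ^ K"
      by (simp add: algebra_simps)
  qed
qed

lemma agree_mult:
  assumes "agree K f g" "agree K f' g'"
  shows "agree K (\<lambda>p. f p * f' p) (\<lambda>p. g p * g' p)"
proof (rule agreeE[OF assms(1)], rule agreeE[OF assms(2)])
  fix C D assume C0: "C \<ge> 0" and D0: "D \<ge> 0"
    and C: "\<And>p. norm p \<le> 1 / 2 \<Longrightarrow>
      norm (f p) \<le> C \<and> norm (g p) \<le> C \<and> norm (f p - g p) \<le> C * norm p ^ K"
    and D: "\<And>p. norm p \<le> 1 / 2 \<Longrightarrow>
      norm (f' p) \<le> D \<and> norm (g' p) \<le> D \<and> norm (f' p - g' p) \<le> D * norm p ^ K"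
  show ?thesis
    unfolding agree_def
  proof (intro exI[of _ "2 * (C * D)"] allI impI conjI)
    fix p :: complex assume p: "norm p \<le> 1 / 2"
    note CD = C0 D0 C[OF p] D[OF p]
    have "C * D \<le> 2 * (C * D)" using C0 D0 by simp
    moreover have "norm (f p * f' p) \<le> C * D" "norm (g p * g' p) \<le> C * D"
      unfolding norm_mult using CD by (auto intro!: mult_mono)
    ultimately show "norm (f p * f' p) \<le> 2 * (C * D)" "norm (g p * g' p) \<le> 2 * (C * D)" by linarith+
    have "norm (f p * (f' p - g' p) + (f p - g p) * g' p) \<le> C * (D * norm p ^ K) + (C * norm p ^ K) * D"
      by (intro norm_triangle_mono) (unfold norm_mult, use CD in \<open>auto intro!: mult_mono\<close>)
    thus "norm (f p * f' p - g p * g' p) \<le> 2 * (C * D) * norm p ^ K"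
      by (simp add: algebra_simps)
  qed
qed

lemma agree_power:
  assumes "agree K f g"
  shows "agree K (\<lambda>p. f p ^ n) (\<lambda>p. g p ^ n)"
proof (induction n)
  case 0
  show ?case using agree_monom[of K 1 0] by simp
next
  case (Suc n)
  show ?case using agree_mult[OF assms Suc] by simp
qed

lemma agree_sum:
  assumes "\<And>i. i \<in> I \<Longrightarrow> agree K (f i) (g i)"
  shows "agree K (\<lambda>p. \<Sum>i\<in>I. f i p) (\<lambda>p. \<Sum>i\<in>I. g i p)"
  using assms
proof (induction I rule: infinite_finite_induct)
  case (insert i I)
  thus ?case using agree_add[of K "f i" "g i"] by simp
qed (use agree_monom[of K 0 0] in simp_all)

definition odd_ipoly :: "nat \<Rightarrow> int poly" where
  "odd_ipoly K = (\<Prod>n<K. 1 + monom 1 (2 * n + 1))"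

lemma ipoly_at_odd_ipoly: "ipoly_at p (odd_ipoly K) = (\<Prod>n<K. 1 + p ^ (2 * n + 1))"
  by (simp add: odd_ipoly_def ipoly_at_prod ipoly_at_add ipoly_at_monom)

text \<open>The omitted factors form \<open>odd_prod p (p ^ (2 * K))\<close>, which differs from 1
  by at most twice the modulus of p^(2 * K).\<close>

lemma agree_odd_prod: "agree K (\<lambda>p. odd_prod p 1) (\<lambda>p. ipoly_at p (odd_ipoly K))"
proof -
  obtain B where B: "\<And>p. norm p \<le> 1 / 2 \<Longrightarrow> norm (ipoly_at p (odd_ipoly K)) \<le> B"
    using ipoly_at_bounded by blast
  have tail: "norm (odd_prod p x - 1) \<le> 2 * norm x" if p: "norm p \<le> 1 / 2" and x: "norm x \<le> 1" for p x
  proof -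
    have "norm p / (1 - norm p ^ 2) \<le> (1 / 2) / (1 - (1 / 2) ^ 2)"
      using p by (intro frac_le diff_left_mono power_mono) (auto simp: power2_eq_square)
    also have "(1 / 2) / (1 - (1 / 2) ^ 2) \<le> (1 :: real)" by (simp add: power2_eq_square)
    finally have "norm p / (1 - norm p ^ 2) \<le> 1" .
    hence "norm p / (1 - norm p ^ 2) * norm x \<le> norm x" by (rule mult_left_le_one_le[rotated 2]) (use p in \<open>auto simp: abs_square_le_1 power_le_one\<close>)
    hence "exp (norm p / (1 - norm p ^ 2) * norm x) - 1 \<le> exp (norm x) - 1" by simp
    also have "\<dots> \<le> norm x + (norm x) ^ 2" using exp_bound[of "norm x"] x by simp
    also have "\<dots> \<le> 2 * norm x"
      using mult_left_mono[OF x, of "norm x"] by (simp add: power2_eq_square)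
    finally show ?thesis
      using norm_odd_prod_minus_1_le[of p x] p by simp
  qed
  have eq: "odd_prod p 1 = ipoly_at p (odd_ipoly K) * odd_prod p (p ^ (2 * K))" if "norm p \<le> 1 / 2" for p
    using odd_prod_split[of p 1 K] that by (simp add: ipoly_at_odd_ipoly)
  have pK: "norm (p ^ (2 * K)) \<le> norm p ^ K" "norm (p ^ (2 * K)) \<le> 1" if "norm p \<le> 1 / 2" for p :: complex
    using that by (auto simp: norm_power intro!: power_decreasing power_le_one)
  have diff: "norm (odd_prod p 1 - ipoly_at p (odd_ipoly K)) \<le> \<bar>B\<bar> * (2 * norm (p ^ (2 * K)))" if p: "norm p \<le> 1 / 2" for p
  proof -
    have "odd_prod p 1 - ipoly_at p (odd_ipoly K) = ipoly_at p (odd_ipoly K) * (odd_prod p (p ^ (2 * K)) - 1)"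
      by (simp add: eq[OF p] algebra_simps)
    thus ?thesis
      unfolding norm_mult using tail[OF p pK(2)[OF p]] B[OF p] by (auto simp: norm_mult intro!: mult_mono)
  qed
  show ?thesis
    unfolding agree_def
  proof (intro exI[of _ "3 * \<bar>B\<bar>"] allI impI conjI)
    fix p :: complex assume p: "norm p \<le> 1 / 2"
    show 1: "norm (ipoly_at p (odd_ipoly K)) \<le> 3 * \<bar>B\<bar>" using B[OF p] by simp
    have "\<bar>B\<bar> * (2 * norm (p ^ (2 * K))) \<le> \<bar>B\<bar> * (2 * norm p ^ K)" using pK(1)[OF p] by (intro mult_left_mono) auto
    also have "\<dots> \<le> 3 * \<bar>B\<bar> * norm p ^ K" by (simp add: mult_right_mono)
    finally show "norm (odd_prod p 1 - ipoly_at p (odd_ipoly K)) \<le> 3 * \<bar>B\<bar> * norm p ^ K"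
      using diff[OF p] by simp
    have "\<bar>B\<bar> * (2 * norm (p ^ (2 * K))) \<le> \<bar>B\<bar> * (2 * 1)" using pK(2)[OF p] by (intro mult_left_mono) auto
    thus "norm (odd_prod p 1) \<le> 3 * \<bar>B\<bar>"
      using diff[OF p] B[OF p] norm_triangle_sub[of "odd_prod p 1" "ipoly_at p (odd_ipoly K)"] by linarith
  qed
qed

text \<open>Integral model of x^i * y^j times a power of the nome that makes the exponent e
  integral; composition with \<open>monom 1 l\<close> substitutes p^l for p.\<close>

definition trunc_monomial :: "nat \<Rightarrow> nat \<Rightarrow> nat \<Rightarrow> nat \<Rightarrow> nat \<Rightarrow> int poly" where
  "trunc_monomial l K e i j = monom 1 e * odd_ipoly K ^ i * pcompose (odd_ipoly K) (monom 1 l) ^ j"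

lemma agree_trunc_monomial:
  assumes "l > 0"
  shows "agree K (\<lambda>p. p ^ e * odd_prod p 1 ^ i * odd_prod (p ^ l) 1 ^ j) (\<lambda>p. ipoly_at p (trunc_monomial l K e i j))"
proof -
  have "agree K (\<lambda>p. odd_prod (p ^ l) 1) (\<lambda>p. ipoly_at (p ^ l) (odd_ipoly K))"
  proof -
    obtain C where C: "C \<ge> 0" "\<And>p. norm p \<le> 1 / 2 \<Longrightarrow> norm (odd_prod p 1) \<le> C \<and>
        norm (ipoly_at p (odd_ipoly K)) \<le> C \<and> norm (odd_prod p 1 - ipoly_at p (odd_ipoly K)) \<le> C * norm p ^ K"
      using agree_odd_prod[of K] by (rule agreeE) blast
    show ?thesis
      unfolding agree_def
    proof (intro exI[of _ C] allI impI conjI)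
      fix p :: complex assume p: "norm p \<le> 1 / 2"
      have "norm (p ^ l) \<le> norm p ^ 1"
        unfolding norm_power using p assms by (intro power_decreasing) auto
      hence pl: "norm (p ^ l) \<le> norm p" by simp
      hence pl': "norm (p ^ l) \<le> 1 / 2" using p by linarith
      show "norm (odd_prod (p ^ l) 1) \<le> C" "norm (ipoly_at (p ^ l) (odd_ipoly K)) \<le> C"
        using C(2)[OF pl'] by auto
      have "C * norm (p ^ l) ^ K \<le> C * norm p ^ K" using C(1) pl by (intro mult_left_mono power_mono) auto
      thus "norm (odd_prod (p ^ l) 1 - ipoly_at (p ^ l) (odd_ipoly K)) \<le> C * norm p ^ K"
        using C(2)[OF pl'] by linarith
    qed
  qed
  hence "agree K (\<lambda>p. 1 * p ^ e * odd_prod p 1 ^ i * odd_prod (p ^ l) 1 ^ j)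
      (\<lambda>p. 1 * p ^ e * ipoly_at p (odd_ipoly K) ^ i * ipoly_at (p ^ l) (odd_ipoly K) ^ j)"
    by (intro agree_mult agree_power agree_odd_prod agree_monom)
  thus ?thesis
    by (simp add: trunc_monomial_def ipoly_at_mult ipoly_at_power ipoly_at_pcompose ipoly_at_monom)
qed

lemma agree_trunc_combination:
  assumes "l > 0"
  shows "agree K (\<lambda>p. \<Sum>i\<in>I. of_int (c i) * (p ^ e i * odd_prod p 1 ^ m i * odd_prod (p ^ l) 1 ^ n i))
     (\<lambda>p. ipoly_at p (\<Sum>i\<in>I. [:c i:] * trunc_monomial l K (e i) (m i) (n i)))"
proof -
  have "agree K (\<lambda>p. of_int (c i) * p ^ 0 * (p ^ e i * odd_prod p 1 ^ m i * odd_prod (p ^ l) 1 ^ n i))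
      (\<lambda>p. of_int (c i) * p ^ 0 * ipoly_at p (trunc_monomial l K (e i) (m i) (n i)))" for i
    by (intro agree_mult agree_monom agree_trunc_monomial assms)
  moreover have "ipoly_at p [:d:] = of_int d * p ^ 0" for p d
    by (simp add: ipoly_at_pCons)
  ultimately show ?thesis
    unfolding ipoly_at_sum ipoly_at_mult by (intro agree_sum) simp
qed

text \<open>Holomorphic functions on a connected open set have no zero divisors: where the other
  factors do not vanish, an open set, the remaining one is 0, and continuation does the
  rest.\<close>

lemma prod_holomorphic_eq_0:
  assumes S: "open S" "connected S" "S \<noteq> {}" and "finite I"
    and "\<And>i. i \<in> I \<Longrightarrow> f i holomorphic_on S" and "\<And>z. z \<in> S \<Longrightarrow> (\<Prod>i\<in>I. f i z) = 0"
  shows "\<exists>i\<in>I. \<forall>z\<in>S. f i z = 0"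
  using assms(4-6)
proof (induction I rule: finite_induct)
  case empty
  thus ?case using S(3) by auto
next
  case (insert i I)
  show ?case
  proof (cases "\<forall>z\<in>S. f i z = 0")
    case False
    then obtain b where b: "b \<in> S" "f i b \<noteq> 0" by blast
    have fi: "f i holomorphic_on S" using insert.prems by simp
    have prod_hol: "(\<lambda>z. \<Prod>i\<in>I. f i z) holomorphic_on S"
      using insert.prems by (intro holomorphic_intros) auto
    have "(\<Prod>i\<in>I. f i z) = 0" if z: "z \<in> S" for z
    proof (rule ccontr)
      assume nz: "(\<Prod>i\<in>I. f i z) \<noteq> 0"
      define U where "U = {w \<in> S. (\<Prod>i\<in>I. f i w) \<noteq> 0}"
      have "open (S \<inter> (\<lambda>w. \<Prod>i\<in>I. f i w) -` (- {0}))"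
        by (rule continuous_open_preimage[OF holomorphic_on_imp_continuous_on[OF prod_hol] S(1)]) auto
      also have "S \<inter> (\<lambda>w. \<Prod>i\<in>I. f i w) -` (- {0}) = U" by (auto simp: U_def)
      finally have "open U" .
      moreover have "z \<in> U" using z nz by (simp add: U_def)
      moreover have "f i w = 0" if "w \<in> U" for w
        using that insert.prems(2)[of w] insert.hyps by (auto simp: U_def)
      ultimately have "f i b = 0"
        using S(1,2) fi b(1)
        by (intro analytic_continuation_open[of U S "f i" "\<lambda>_. 0" b]) (auto simp: U_def)
      thus False using b(2) by simp
    qed
    thus ?thesis using insert.IH insert.prems(1) by auto
  qed auto
qed

context weber_level
begin

text \<open>The bound l + 1 on the exponent of w becomes the degree in y; the exponents of u start
  at l * (l + 1) because of the cusp 1.\<close>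

definition weber_relation :: "(nat \<times> nat \<Rightarrow> int) \<Rightarrow> nat \<Rightarrow> complex \<Rightarrow> complex \<Rightarrow> complex" where
  "weber_relation c A u w = (\<Sum>(a, b)\<in>{l * (l + 1)..A} \<times> {..l + 1}. of_int (c (a, b)) * u ^ a * w ^ b)"

text \<open>With a and b the products at p and p^l, u = a^24 / p and w = b / a^l; the prefactor
  clears the pole in p and the denominators.\<close>

lemma weber_relation_expansion:
  assumes \<tau>: "Im \<tau> > 0"
  shows "nome \<tau> ^ A * odd_prod (nome \<tau>) 1 ^ (l * (l + 1)) * weber_relation c A (weber_f \<tau> ^ 24) (weber_conj_inf \<tau>) =
    (\<Sum>i\<in>{l * (l + 1)..A} \<times> {..l + 1}. of_int (c i) * (nome \<tau> ^ (A - fst i) *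
       odd_prod (nome \<tau>) 1 ^ (24 * fst i + l * (l + 1 - snd i)) * odd_prod (nome \<tau> ^ l) 1 ^ snd i))"
proof -
  define p where "p = nome \<tau>"
  define a0 where "a0 = odd_prod p 1"
  define al where "al = odd_prod (p ^ l) 1"
  have a0: "a0 \<noteq> 0"
    using weber_f_nonzero[OF \<tau>] by (auto simp: weber_f_nome[OF \<tau>] a0_def p_def)
  have u: "weber_f \<tau> ^ 24 = nome (- \<tau>) * a0 ^ 24"
    unfolding weber_f_nome[OF \<tau>] a0_def p_def power_mult_distrib nome_power by simp
  have w: "weber_conj_inf \<tau> = al / a0 ^ l"
  proof -
    have "weber_f (of_nat l * \<tau>) = nome (- (of_nat l * \<tau> / 24)) * al"
      using \<tau> level_pos weber_f_nome[of "of_nat l * \<tau>"] by (simp add: nome_of_nat_mult al_def p_def)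
    moreover have "weber_f \<tau> ^ l = nome (- (of_nat l * \<tau> / 24)) * a0 ^ l"
      unfolding weber_f_nome[OF \<tau>] a0_def p_def power_mult_distrib nome_power by simp
    ultimately show ?thesis by (simp add: weber_conj_inf_def)
  qed
  have pm: "p * nome (- \<tau>) = 1" unfolding p_def nome_add [symmetric] by simp
  have "p ^ A * a0 ^ (l * (l + 1)) * (of_int d * (weber_f \<tau> ^ 24) ^ a * weber_conj_inf \<tau> ^ b) =
      of_int d * (p ^ (A - a) * a0 ^ (24 * a + l * (l + 1 - b)) * al ^ b)"
    if a: "a \<le> A" and b: "b \<le> l + 1" for a b d
  proof -
    have "p ^ A * nome (- \<tau>) ^ a = p ^ (A - a) * (p * nome (- \<tau>)) ^ a"
      using a by (simp add: power_mult_distrib mult.assoc flip: power_add)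
    hence 1: "p ^ A * nome (- \<tau>) ^ a = p ^ (A - a)" by (simp add: pm)
    have "l * (l + 1) = l * (l + 1 - b) + l * b"
      using b by (metis add_mult_distrib2 le_add_diff_inverse2)
    hence "a0 ^ (l * (l + 1)) = a0 ^ (l * (l + 1 - b)) * (a0 ^ l) ^ b"
      by (simp only: power_add power_mult)
    hence 2: "a0 ^ (l * (l + 1)) * (al / a0 ^ l) ^ b = a0 ^ (l * (l + 1 - b)) * al ^ b"
      using a0 by (simp add: power_divide)
    have 3: "a0 ^ (24 * a + l * (l + 1 - b)) = (a0 ^ 24) ^ a * a0 ^ (l * (l + 1 - b))"
      by (simp only: power_add power_mult[of a0 24 a])
    have "p ^ A * a0 ^ (l * (l + 1)) * (of_int d * (weber_f \<tau> ^ 24) ^ a * weber_conj_inf \<tau> ^ b) =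
        of_int d * (p ^ A * nome (- \<tau>) ^ a) * (a0 ^ 24) ^ a * (a0 ^ (l * (l + 1)) * (al / a0 ^ l) ^ b)"
      unfolding u w power_mult_distrib by (simp only: mult_ac)
    also have "\<dots> = of_int d * (p ^ (A - a) * a0 ^ (24 * a + l * (l + 1 - b)) * al ^ b)"
      unfolding 1 2 3 by (simp only: mult_ac)
    finally show ?thesis .
  qed
  thus ?thesis
    unfolding weber_relation_def sum_distrib_left p_def [symmetric] a0_def [symmetric] al_def [symmetric]
    by (intro sum.cong) auto
qed

text \<open>There are (A - A0 + 1) * (l + 2) unknowns and K = A * (l + 1) + 1 equations; the
  unknowns win as soon as A exceeds A0 * (l + 2).\<close>

lemma ex_weber_relation:
  obtains c A where "\<exists>i\<in>{l * (l + 1)..A} \<times> {..l + 1}. c i \<noteq> 0"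
    "\<And>\<tau>. Im \<tau> > 0 \<Longrightarrow> weber_relation c A (weber_f \<tau> ^ 24) (weber_conj_inf \<tau>) = 0"
proof -
  define A0 where "A0 = l * (l + 1)"
  define A where "A = A0 * (l + 2) + 2"
  define M where "M = A * l + 1"
  \<comment> \<open>M is the decay at infinity demanded by the norm argument; A more orders are
    needed because the expansion carries the factor p^A.\<close>
  define K where "K = M + A"
  define I where "I = {A0..A} \<times> {..l + 1}"
  have "A0 \<le> A" by (simp add: A_def)
  hence cardI: "card I = (A - A0 + 1) * (l + 2)" by (simp add: I_def Suc_diff_le)
  have "A0 * (l + 2) + K < card I + A0 * (l + 2)"
  proof -
    have "card I + A0 * (l + 2) = (A + 1) * (l + 2)"
      using \<open>A0 \<le> A\<close> unfolding cardI by (simp flip: add_mult_distrib)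
    also have "\<dots> = A + (A * l + A) + (l + 2)" by (simp add: algebra_simps)
    finally have eq: "card I + A0 * (l + 2) = A + (A * l + A) + (l + 2)" .
    have "A0 * (l + 2) < A" by (simp add: A_def)
    thus ?thesis unfolding eq K_def M_def by linarith
  qed
  hence "K < card I" by simp
  define t where "t = (\<lambda>i. trunc_monomial l K (A - fst i) (24 * fst i + l * (l + 1 - snd i)) (snd i))"
  have "finite I" by (simp add: I_def)
  from homogeneous_system_nontrivial_solution[OF this \<open>K < card I\<close>, of "\<lambda>i. coeff (t i)"]
  obtain c where c: "\<exists>i\<in>I. c i \<noteq> 0" "\<And>n. n < K \<Longrightarrow> (\<Sum>i\<in>I. c i * coeff (t i) n) = 0"
    by blast
  define F where "F = weber_relation c A"
  define q where "q = (\<Sum>i\<in>I. [:c i:] * t i)"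
  have "coeff q n = 0" if "n < K" for n
    using c(2)[OF that] by (simp add: q_def coeff_sum)
  then obtain C1 where C1: "\<And>p. norm p \<le> 1 / 2 \<Longrightarrow> norm (ipoly_at p q) \<le> C1 * norm p ^ K"
    using ipoly_at_order_ge by blast
  define G where "G = (\<lambda>p. \<Sum>i\<in>I. of_int (c i) * (p ^ (A - fst i) *
       odd_prod p 1 ^ (24 * fst i + l * (l + 1 - snd i)) * odd_prod (p ^ l) 1 ^ snd i))"
  have "agree K G (\<lambda>p. ipoly_at p q)"
    unfolding G_def q_def t_def by (rule agree_trunc_combination[OF level_pos])
  then obtain C2 where C2: "\<And>p. norm p \<le> 1 / 2 \<Longrightarrow> norm (G p - ipoly_at p q) \<le> C2 * norm p ^ K"
    by (rule agreeE) blast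
  have G_le: "norm (G p) \<le> (C1 + C2) * norm p ^ K" if "norm p \<le> 1 / 2" for p
    using C1[OF that] C2[OF that] norm_triangle_sub[of "G p" "ipoly_at p q"]
    by (simp add: distrib_right)
  have "conj_norm (\<lambda>u w. \<Sum>(a, b)\<in>{l * (l + 1)..A} \<times> {..l + 1}. of_int (c (a, b)) * u ^ a * w ^ b) \<tau> = 0"
    if \<tau>: "Im \<tau> > 0" for \<tau>
  proof (rule conj_norm_eq_0[OF _ \<tau>])
    fix \<tau> :: complex assume \<tau>: "Im \<tau> \<ge> 1" "Im \<tau> > 0"
    define p where "p = nome \<tau>"
    have np: "norm p = exp (- pi * Im \<tau>)" by (simp add: p_def norm_nome)
    have "1 \<le> pi * Im \<tau>" using mult_mono[of 1 pi 1 "Im \<tau>"] pi_gt3 \<tau> by simp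
    hence "norm p \<le> exp (- 1)" unfolding np by simp
    also have "\<dots> \<le> 1 / 2" using exp_ge_add_one_self[of "1 :: real"] by (simp add: exp_minus field_simps)
    finally have p2: "norm p \<le> 1 / 2" .
    have odd: "norm (odd_prod p 1) \<ge> exp (- 1)"
    proof -
      have "exp (pi * Im \<tau> / 24) * exp (- 1) \<le> exp (pi * Im \<tau> / 24 - 1 / Im \<tau>)"
        unfolding exp_add [symmetric] using \<tau> by simp
      also have "\<dots> \<le> norm (weber_f \<tau>)" by (rule norm_weber_f_ge[OF \<tau>(2)])
      also have "\<dots> = exp (pi * Im \<tau> / 24) * norm (odd_prod p 1)"
        unfolding weber_f_nome[OF \<tau>(2)] p_def by (simp add: norm_mult norm_nome)
      finally show ?thesis by simp
    qed
    have "norm p ^ A * exp (- 1) ^ A0 * norm (F (weber_f \<tau> ^ 24) (weber_conj_inf \<tau>)) \<le>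
        norm p ^ A * norm (odd_prod p 1) ^ A0 * norm (F (weber_f \<tau> ^ 24) (weber_conj_inf \<tau>))"
      using odd by (intro mult_right_mono mult_left_mono power_mono) auto
    also have "\<dots> = norm (G p)"
      unfolding norm_power [symmetric] norm_mult [symmetric] F_def G_def p_def A0_def I_def
      by (simp only: weber_relation_expansion[OF \<tau>(2)])
    also have "\<dots> \<le> norm p ^ A * ((C1 + C2) * norm p ^ M)"
      using G_le[OF p2] by (simp add: K_def power_add mult_ac)
    finally have "exp (- 1) ^ A0 * norm (F (weber_f \<tau> ^ 24) (weber_conj_inf \<tau>)) \<le> (C1 + C2) * norm p ^ M"
      by (simp add: mult.assoc p_def)
    hence "norm (F (weber_f \<tau> ^ 24) (weber_conj_inf \<tau>)) \<le> exp (real A0) * (C1 + C2) * norm p ^ M"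
      by (simp add: exp_minus field_simps flip: exp_of_nat_mult)
    also have "norm p ^ M = exp (- (pi * real (A * l + 1) * Im \<tau>))"
      unfolding np exp_of_nat_mult [symmetric] M_def by (rule arg_cong[of _ _ exp]) (simp add: algebra_simps)
    finally show "norm (\<Sum>(a, b)\<in>{l * (l + 1)..A} \<times> {..l + 1}. of_int (c (a, b)) * (weber_f \<tau> ^ 24) ^ a * weber_conj_inf \<tau> ^ b)
        \<le> exp (real A0) * (C1 + C2) * exp (- (pi * real (A * l + 1) * Im \<tau>))"
      by (simp add: F_def weber_relation_def)
  qed
  hence zero: "conj_norm F \<tau> = 0" if "Im \<tau> > 0" for \<tau>
    using that unfolding F_def weber_relation_def .
  \<comment> \<open>The index - 1 stands for the conjugate at infinity.\<close>
  define f where "f = (\<lambda>k \<tau>. F (weber_f \<tau> ^ 24) ((if k = - 1 then weber_conj_inf else weber_conj k) \<tau>))"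
  have "\<exists>k\<in>insert (- 1) {0..<int l}. \<forall>z\<in>upper_half. f k z = 0"
  proof (rule prod_holomorphic_eq_0[OF open_upper_half connected_upper_half])
    show "upper_half \<noteq> {}" by (auto simp: upper_half_def intro: exI[of _ \<i>])
    show "f k holomorphic_on upper_half" for k
      unfolding f_def F_def weber_relation_def case_prod_unfold
      by (intro holomorphic_intros holomorphic_weber_f) (auto simp: holomorphic_weber_conj_inf holomorphic_weber_conj)
    have "(\<Prod>k\<in>insert (- 1) {0..<int l}. f k z) = conj_norm F z" for z
      by (auto simp: conj_norm_def f_def intro!: prod.cong)
    thus "(\<Prod>k\<in>insert (- 1) {0..<int l}. f k z) = 0" if "z \<in> upper_half" for z
      using zero that by (simp add: upper_half_def)
  qed simp
  then obtain k where k: "k \<in> insert (- 1) {0..<int l}" "\<And>z. Im z > 0 \<Longrightarrow> f k z = 0"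
    unfolding upper_half_def by blast
  have final: "F (weber_f \<tau> ^ 24) (weber_conj_inf \<tau>) = 0" if \<tau>: "Im \<tau> > 0" for \<tau>
  proof (cases "k = - 1")
    case True
    thus ?thesis using k(2)[OF \<tau>] by (simp add: f_def)
  next
    case False
    \<comment> \<open>Translation raises the index by 1. Index l is index 0, from which the
      inversion reaches the conjugate at infinity.\<close>
    have "F (weber_f z ^ 24) (weber_conj (k + int n) z) = 0" if "Im z > 0" for z n
      using that
    proof (induction n arbitrary: z)
      case 0
      thus ?case using k(2)[of z] False by (simp add: f_def)
    next
      case (Suc n)
      show ?case
        using Suc.IH[of "z + 2"] Suc.prems weber_f_24_plus_2[OF Suc.prems] weber_conj_plus_2[OF Suc.prems, of "k + int n"]
        by (simp add: add.assoc add.commute[of 1])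
    qed
    from this[of "- 1 / \<tau>" "nat (int l - k)"] Im_minus_inverse_pos[OF \<tau>]
    have "F (weber_f (- 1 / \<tau>) ^ 24) (weber_conj (0 + int l) (- 1 / \<tau>)) = 0"
      using k(1) False by simp
    thus ?thesis
      unfolding weber_conj_plus_level[OF Im_minus_inverse_pos[OF \<tau>]] weber_conj_0_inversion[OF \<tau>] weber_f_inversion[OF \<tau>] .
  qed
  show ?thesis
    using that[of A c] c(1) final unfolding F_def I_def A0_def by blast
qed

end

section \<open>Degree bounds and homogeneity\<close>

lemma coeff_mult_top:
  fixes p q :: "'a :: comm_semiring_1 poly"
  assumes "degree p \<le> a" "degree q \<le> b"
  shows "coeff (p * q) (a + b) = coeff p a * coeff q b"
proof -
  have "coeff p i * coeff q (a + b - i) = 0" if "i \<noteq> a" for i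
    using assms that by (cases "i < a") (auto simp: coeff_eq_0)
  hence "coeff p i * coeff q (a + b - i) = (if i = a then coeff p a * coeff q b else 0)" for i
    by simp
  thus ?thesis by (simp add: coeff_mult)
qed

text \<open>The degree in the inner variable is additive: the coefficients of its top powers are
  nonzero polynomials in the outer variable, and so is their product.\<close>

lemma coeff_degree_le_of_dvd:
  fixes P R :: "'a :: idom poly poly"
  assumes "P dvd R" "R \<noteq> 0" "\<And>j. degree (coeff R j) \<le> D"
  shows "degree (coeff P j) \<le> D"
proof -
  obtain Q where Q: "R = P * Q" using assms(1) by blast
  have nz: "P \<noteq> 0" "Q \<noteq> 0" using assms(2) Q by auto
  have top: "\<exists>d. (\<forall>j. degree (coeff S j) \<le> d) \<and> map_poly (\<lambda>p. coeff p d) S \<noteq> 0" if S: "S \<noteq> 0" for S :: "'a poly poly"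
  proof -
    define d where "d = Max ((\<lambda>j. degree (coeff S j)) ` {..degree S})"
    have le: "degree (coeff S j) \<le> d" for j
      by (cases "j \<le> degree S") (auto simp: d_def coeff_eq_0)
    have "d \<in> (\<lambda>j. degree (coeff S j)) ` {..degree S}"
      unfolding d_def by (intro Max_in) auto
    then obtain j where j: "d = degree (coeff S j)" by blast
    have "\<exists>j. coeff (coeff S j) d \<noteq> 0"
    proof (cases "coeff S j = 0")
      case True
      hence "d = 0" using j by simp
      moreover have "degree (lead_coeff S) \<le> 0" using le[of "degree S"] \<open>d = 0\<close> by simp
      ultimately show ?thesis using S by (intro exI[of _ "degree S"]) (metis leading_coeff_0_iff le_zero_eq)
    next
      case False
      thus ?thesis by (intro exI[of _ j]) (simp add: j)
    qed
    thus ?thesis using le by (intro exI[of _ d]) (auto simp: poly_eq_iff coeff_map_poly)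
  qed
  obtain a where a: "\<And>j. degree (coeff P j) \<le> a" "map_poly (\<lambda>p. coeff p a) P \<noteq> 0"
    using top[OF nz(1)] by blast
  obtain b where b: "\<And>j. degree (coeff Q j) \<le> b" "map_poly (\<lambda>p. coeff p b) Q \<noteq> 0"
    using top[OF nz(2)] by blast
  have "map_poly (\<lambda>p. coeff p (a + b)) R = map_poly (\<lambda>p. coeff p a) P * map_poly (\<lambda>p. coeff p b) Q"
  proof (rule poly_eqI)
    fix n
    have "coeff (\<Sum>i\<le>n. coeff P i * coeff Q (n - i)) (a + b) = (\<Sum>i\<le>n. coeff (coeff P i) a * coeff (coeff Q (n - i)) b)"
      unfolding coeff_sum by (intro sum.cong refl coeff_mult_top a(1) b(1))
    thus "coeff (map_poly (\<lambda>p. coeff p (a + b)) R) n = coeff (map_poly (\<lambda>p. coeff p a) P * map_poly (\<lambda>p. coeff p b) Q) n"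
      unfolding Q coeff_mult[of "map_poly _ P"] by (simp add: coeff_map_poly coeff_mult[of P])
  qed
  hence "map_poly (\<lambda>p. coeff p (a + b)) R \<noteq> 0" using a(2) b(2) by simp
  then obtain i where "coeff (coeff R i) (a + b) \<noteq> 0"
    by (auto simp: poly_eq_iff coeff_map_poly)
  hence "a + b \<le> degree (coeff R i)" by (rule le_degree)
  also have "\<dots> \<le> D" by (rule assms(3))
  finally show ?thesis using a(1)[of j] by linarith
qed

text \<open>The roots of a nonzero polynomial are bounded, whereas the Weber function is unbounded
  on the imaginary axis.\<close>

lemma ipoly_at_weber_f_eq_0:
  assumes "\<And>\<tau>. Im \<tau> > 0 \<Longrightarrow> ipoly_at (weber_f \<tau>) r = 0"
  shows "r = 0"
proof (rule ccontr)
  assume "r \<noteq> 0"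
  define S where "S = {x. poly (map_poly complex_of_int r) x = 0}"
  have "map_poly complex_of_int r \<noteq> 0"
    using \<open>r \<noteq> 0\<close> by (auto simp: poly_eq_iff coeff_map_poly)
  hence "bounded S" unfolding S_def by (intro finite_imp_bounded poly_roots_finite)
  then obtain B where B: "\<And>x. x \<in> S \<Longrightarrow> norm x \<le> B"
    unfolding bounded_iff by blast
  define b where "b = \<bar>B\<bar>"
  have b: "b \<ge> 0" "B \<le> b" by (simp_all add: b_def)
  \<comment> \<open>This makes pi * y / 24 equal to pi * (b + 2), which exceeds b even after
    subtracting 1 / y \<le> 1.\<close>
  define y where "y = 24 * (b + 2)"
  have y: "1 / y \<le> 1" "y > 0" using b(1) by (simp_all add: y_def)
  have Im: "Im (\<i> * of_real y) = y" by simp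
  have "3 * (b + 2) \<le> pi * (b + 2)" using pi_gt3 b by (intro mult_right_mono) auto
  also have "pi * (b + 2) = pi * y / 24" by (simp add: y_def)
  finally have "3 * (b + 2) \<le> pi * y / 24" .
  moreover have "b < u - v" if "3 * (b + 2) \<le> u" "v \<le> 1" for u v :: real
    using that b(1) by simp
  ultimately have "b < pi * y / 24 - 1 / y" using y(1) by blast
  also have "\<dots> < exp (pi * y / 24 - 1 / y)"
    using exp_ge_add_one_self[of "pi * y / 24 - 1 / y"] by linarith
  also have "\<dots> \<le> norm (weber_f (\<i> * of_real y))"
    using norm_weber_f_ge[of "\<i> * of_real y"] y(2) unfolding Im by simp
  also have "\<dots> \<le> B"
    using assms[of "\<i> * of_real y"] y(2) by (intro B) (simp add: S_def ipoly_at_def)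
  finally show False using b(2) by simp
qed

context weber_level
begin

definition vanishes :: "int poly poly \<Rightarrow> bool" where
  "vanishes P \<longleftrightarrow> (\<forall>\<tau>. Im \<tau> > 0 \<longrightarrow> eval_xy P (weber_f \<tau>) (weber_f (of_nat l * \<tau>)) = 0)"

lemma vanishes_degree_pos:
  assumes "vanishes P" "P \<noteq> 0"
  shows "degree P > 0"
proof (rule ccontr)
  assume "\<not> degree P > 0"
  then obtain p where p: "P = [:p:]" by (metis degree_eq_zeroE gr0I)
  have "p = 0"
    using assms(1) by (intro ipoly_at_weber_f_eq_0) (simp add: vanishes_def p eval_xy_const)
  thus False using assms(2) p by simp
qed

text \<open>Otherwise a combination of P and R would be a nonzero polynomial in x alone that
  vanishes at all values of the Weber function.\<close>

lemma irreducible_vanishes_dvd: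
  assumes "irreducible P" "vanishes P" "vanishes R"
  shows "P dvd R"
proof (rule ccontr)
  assume ndvd: "\<not> P dvd R"
  have "degree P > 0" using assms(1) by (intro vanishes_degree_pos assms(2)) auto
  then obtain A B r where r: "r \<noteq> 0" "A * P + B * R = [:r:]"
    using irreducible_combination[OF assms(1) _ ndvd] by metis
  have "ipoly_at (weber_f \<tau>) r = 0" if "Im \<tau> > 0" for \<tau>
  proof -
    have "eval_xy [:r:] (weber_f \<tau>) (weber_f (of_nat l * \<tau>)) = 0"
      unfolding r(2) [symmetric] using assms(2,3) that by (simp add: eval_xy_add eval_xy_mult vanishes_def)
    thus ?thesis by (simp add: eval_xy_const)
  qed
  thus False using ipoly_at_weber_f_eq_0 r(1) by blast
qed

text \<open>The Fricke involution \<tau> \<mapsto> - 1 / (l * \<tau>).\<close>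

lemma weber_f_swap:
  assumes \<tau>: "Im \<tau> > 0"
  obtains \<sigma> where "Im \<sigma> > 0" "weber_f \<sigma> = weber_f (of_nat l * \<tau>)" "weber_f (of_nat l * \<sigma>) = weber_f \<tau>"
proof
  have l\<tau>: "Im (of_nat l * \<tau>) > 0" using \<tau> level_pos by simp
  show "Im (- 1 / (of_nat l * \<tau>)) > 0" by (rule Im_minus_inverse_pos[OF l\<tau>])
  show "weber_f (- 1 / (of_nat l * \<tau>)) = weber_f (of_nat l * \<tau>)" by (rule weber_f_inversion[OF l\<tau>])
  have "of_nat l * (- 1 / (of_nat l * \<tau>)) = - 1 / \<tau>" using level_pos by simp
  thus "weber_f (of_nat l * (- 1 / (of_nat l * \<tau>))) = weber_f \<tau>" using weber_f_inversion[OF \<tau>] by simp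
qed

text \<open>P divides the relation R, of degree at most l + 1 in y, and by the Fricke involution
  also R', in which the variables are exchanged.\<close>

lemma vanishes_degree_bounds:
  assumes irr: "irreducible P" and van: "vanishes P"
  shows "degree P \<le> l + 1" and "degree (coeff P j) \<le> l + 1"
proof -
  obtain c A where c: "\<exists>i\<in>{l * (l + 1)..A} \<times> {..l + 1}. c i \<noteq> 0"
    "\<And>\<tau>. Im \<tau> > 0 \<Longrightarrow> weber_relation c A (weber_f \<tau> ^ 24) (weber_conj_inf \<tau>) = 0"
    by (rule ex_weber_relation) (rule that)
  define I where "I = {l * (l + 1)..A} \<times> {..l + 1}"
  have finI: "finite I" by (simp add: I_def)
  \<comment> \<open>The exponent of x once the denominators x^(l * b) are cleared by x^(l * (l +
    1)).\<close>
  define e where "e = (\<lambda>i::nat \<times> nat. 24 * fst i + l * (l + 1 - snd i))"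
  define R where "R = (\<Sum>i\<in>I. monom (monom (c i) (e i)) (snd i))"
  define R' where "R' = (\<Sum>i\<in>I. monom (monom (c i) (snd i)) (e i))"
  \<comment> \<open>Distinct pairs give distinct monomials, so nothing cancels in R and R'.\<close>
  have inj: "i = i'" if "e i = e i'" "snd i = snd i'" for i i'
    using that by (simp add: e_def prod_eq_iff)
  obtain i0 where i0: "i0 \<in> I" "c i0 \<noteq> 0" using c(1) I_def by blast
  have "coeff (coeff R (snd i0)) (e i0) = (\<Sum>i\<in>I. if i = i0 then c i else 0)"
    unfolding R_def coeff_sum by (intro sum.cong) (auto dest: inj)
  hence R0: "R \<noteq> 0" using i0 finI by auto
  have "coeff (coeff R' (e i0)) (snd i0) = (\<Sum>i\<in>I. if i = i0 then c i else 0)"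
    unfolding R'_def coeff_sum by (intro sum.cong) (auto dest: inj)
  hence R'0: "R' \<noteq> 0" using i0 finI by auto
  have R_eq: "eval_xy R x y = x ^ (l * (l + 1)) * weber_relation c A (x ^ 24) (y / x ^ l)" if "x \<noteq> 0" for x y
    unfolding R_def weber_relation_def I_def eval_xy_sum eval_xy_monom sum_distrib_left
  proof (intro sum.cong)
    fix i assume i: "i \<in> {l * (l + 1)..A} \<times> {..l + 1}"
    obtain a b where ab: "i = (a, b)" by force
    have "l * (l + 1) = l * (l + 1 - b) + l * b"
      using i ab by (metis add_mult_distrib2 le_add_diff_inverse2 SigmaD2 atMost_iff)
    hence "x ^ (l * (l + 1)) = x ^ (l * (l + 1 - b)) * (x ^ l) ^ b"
      by (simp only: power_add power_mult)
    moreover have "x ^ e i = (x ^ 24) ^ a * x ^ (l * (l + 1 - b))"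
      by (simp add: e_def ab power_add power_mult)
    ultimately show "of_int (c i) * x ^ e i * y ^ snd i =
        x ^ (l * (l + 1)) * (case i of (a, b) \<Rightarrow> of_int (c (a, b)) * (x ^ 24) ^ a * (y / x ^ l) ^ b)"
      using \<open>x \<noteq> 0\<close> by (simp add: ab power_divide)
  qed simp
  have vR: "vanishes R"
    unfolding vanishes_def
    using c(2) by (auto simp: R_eq weber_f_nonzero weber_conj_inf_def)
  have "eval_xy R' x y = eval_xy R y x" for x y
    unfolding R_def R'_def eval_xy_sum eval_xy_monom by (intro sum.cong) simp_all
  hence vR': "vanishes R'"
    unfolding vanishes_def using vR[unfolded vanishes_def] weber_f_swap by metis
  have "P dvd R" by (rule irreducible_vanishes_dvd[OF irr van vR])
  hence "degree P \<le> degree R" using R0 by (rule dvd_imp_degree_le)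
  also have "degree R \<le> l + 1"
    unfolding R_def
    by (intro degree_sum_le finI order_trans[OF degree_monom_le]) (auto simp: I_def)
  finally show "degree P \<le> l + 1" .
  have "P dvd R'" by (rule irreducible_vanishes_dvd[OF irr van vR'])
  thus "degree (coeff P j) \<le> l + 1"
  proof (rule coeff_degree_le_of_dvd[OF _ R'0])
    show "degree (coeff R' j) \<le> l + 1" for j
      unfolding R'_def coeff_sum
      by (intro degree_sum_le finI) (auto simp: I_def intro: order_trans[OF degree_monom_le])
  qed
qed

section \<open>The grading by i + l * j modulo 24\<close>

definition weight_part :: "int poly poly \<Rightarrow> nat \<Rightarrow> int poly poly" where
  "weight_part P r = (\<Sum>j\<le>degree P. \<Sum>i\<le>degree (coeff P j).
     monom (monom (if (i + l * j) mod 24 = r then coeff (coeff P j) i else 0) i) j)"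

lemma coeff_weight_part:
  "coeff (coeff (weight_part P r) j) i = (if (i + l * j) mod 24 = r then coeff (coeff P j) i else 0)"
proof -
  define g where "g = (\<lambda>j i. if (i + l * j) mod 24 = r then coeff (coeff P j) i else 0)"
  have "coeff (coeff (weight_part P r) j) i = (\<Sum>j'\<le>degree P. \<Sum>i'\<le>degree (coeff P j').
      if j' = j then (if i' = i then g j i else 0) else 0)"
    unfolding weight_part_def coeff_sum g_def by (intro sum.cong) auto
  also have "\<dots> = (\<Sum>j'\<le>degree P. if j' = j then (\<Sum>i'\<le>degree (coeff P j). if i' = i then g j i else 0) else 0)"
    by (intro sum.cong) auto
  also have "\<dots> = (if j \<le> degree P then if i \<le> degree (coeff P j) then g j i else 0 else 0)"
    by simp
  also have "\<dots> = g j i" by (auto simp: g_def coeff_eq_0)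
  finally show ?thesis by (simp add: g_def)
qed

lemma root24_sum:
  "(\<Sum>k<24. root24 (int k * m)) = (if 24 dvd m then 24 else 0)"
proof (cases "24 dvd m")
  case True
  hence "root24 (int k * m) = 1" for k by (simp add: root24_eq_1_iff)
  thus ?thesis using True by simp
next
  case False
  have "(\<Sum>k<24. root24 m ^ k) = 0"
    using geometric_sum[of "root24 m" 24] False by (simp add: root24_eq_1_iff root24_power)
  thus ?thesis using False by (simp add: root24_power)
qed

text \<open>Orthogonality of the characters of the translations by \<open>2 * k\<close> isolates a single weight.\<close>
lemma vanishes_weight_part:
  assumes "vanishes P" and r: "r < 24"
  shows "vanishes (weight_part P r)"
  unfolding vanishes_def
proof (intro allI impI)
  fix \<tau> :: complex assume \<tau>: "Im \<tau> > 0"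
  define x where "x = weber_f \<tau>"
  define y where "y = weber_f (of_nat l * \<tau>)"
  define t where "t = (\<lambda>j i. of_int (coeff (coeff P j) i) * x ^ i * y ^ j)"
  have shifted: "(\<Sum>j\<le>degree P. \<Sum>i\<le>degree (coeff P j). root24 (- (int k * int (i + l * j))) * t j i) = 0" for k
  proof -
    define \<tau>' where "\<tau>' = \<tau> + 2 * of_int (int k)"
    have "weber_f \<tau>' = root24 (- int k) * x"
      unfolding x_def \<tau>'_def by (rule weber_f_plus_even[OF \<tau>])
    moreover have "weber_f (of_nat l * \<tau>') = root24 (- int (l * k)) * y"
      using weber_f_plus_even[of "of_nat l * \<tau>" "int (l * k)"] \<tau> level_pos
      by (simp add: y_def \<tau>'_def algebra_simps)
    moreover have "eval_xy P (weber_f \<tau>') (weber_f (of_nat l * \<tau>')) = 0"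
      using assms(1) \<tau> by (simp add: vanishes_def \<tau>'_def)
    ultimately have "(\<Sum>j\<le>degree P. \<Sum>i\<le>degree (coeff P j).
        of_int (coeff (coeff P j) i) * (root24 (- int k) * x) ^ i * (root24 (- int (l * k)) * y) ^ j) = 0"
      by (simp add: eval_xy_altdef)
    also have "(\<Sum>j\<le>degree P. \<Sum>i\<le>degree (coeff P j).
        of_int (coeff (coeff P j) i) * (root24 (- int k) * x) ^ i * (root24 (- int (l * k)) * y) ^ j) =
        (\<Sum>j\<le>degree P. \<Sum>i\<le>degree (coeff P j). root24 (- (int k * int (i + l * j))) * t j i)"
    proof (intro sum.cong refl)
      fix j i
      have "root24 (- (int k * int (i + l * j))) = root24 (int i * (- int k)) * root24 (int j * (- int (l * k)))"
        unfolding root24_add [symmetric] by (rule arg_cong[of _ _ root24]) (simp add: algebra_simps)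
      thus "of_int (coeff (coeff P j) i) * (root24 (- int k) * x) ^ i * (root24 (- int (l * k)) * y) ^ j =
          root24 (- (int k * int (i + l * j))) * t j i"
        unfolding t_def power_mult_distrib root24_power by (simp only: mult_ac)
    qed
    finally show ?thesis .
  qed
  have "(\<Sum>k<24. root24 (int k * int r) * root24 (- (int k * int n))) = (if n mod 24 = r then 24 else 0)" for n
  proof -
    have "root24 (int k * int r) * root24 (- (int k * int n)) = root24 (int k * (int r - int n))" for k
      unfolding root24_add [symmetric] by (simp add: algebra_simps)
    moreover have "24 dvd int r - int n \<longleftrightarrow> n mod 24 = r"
    proof -
      have "24 dvd int r - int n \<longleftrightarrow> int r mod 24 = int n mod 24" by (rule mod_eq_dvd_iff [symmetric])
      also have "int r mod 24 = int r" using r by simp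
      also have "int n mod 24 = int (n mod 24)" by (simp add: zmod_int)
      also have "int r = int (n mod 24) \<longleftrightarrow> n mod 24 = r" by auto
      finally show ?thesis .
    qed
    ultimately show ?thesis by (simp only: root24_sum)
  qed
  hence ortho: "(\<Sum>k<24. root24 (int k * int r) * (root24 (- (int k * int n)) * v)) = (if n mod 24 = r then 24 else 0) * v" for n v
    by (simp only: mult.assoc [symmetric] sum_distrib_right [symmetric])
  have "24 * eval_xy (weight_part P r) x y =
      (\<Sum>j\<le>degree P. \<Sum>i\<le>degree (coeff P j). (if (i + l * j) mod 24 = r then 24 else 0) * t j i)"
    unfolding weight_part_def eval_xy_sum eval_xy_monom sum_distrib_left t_def by (intro sum.cong) auto
  also have "\<dots> = (\<Sum>j\<le>degree P. \<Sum>i\<le>degree (coeff P j). \<Sum>k<24.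
      root24 (int k * int r) * (root24 (- (int k * int (i + l * j))) * t j i))"
    by (simp only: ortho)
  also have "\<dots> = (\<Sum>k<24. root24 (int k * int r) *
      (\<Sum>j\<le>degree P. \<Sum>i\<le>degree (coeff P j). root24 (- (int k * int (i + l * j))) * t j i))"
    unfolding sum_distrib_left by (subst sum.swap, subst sum.swap[of _ "{..<24}"]) (rule refl)
  also have "\<dots> = 0" by (simp only: shifted mult_zero_right sum.neutral_const)
  finally show "eval_xy (weight_part P r) (weber_f \<tau>) (weber_f (of_nat l * \<tau>)) = 0"
    by (simp add: x_def y_def)
qed

text \<open>The graded piece W is P * C, and its degrees do not exceed those of P, so C is a nonzero
  integer. Hence every monomial of P occurs in W.\<close>

lemma vanishes_homogeneous:
  assumes irr: "irreducible P" and van: "vanishes P"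
    and nz: "coeff (coeff P j) i \<noteq> 0" "coeff (coeff P j') i' \<noteq> 0"
  shows "(i + l * j) mod 24 = (i' + l * j') mod 24"
proof -
  define r where "r = (i + l * j) mod 24"
  define W where "W = weight_part P r"
  have "coeff (coeff W j) i \<noteq> 0" using nz(1) by (simp add: W_def coeff_weight_part r_def)
  hence W0: "W \<noteq> 0" by auto
  have "vanishes W" unfolding W_def by (rule vanishes_weight_part[OF van]) (simp add: r_def)
  then obtain C where C: "W = P * C" using irreducible_vanishes_dvd[OF irr van] by blast
  have P0: "P \<noteq> 0" and C0: "C \<noteq> 0" using W0 C by auto
  have coeff_zero: "coeff (coeff W m) n = 0" if "coeff (coeff P m) n = 0" for m n
    using that by (simp add: W_def coeff_weight_part)
  have "degree W \<le> degree P"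
  proof (rule degree_le, intro allI impI poly_eqI)
    fix m n assume "degree P < m"
    thus "coeff (coeff W m) n = coeff 0 n" using coeff_zero[of m n] by (simp add: coeff_eq_0)
  qed
  hence "degree C = 0" using degree_mult_eq[OF P0 C0] C by simp
  then obtain d where d: "C = [:d:]" by (rule degree_eq_zeroE)
  have Wd: "coeff W m = coeff P m * d" for m by (simp add: C d mult.commute)
  have d0: "d \<noteq> 0" using C0 d by simp
  have Pj: "coeff P j \<noteq> 0" using nz(1) by auto
  have "degree (coeff W j) \<le> degree (coeff P j)"
    by (rule degree_le) (auto intro: coeff_zero simp: coeff_eq_0)
  hence "degree d = 0" using degree_mult_eq[OF Pj d0] Wd[of j] by simp
  then obtain e where e: "d = [:e:]" by (rule degree_eq_zeroE)
  have "coeff (coeff W j') i' \<noteq> 0"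
    using nz(2) d0 by (simp add: Wd e mult.commute)
  thus ?thesis by (auto simp: W_def coeff_weight_part r_def split: if_splits)
qed

end

section \<open>Kronecker's congruence\<close>

lemma dvd_mult_diff_cong:
  fixes a b :: "'a :: comm_ring_1"
  assumes "d dvd a - b" "d dvd a' - b'"
  shows "d dvd a * a' - b * b'"
proof -
  have "a * a' - b * b' = a * (a' - b') + (a - b) * b'" by (simp add: algebra_simps)
  thus ?thesis using assms by simp
qed

lemma dvd_power_diff_cong:
  fixes a b :: "'a :: comm_ring_1"
  assumes "d dvd a - b"
  shows "d dvd a ^ n - b ^ n"
  by (induction n) (simp_all add: dvd_mult_diff_cong assms)

lemma prime_dvd_one_plus_power:
  fixes y :: "'a :: comm_ring_1"
  assumes "prime l"
  shows "of_nat l dvd (1 + y ^ l) - (1 + y) ^ l"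
proof -
  have l: "l > 0" using assms by (simp add: prime_gt_0_nat)
  have "(y + 1) ^ l = (\<Sum>k\<le>l. of_nat (l choose k) * y ^ k)"
    by (simp add: binomial_ring)
  also have "{..l} = insert 0 (insert l {0<..<l})" using l by auto
  also have "(\<Sum>k\<in>insert 0 (insert l {0<..<l}). of_nat (l choose k) * y ^ k) =
      1 + y ^ l + (\<Sum>k\<in>{0<..<l}. of_nat (l choose k) * y ^ k)"
    using l by simp
  finally have eq: "(1 + y ^ l) - (1 + y) ^ l = - (\<Sum>k\<in>{0<..<l}. of_nat (l choose k) * y ^ k)"
    by (simp add: add.commute)
  have "(of_nat l :: 'a) dvd of_nat (l choose k)" if "k \<in> {0<..<l}" for k
  proof -
    have "l dvd (l choose k)" using that assms by (intro dvd_choose_prime) auto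
    thus ?thesis by (auto elim!: dvdE)
  qed
  thus ?thesis unfolding eq by (auto intro!: dvd_sum)
qed

text \<open>Factor by factor, 1 + y^l is congruent to (1 + y)^l modulo the prime l. This is the
  source of y being congruent to x^l.\<close>

lemma Frobenius_odd_ipoly:
  assumes "prime l"
  shows "of_nat l dvd pcompose (odd_ipoly K) (monom 1 l) - odd_ipoly K ^ l"
proof (induction K)
  case 0
  show ?case by (simp add: odd_ipoly_def pcompose_1)
next
  case (Suc K)
  define y :: "int poly" where "y = monom 1 (2 * K + 1)"
  have "pcompose y (monom 1 l) = y ^ l"
  proof -
    have "pcompose (monom 1 n) q = q ^ n" for n and q :: "int poly"
      by (induction n) (simp_all add: monom_0 monom_Suc pcompose_pCons)
    thus ?thesis by (simp only: y_def monom_power power_one mult.commute)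
  qed
  hence "pcompose (1 + y) (monom 1 l) = 1 + y ^ l" by (simp add: pcompose_add pcompose_1)
  moreover have "odd_ipoly (Suc K) = odd_ipoly K * (1 + y)" by (simp add: odd_ipoly_def y_def)
  ultimately show ?case
    using dvd_mult_diff_cong[OF Suc prime_dvd_one_plus_power[OF assms, of y]]
    by (simp add: pcompose_mult power_mult_distrib)
qed

lemma coeff_0_odd_ipoly: "coeff (odd_ipoly K) 0 = 1"
  by (induction K) (simp_all add: odd_ipoly_def coeff_mult)

lemma coeff_0_power: "coeff (p ^ n) 0 = coeff p 0 ^ n"
  by (induction n) (simp_all add: coeff_mult)

lemma nome_surj:
  assumes "p \<noteq> 0" "norm p < 1"
  obtains \<tau> where "Im \<tau> > 0" "nome \<tau> = p"
proof
  define \<tau> where "\<tau> = Ln p / (\<i> * of_real pi)"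
  show "nome \<tau> = p" using assms(1) by (simp add: nome_def \<tau>_def)
  hence "exp (- pi * Im \<tau>) < exp 0" using norm_nome[of \<tau>] assms(2) by simp
  thus "Im \<tau> > 0" by simp (simp add: zero_less_mult_iff)
qed

context weber_level
begin

text \<open>With \<open>a i j\<close> the coefficients of \<open>P\<close>, this says that \<open>P(x, x ^ l)\<close> vanishes
  modulo \<open>l\<close>. Otherwise the largest weight \<open>n0\<close> whose coefficient is not divisible by \<open>l\<close> would give the lowest term of an expansion that is \<open>0\<close>.\<close>
lemma Kronecker_congruence:
  fixes a :: "nat \<Rightarrow> nat \<Rightarrow> int"
  assumes van: "\<And>\<tau>. Im \<tau> > 0 \<Longrightarrow>
      (\<Sum>(i, j)\<in>{..l + 1} \<times> {..l + 1}. of_int (a i j) * weber_f \<tau> ^ i * weber_f (of_nat l * \<tau>) ^ j) = 0"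
    and hom: "\<And>i j. a i j \<noteq> 0 \<Longrightarrow> (i + l * j) mod 24 = r"
  shows "int l dvd (\<Sum>(i, j)\<in>{(i, j) \<in> {..l + 1} \<times> {..l + 1}. i + l * j = N}. a i j)"
proof (rule ccontr)
  define box where "box = {..l + 1} \<times> {..l + 1}"
  define b where "b = (\<lambda>n. \<Sum>(i, j)\<in>{(i, j) \<in> box. i + l * j = n}. a i j)"
  define wt where "wt = (\<lambda>(i, j). i + l * j)"
  assume "\<not> int l dvd (\<Sum>(i, j)\<in>{(i, j) \<in> {..l + 1} \<times> {..l + 1}. i + l * j = N}. a i j)"
  hence bN: "\<not> int l dvd b N" by (simp add: b_def box_def)
  define I where "I = {ij \<in> box. case_prod a ij \<noteq> 0}"
  have finbox: "finite box" by (simp add: box_def)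
  hence finI: "finite I" by (simp add: I_def)
  have b_I: "b n = (\<Sum>ij\<in>{ij \<in> I. wt ij = n}. case_prod a ij)" for n
    unfolding b_def
    by (rule sum.mono_neutral_right) (auto simp: I_def wt_def intro: finite_subset[OF _ finbox])
  have N_ex: "\<exists>ij\<in>I. wt ij = n" if n: "\<not> int l dvd b n" for n
  proof (rule ccontr)
    assume "\<not> (\<exists>ij\<in>I. wt ij = n)"
    hence "{ij \<in> I. wt ij = n} = {}" by blast
    hence "b n = 0" by (simp only: b_I sum.empty)
    thus False using n by simp
  qed
  have finB: "finite {n. \<not> int l dvd b n}"
    by (rule finite_subset[OF _ finite_imageI[OF finI, of wt]]) (use N_ex in blast)
  define n0 where "n0 = Max {n. \<not> int l dvd b n}"
  have n0: "\<not> int l dvd b n0" using Max_in[OF finB] bN unfolding n0_def by blast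
  have n0_max: "int l dvd b n" if "n > n0" for n
    using Max_ge[OF finB, of n] that unfolding n0_def by fastforce
  have wt_mod: "wt ij mod 24 = r" if "ij \<in> I" for ij
    using that hom by (cases ij) (auto simp: I_def wt_def)
  \<comment> \<open>The multiple of 24 lifts m above every weight, so that x^i * y^j times nome (m *
    \<tau> / 24) starts with the integral exponent (m - weight) / 24 \<ge> 0.\<close>
  define m where "m = n0 + 24 * (\<Sum>ij\<in>I. wt ij)"
  have m_ge: "wt ij \<le> m" if "ij \<in> I" for ij
    using member_le_sum[OF that, of wt] finI by (simp add: m_def)
  have n0_mod: "n0 mod 24 = r" using N_ex[OF n0] wt_mod by blast
  define e where "e = (\<lambda>n. (m - n) div 24)"
  have e24: "24 * e (wt ij) = m - wt ij" if "ij \<in> I" for ij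
  proof -
    have "m mod 24 = wt ij mod 24" using n0_mod wt_mod[OF that] by (simp add: m_def)
    hence "24 dvd m - wt ij" using m_ge[OF that] by (simp add: mod_eq_dvd_iff_nat)
    thus ?thesis by (simp add: e_def)
  qed
  define K where "K = m + 1"
  define B where "B = odd_ipoly K"
  define q where "q = (\<Sum>ij\<in>I. [:case_prod a ij:] * trunc_monomial l K (e (wt ij)) (fst ij) (snd ij))"
  define G where "G = (\<lambda>p. \<Sum>ij\<in>I. of_int (case_prod a ij) * (p ^ e (wt ij) * odd_prod p 1 ^ fst ij * odd_prod (p ^ l) 1 ^ snd ij))"
  have "G p = 0" if p: "p \<noteq> 0" "norm p \<le> 1 / 2" for p
  proof -
    obtain \<tau> where \<tau>: "Im \<tau> > 0" "nome \<tau> = p" using nome_surj[of p] p by auto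
    have l\<tau>: "Im (of_nat l * \<tau>) > 0" using \<tau>(1) level_pos by simp
    have "of_int (case_prod a ij) * (p ^ e (wt ij) * odd_prod p 1 ^ fst ij * odd_prod (p ^ l) 1 ^ snd ij) =
        nome (of_nat m * \<tau> / 24) * (case ij of (i, j) \<Rightarrow> of_int (a i j) * weber_f \<tau> ^ i * weber_f (of_nat l * \<tau>) ^ j)"
      if ij: "ij \<in> I" for ij
    proof -
      obtain i j where ij_eq: "ij = (i, j)" by force
      have "of_nat (24 * e (wt ij)) = (of_nat m - of_nat (wt ij) :: complex)"
        using e24[OF ij] m_ge[OF ij] by (simp add: of_nat_diff)
      hence e_eq: "of_nat (e (wt ij)) = (of_nat m - of_nat (i + l * j)) / (24 :: complex)"
        by (simp add: ij_eq wt_def field_simps)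
      hence "p ^ e (wt ij) = nome ((of_nat m - of_nat (i + l * j)) / 24 * \<tau>)"
        unfolding \<tau>(2) [symmetric] nome_power e_eq by simp
      also have "(of_nat m - of_nat (i + l * j)) / 24 * \<tau> =
          of_nat m * \<tau> / 24 + (of_nat i * - (\<tau> / 24) + of_nat j * - (of_nat l * \<tau> / 24))"
        by (simp add: field_simps)
      also have "nome \<dots> = nome (of_nat m * \<tau> / 24) * (nome (- (\<tau> / 24)) ^ i * nome (- (of_nat l * \<tau> / 24)) ^ j)"
        unfolding nome_add nome_power ..
      finally show ?thesis
        unfolding ij_eq weber_f_nome[OF \<tau>(1)] weber_f_nome[OF l\<tau>] nome_of_nat_mult \<tau>(2) power_mult_distrib
        by simp
    qed
    hence "G p = nome (of_nat m * \<tau> / 24) *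
        (\<Sum>ij\<in>I. case ij of (i, j) \<Rightarrow> of_int (a i j) * weber_f \<tau> ^ i * weber_f (of_nat l * \<tau>) ^ j)"
      unfolding G_def sum_distrib_left by (intro sum.cong refl)
    also have "(\<Sum>ij\<in>I. case ij of (i, j) \<Rightarrow> of_int (a i j) * weber_f \<tau> ^ i * weber_f (of_nat l * \<tau>) ^ j) =
        (\<Sum>ij\<in>box. case ij of (i, j) \<Rightarrow> of_int (a i j) * weber_f \<tau> ^ i * weber_f (of_nat l * \<tau>) ^ j)"
      by (rule sum.mono_neutral_left) (auto simp: I_def box_def)
    finally show ?thesis using van[OF \<tau>(1)] by (simp add: box_def)
  qed
  moreover have "agree K G (\<lambda>p. ipoly_at p q)"
    unfolding G_def q_def by (rule agree_trunc_combination[OF level_pos])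
  then obtain C where "\<And>p. norm p \<le> 1 / 2 \<Longrightarrow> norm (G p - ipoly_at p q) \<le> C * norm p ^ K"
    by (rule agreeE) blast
  ultimately have "norm (ipoly_at p q) \<le> C * norm p ^ K" if "p \<noteq> 0" "norm p \<le> 1 / 2" for p
    using that by (metis diff_0 norm_minus_cancel)
  hence q0: "coeff q n = 0" if "n < K" for n
    using coeff_eq_0_of_ipoly_at_order that by blast
  \<comment> \<open>Modulo l the truncation at p^l is B^l, so y becomes x^l and a term depends on
    (i, j) only through its weight and coefficient.\<close>
  define q' where "q' = (\<Sum>ij\<in>I. [:case_prod a ij:] * (monom 1 (e (wt ij)) * B ^ wt ij))"
  have "of_nat l dvd q - q'"
    unfolding q_def q'_def sum_subtractf [symmetric]
  proof (intro dvd_sum)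
    fix ij assume "ij \<in> I"
    obtain i j where ij_eq: "ij = (i, j)" by force
    have "of_nat l dvd pcompose B (monom 1 l) ^ j - (B ^ l) ^ j"
      unfolding B_def by (intro dvd_power_diff_cong Frobenius_odd_ipoly prime_level)
    moreover have "[:a i j:] * trunc_monomial l K (e (wt ij)) i j - [:a i j:] * (monom 1 (e (wt ij)) * B ^ wt ij) =
        [:a i j:] * monom 1 (e (wt ij)) * B ^ i * (pcompose B (monom 1 l) ^ j - (B ^ l) ^ j)"
    proof -
      have "B ^ wt ij = B ^ i * (B ^ l) ^ j" by (simp only: ij_eq wt_def prod.case power_add power_mult)
      thus ?thesis unfolding trunc_monomial_def B_def [symmetric] by (simp only: right_diff_distrib mult_ac)
    qed
    ultimately show "of_nat l dvd [:case_prod a ij:] * trunc_monomial l K (e (wt ij)) (fst ij) (snd ij) -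
        [:case_prod a ij:] * (monom 1 (e (wt ij)) * B ^ wt ij)"
      unfolding ij_eq by (simp only: prod.case fst_conv snd_conv dvd_mult)
  qed
  then obtain h where h: "q - q' = of_nat l * h" by blast
  have "coeff q (e n0) - coeff q' (e n0) = int l * coeff h (e n0)"
    unfolding coeff_diff [symmetric] h by (simp add: of_nat_poly)
  moreover have "coeff q (e n0) = 0" by (rule q0) (simp add: K_def e_def)
  ultimately have dq': "int l dvd coeff q' (e n0)"
    by (metis diff_0 dvd_minus_iff dvd_triv_left)
  \<comment> \<open>B has constant term 1, so this is 1 at n0; it is 0 for the smaller weights that
    occur, whose terms start at a higher power of p.\<close>
  define g where "g = (\<lambda>n. coeff (monom 1 (e n) * B ^ n) (e n0))"
  have "coeff q' (e n0) = (\<Sum>ij\<in>I. g (wt ij) * case_prod a ij)"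
    by (simp add: q'_def coeff_sum g_def mult.commute)
  also have "\<dots> = (\<Sum>n\<in>wt ` I. \<Sum>ij\<in>{ij \<in> I. wt ij = n}. g (wt ij) * case_prod a ij)"
    by (rule sum.image_gen[OF finI])
  also have "\<dots> = (\<Sum>n\<in>wt ` I. g n * b n)"
    unfolding b_I sum_distrib_left by (intro sum.cong) auto
  finally have "coeff q' (e n0) = (\<Sum>n\<in>wt ` I. g n * b n)" .
  moreover have "n0 \<in> wt ` I" using N_ex[OF n0] by blast
  ultimately have split: "coeff q' (e n0) = g n0 * b n0 + (\<Sum>n\<in>wt ` I - {n0}. g n * b n)"
    using finI by (simp add: sum.remove)
  have "int l dvd (\<Sum>n\<in>wt ` I - {n0}. g n * b n)"
  proof (intro dvd_sum)
    fix n assume n: "n \<in> wt ` I - {n0}"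
    show "int l dvd g n * b n"
    proof (cases "n > n0")
      case True
      thus ?thesis using n0_max by simp
    next
      case False
      obtain ij where ij: "ij \<in> I" "wt ij = n" using n by blast
      obtain ij0 where ij0: "ij0 \<in> I" "wt ij0 = n0" using N_ex[OF n0] by blast
      have "24 * e n = m - n" "24 * e n0 = m - n0" "n \<le> m"
        using e24[OF ij(1)] e24[OF ij0(1)] m_ge[OF ij(1)] ij ij0 by simp_all
      hence "e n0 < e n" using False n m_ge[OF ij0(1)] ij0(2) by auto
      hence "g n = 0" by (simp add: g_def coeff_monom_mult)
      thus ?thesis by simp
    qed
  qed
  moreover have "g n0 = 1"
    by (simp add: g_def coeff_monom_mult coeff_0_power B_def coeff_0_odd_ipoly)
  ultimately have "int l dvd b n0" using dq' unfolding split by (simp add: dvd_add_left_iff)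
  thus False using n0 by blast
qed

text \<open>With i at most l + 1 the weight i + l * j determines (i, j) except for one carry: i = 0
  or 1 shares its weight with i + l at the next lower j. Each congruence thus involves one or two
  coefficients.\<close>

lemma Kronecker_pairs:
  fixes a :: "nat \<Rightarrow> nat \<Rightarrow> int"
  assumes van: "\<And>\<tau>. Im \<tau> > 0 \<Longrightarrow>
      (\<Sum>(i, j)\<in>{..l + 1} \<times> {..l + 1}. of_int (a i j) * weber_f \<tau> ^ i * weber_f (of_nat l * \<tau>) ^ j) = 0"
    and hom: "\<And>i j. a i j \<noteq> 0 \<Longrightarrow> (i + l * j) mod 24 = r"
  shows "\<And>i j. 2 \<le> i \<Longrightarrow> i < l \<Longrightarrow> j \<le> l + 1 \<Longrightarrow> int l dvd a i j"
    and "\<And>i. i \<le> 1 \<Longrightarrow> int l dvd a i 0"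
    and "\<And>i. i \<le> 1 \<Longrightarrow> int l dvd a (l + i) (l + 1)"
    and "\<And>i j. i \<le> 1 \<Longrightarrow> j \<le> l \<Longrightarrow> int l dvd a i (j + 1) + a (l + i) j"
proof -
  have K: "int l dvd (\<Sum>(i, j)\<in>{(i, j) \<in> {..l + 1} \<times> {..l + 1}. i + l * j = N}. a i j)" for N
    by (rule Kronecker_congruence[OF van hom])
  have l5: "l \<ge> 5" by (rule level_ge_5)
  have digit: "i = i' \<and> j = j' \<or> i = i' + l \<and> j' = j + 1 \<or> i' = i + l \<and> j = j' + 1"
    if "i + l * j = i' + l * j'" "i \<le> l + 1" "i' \<le> l + 1" for i j i' j'
  proof -
    consider "j = j'" | k where "j' = j + Suc k" | k where "j = j' + Suc k"
      by (metis less_imp_Suc_add linorder_neqE_nat add_Suc_right)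
    thus ?thesis
    proof cases
      case 1
      thus ?thesis using that by simp
    next
      case (2 k)
      hence "i = i' + l + l * k" using that(1) by (simp add: algebra_simps)
      \<comment> \<open>A carry by two or more would require i \<ge> 2 * l, which exceeds l +
        1.\<close>
      moreover from this have "k = 0" using that(2) l5 by (cases k) auto
      ultimately show ?thesis using 2 by simp
    next
      case (3 k)
      hence "i' = i + l + l * k" using that(1) by (simp add: algebra_simps)
      moreover from this have "k = 0" using that(3) l5 by (cases k) auto
      ultimately show ?thesis using 3 by simp
    qed
  qed
  have fiber: "int l dvd (\<Sum>(i', j')\<in>S. a i' j')"
    if "i \<le> l + 1" and S: "S = {(i', j') \<in> {..l + 1} \<times> {..l + 1}.
      i' = i \<and> j' = j \<or> i' = i + l \<and> j = j' + 1 \<or> i = i' + l \<and> j' = j + 1}" for i j S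
  proof -
    have "S = {(i', j') \<in> {..l + 1} \<times> {..l + 1}. i' + l * j' = i + l * j}"
      unfolding S using digit[of _ _ i j] that(1) by (auto simp: algebra_simps)
    thus ?thesis using K by simp
  qed
  show "int l dvd a i j" if "2 \<le> i" "i < l" "j \<le> l + 1" for i j
    using fiber[of i "{(i, j)}" j] that l5 by fastforce
  show "int l dvd a i 0" if "i \<le> 1" for i
    using fiber[of i "{(i, 0)}" 0] that l5 by fastforce
  show "int l dvd a (l + i) (l + 1)" if "i \<le> 1" for i
    using fiber[of "l + i" "{(l + i, l + 1)}" "l + 1"] that l5 by fastforce
  show "int l dvd a i (j + 1) + a (l + i) j" if "i \<le> 1" "j \<le> l" for i j
    using fiber[of i "{(i, j + 1), (l + i, j)}" "j + 1"] that l5 by fastforce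
qed

text \<open>The congruences for the coefficients and for their transposes leave, modulo l, one free
  scalar, the coefficient of x * y. If it is 0, then l divides P, which is impossible for an
  irreducible P of positive degree in y.\<close>

theorem coeff_1_1_not_dvd:
  assumes irr: "irreducible P" and van: "vanishes P"
  shows "\<not> int l dvd coeff (coeff P 1) 1"
proof
  assume d11: "int l dvd coeff (coeff P 1) 1"
  define a where "a = (\<lambda>i j. coeff (coeff P j) i)"
  have P0: "P \<noteq> 0" using irr by auto
  have l5: "l \<ge> 5" by (rule level_ge_5)
  have eval: "eval_xy P x y = (\<Sum>(i, j)\<in>{..l + 1} \<times> {..l + 1}. of_int (a i j) * x ^ i * y ^ j)" for x y
  proof -
    have "eval_xy P x y = (\<Sum>j\<le>l + 1. \<Sum>i\<le>degree (coeff P j). of_int (a i j) * x ^ i * y ^ j)"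
      unfolding eval_xy_altdef a_def using vanishes_degree_bounds(1)[OF irr van]
      by (intro sum.mono_neutral_left) (auto simp: coeff_eq_0)
    also have "\<dots> = (\<Sum>j\<le>l + 1. \<Sum>i\<le>l + 1. of_int (a i j) * x ^ i * y ^ j)"
      using vanishes_degree_bounds(2)[OF irr van]
      by (intro sum.cong sum.mono_neutral_left) (auto simp: coeff_eq_0 a_def)
    also have "\<dots> = (\<Sum>i\<le>l + 1. \<Sum>j\<le>l + 1. of_int (a i j) * x ^ i * y ^ j)"
      by (rule sum.swap)
    finally show ?thesis by (simp only: sum.cartesian_product)
  qed
  obtain i0 j0 where a0: "a i0 j0 \<noteq> 0"
    using P0 unfolding a_def by (metis leading_coeff_0_iff)
  define r where "r = (i0 + l * j0) mod 24"
  have hom: "(i + l * j) mod 24 = r" if "a i j \<noteq> 0" for i j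
    using vanishes_homogeneous[OF irr van] that a0 unfolding a_def r_def by blast
  \<comment> \<open>Transposition multiplies weights by l modulo 24, because l^2 is 1 there; so the
    transposed coefficients are homogeneous as well.\<close>
  have hom': "(i + l * j) mod 24 = (l * r) mod 24" if "a j i \<noteq> 0" for i j
  proof -
    have "(l * r) mod 24 = (l * (j + l * i)) mod 24"
      unfolding hom[OF that, symmetric] by (simp add: mod_mult_right_eq)
    moreover have "[int (l * (j + l * i)) = int (i + l * j)] (mod 24)"
    proof -
      have "int (l * (j + l * i)) - int (i + l * j) = (int l * int l - 1) * int i"
        by (simp add: algebra_simps)
      thus ?thesis using level_square by (simp add: cong_iff_dvd_diff)
    qed
    hence "(l * (j + l * i)) mod 24 = (i + l * j) mod 24"
      using cong_int_iff[of "l * (j + l * i)" "i + l * j" 24] by (simp add: cong_def)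
    ultimately show ?thesis by simp
  qed
  have vanP: "(\<Sum>(i, j)\<in>{..l + 1} \<times> {..l + 1}. of_int (a i j) * weber_f \<tau> ^ i * weber_f (of_nat l * \<tau>) ^ j) = 0"
    if "Im \<tau> > 0" for \<tau>
    using van that unfolding vanishes_def eval by blast
  have vanP': "(\<Sum>(i, j)\<in>{..l + 1} \<times> {..l + 1}. of_int (a j i) * weber_f \<tau> ^ i * weber_f (of_nat l * \<tau>) ^ j) = 0"
    if \<tau>: "Im \<tau> > 0" for \<tau>
  proof -
    obtain \<sigma> where \<sigma>: "Im \<sigma> > 0" "weber_f \<sigma> = weber_f (of_nat l * \<tau>)" "weber_f (of_nat l * \<sigma>) = weber_f \<tau>"
      using weber_f_swap[OF \<tau>] .
    have "(\<Sum>(i, j)\<in>{..l + 1} \<times> {..l + 1}. of_int (a j i) * weber_f \<tau> ^ i * weber_f (of_nat l * \<tau>) ^ j) =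
        (\<Sum>(i, j)\<in>{..l + 1} \<times> {..l + 1}. of_int (a i j) * weber_f \<sigma> ^ i * weber_f (of_nat l * \<sigma>) ^ j)"
      unfolding \<sigma>(2,3)
      by (rule sum.reindex_bij_witness[of _ "\<lambda>(i, j). (j, i)" "\<lambda>(i, j). (j, i)"]) auto
    thus ?thesis using vanP[OF \<sigma>(1)] by simp
  qed
  note R = Kronecker_pairs[OF vanP hom]
  note S = Kronecker_pairs[of "\<lambda>i j. a j i", OF vanP' hom']
  have second: "int l dvd y" if "int l dvd x + y" "int l dvd x" for x y
    using that by (simp add: dvd_add_right_iff)
  have a11: "int l dvd a 1 1" using d11 by (simp add: a_def)
  \<comment> \<open>What remains after 2 \<le> i < l and 2 \<le> j < l are the sixteen positions
    with i and j in {0, 1, l, l + 1}; carry pairs spread divisibility over them.\<close>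
  have a_low: "int l dvd a 0 0" "int l dvd a 1 0" "int l dvd a 0 1"
    using R(2)[of 0] R(2)[of 1] S(2)[of 1] by simp_all
  have al0: "int l dvd a l 0" using second[OF R(4)[of 0 0]] a_low by simp
  have al0': "int l dvd a (l + 1) 0" using second[OF R(4)[of 1 0]] a11 by simp
  have al1: "int l dvd a l 1" using second[OF R(4)[of 0 1]] S(1)[of 2 0] l5 by (simp add: numeral_2_eq_2)
  have al1': "int l dvd a (l + 1) 1" using second[OF R(4)[of 1 1]] S(1)[of 2 1] l5 by (simp add: numeral_2_eq_2)
  have a0l: "int l dvd a 0 l" using second[OF S(4)[of 0 0]] a_low by simp
  have a0l': "int l dvd a 0 (l + 1)" using second[OF S(4)[of 1 0]] a11 by simp
  have a1l: "int l dvd a 1 l" using second[OF S(4)[of 0 1]] R(1)[of 2 0] l5 by (simp add: numeral_2_eq_2)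
  have a1l': "int l dvd a 1 (l + 1)" using second[OF S(4)[of 1 1]] R(1)[of 2 1] l5 by (simp add: numeral_2_eq_2)
  have all: "int l dvd a l l" using second[OF R(4)[of 0 l]] a0l' by simp
  have all': "int l dvd a (l + 1) l" using S(3)[of 0] by simp
  have all'': "int l dvd a l (l + 1)" "int l dvd a (l + 1) (l + 1)" using R(3)[of 0] R(3)[of 1] by simp_all
  have dvd_a: "int l dvd a i j" for i j
  proof (cases "i \<le> l + 1 \<and> j \<le> l + 1")
    case False
    hence "a i j = 0"
      using vanishes_degree_bounds[OF irr van] unfolding a_def
      by (metis coeff_0 coeff_eq_0 le_less_trans linorder_not_le)
    thus ?thesis by simp
  next
    case True
    consider "2 \<le> i" "i < l" | "2 \<le> j" "j < l" | "i \<in> {0, 1, l, l + 1}" "j \<in> {0, 1, l, l + 1}"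
      using True by force
    thus ?thesis
    proof cases
      case 1
      thus ?thesis using R(1) True by blast
    next
      case 2
      thus ?thesis using S(1) True by blast
    next
      case 3
      thus ?thesis using a11 a_low al0 al0' al1 al1' a0l a0l' a1l a1l' all all' all'' by auto
    qed
  qed
  \<comment> \<open>The constant l is not a unit, so the cofactor would be one and P would have
    degree 0 in y.\<close>
  have "[:[:int l:]:] dvd P"
    unfolding const_poly_dvd_iff using dvd_a by (simp add: a_def)
  then obtain Q where Q: "P = [:[:int l:]:] * Q" by blast
  have "\<not> [:[:int l:]:] dvd (1 :: int poly poly)"
    using l5 by (simp add: is_unit_const_poly_iff)
  hence "Q dvd 1" using irreducibleD[OF irr Q] by blast
  hence "degree Q = 0" using dvd_imp_degree_le[of Q 1] by simp
  hence "degree P = 0" unfolding Q by (metis degree_mult_le degree_pCons_0 add_0 le_zero_eq)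
  thus False using vanishes_degree_pos[OF van P0] by simp
qed

end

theorem corollary2:
  fixes l :: nat and \<Phi> :: "int poly poly"
  assumes "prime l" and "\<not> l dvd 48"
    and "is_weber_modular_poly l \<Phi>"
  shows "\<forall>i j. coeff (coeff \<Phi> j) i \<noteq> 0 \<longrightarrow> [i + l * j = l + 1] (mod 24)"
proof (intro allI impI)
  fix i j assume ij: "coeff (coeff \<Phi> j) i \<noteq> 0"
  interpret weber_level l by unfold_locales (fact assms)+
  have irr: "irreducible \<Phi>" and van: "vanishes \<Phi>"
    using assms(3) by (auto simp: is_weber_modular_poly_def vanishes_def)
  have "coeff (coeff \<Phi> 1) 1 \<noteq> 0"
    using coeff_1_1_not_dvd[OF irr van] by auto
  \<comment> \<open>The reference monomial x * y has weight 1 + l.\<close>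
  from vanishes_homogeneous[OF irr van ij this] show "[i + l * j = l + 1] (mod 24)"
    by (simp add: cong_def)
qed

end
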